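(* For every $V > 0$, $\omega \in \mathbb{T}$, $0 \not= \psi \in \ell^2(\mathbb{Z})$, and $p > 0$, we have $$\beta_\psi^\pm(p) \ge \frac{2 \log \left( 1 + \frac{1}{(2+2V)^2} \right)}{\log \left( 1 + \frac{1}{(2+2V)^2} \right) + 16 \cdot \log \left( \frac{\sqrt{5} + 1}{2} \right) + 16 \log [(5 + 2V)^{1/2}(3+V) a_V]},$$ where the time-average is given by $\langle f \rangle(T) = \frac{1}{T} \int_0^T f(t)\,dt$.
   Context: Let $\alpha = \frac{\sqrt{5}-1}{2}$. For $V>0$ and $\omega \in \mathbb{T} = \mathbb{R}/\mathbb{Z}$, the Fibonacci Hamiltonian is the bounded self-adjoint operator on $\ell^2(\mathbb{Z})$ given by $$[H_{V,\omega} \psi](n) = \psi(n+1) + \psi(n-1) + V \chi_{[1-\alpha,1)}(n\alpha + \omega \bmod 1)\, \psi(n).$$ $a_V$ denotes the largest root of the polynomial $x^3-(2+V)x-1$. Transport exponents: for $\psi\in\ell^2(\mathbb{Z})$ and $p>0$ put $$\langle |X|_\psi^p\rangle(t) = \sum_{n\in\mathbb{Z}} |n|^p\, |\langle \delta_n, e^{-itH_{V,\omega}}\psi\rangle|^2 ,$$ let $\langle\langle |X|_\psi^p\rangle\rangle(T)$ denote the time average $\langle f\rangle(T)$ of $f(t)=\langle |X|_\psi^p\rangle(t)$ (values $+\infty$ are allowed), and define $$\beta_\psi^+(p) = \limsup_{T\to\infty} \frac{\log \langle\langle |X|_\psi^p\rangle\rangle(T)}{p\log T}, \qquad \beta_\psi^-(p)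 = \liminf_{T\to\infty} \frac{\log \langle\langle |X|_\psi^p\rangle\rangle(T)}{p\log T}.$$ The inequality is asserted for both $\beta^+_\psi$ and $\beta^-_\psi$. *)

theory Defs
  imports "HOL-Analysis.Analysis"
begin

definition ell2 :: "(int \<Rightarrow> complex) set" where
  "ell2 = {\<psi>. (\<lambda>n. (cmod (\<psi> n))\<^sup>2) summable_on UNIV}"

definition ell2_norm :: "(int \<Rightarrow> complex) \<Rightarrow> real" where
  "ell2_norm \<psi> = sqrt (\<Sum>\<^sub>\<infinity>n. (cmod (\<psi> n))\<^sup>2)"

definition alpha :: real where
  "alpha = (sqrt 5 - 1) / 2"

(* The phase is taken in \<real> rather than in \<real> / \<int>; frac makes the operator 1-periodic in it. *)
definition fib_potential :: "real \<Rightarrow> real \<Rightarrow> int \<Rightarrow> real" where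
  "fib_potential V \<omega> n = V * indicator {1 - alpha..<1} (frac (of_int n * alpha + \<omega>))"

definition fib_H :: "real \<Rightarrow> real \<Rightarrow> (int \<Rightarrow> complex) \<Rightarrow> int \<Rightarrow> complex" where
  "fib_H V \<omega> \<psi> = (\<lambda>n. \<psi> (n + 1) + \<psi> (n - 1) + of_real (fib_potential V \<omega> n) * \<psi> n)"

(* exp(- i t H) \<psi> by the exponential series. The sum is written coordinatewise; the series also
   converges to it in the ell2 norm, see evolution_ell2_limit below. *)
definition evolution :: "real \<Rightarrow> real \<Rightarrow> real \<Rightarrow> (int \<Rightarrow> complex) \<Rightarrow> int \<Rightarrow> complex" where
  "evolution V \<omega> t \<psi> n = (\<Sum>k. (- \<i> * of_real t) ^ k / fact k * (fib_H V \<omega> ^^ k) \<psi> n)"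

(* The inner product with the basis vector at n is evaluation at n. *)
definition moment :: "real \<Rightarrow> real \<Rightarrow> (int \<Rightarrow> complex) \<Rightarrow> real \<Rightarrow> real \<Rightarrow> ennreal" where
  "moment V \<omega> \<psi> p t =
     (\<Sum>\<^sub>\<infinity>n. ennreal (\<bar>of_int n\<bar> powr p * (cmod (evolution V \<omega> t \<psi> n))\<^sup>2))"

definition time_average :: "(real \<Rightarrow> ennreal) \<Rightarrow> real \<Rightarrow> ennreal" where
  "time_average f T = (\<integral>\<^sup>+t\<in>{0..T}. f t \<partial>lborel) / ennreal T"

definition ennreal_ln :: "ennreal \<Rightarrow> ereal" where
  "ennreal_ln x = (if x = 0 then -\<infinity> else if x = \<infinity> then \<infinity> else ereal (ln (enn2real x)))"

definition transport_quotient ::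
    "real \<Rightarrow> real \<Rightarrow> (int \<Rightarrow> complex) \<Rightarrow> real \<Rightarrow> real \<Rightarrow> ereal" where
  "transport_quotient V \<omega> \<psi> p T =
     ennreal_ln (time_average (moment V \<omega> \<psi> p) T) / ereal (p * ln T)"

definition beta_plus :: "real \<Rightarrow> real \<Rightarrow> (int \<Rightarrow> complex) \<Rightarrow> real \<Rightarrow> ereal" where
  "beta_plus V \<omega> \<psi> p = Limsup at_top (transport_quotient V \<omega> \<psi> p)"

definition beta_minus :: "real \<Rightarrow> real \<Rightarrow> (int \<Rightarrow> complex) \<Rightarrow> real \<Rightarrow> ereal" where
  "beta_minus V \<omega> \<psi> p = Liminf at_top (transport_quotient V \<omega> \<psi> p)"

definition largest_root :: "real \<Rightarrow> real" where
  "largest_root V = Max {x::real. x ^ 3 - (2 + V) * x - 1 = 0}"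

lemma largest_root:
  assumes "V > 0"
  shows "largest_root V ^ 3 - (2 + V) * largest_root V - 1 = 0" "largest_root V > 0"
    "x ^ 3 - (2 + V) * x - 1 = 0 \<Longrightarrow> x \<le> largest_root V"
proof -
  let ?R = "{x::real. x ^ 3 - (2 + V) * x - 1 = 0}"
  have "?R = {x. poly [:- 1, - (2 + V), 0, 1:] x = 0}"
    by (auto simp: algebra_simps power3_eq_cube)
  then have fin: "finite ?R"
    using poly_roots_finite[of "[:- 1, - (2 + V), 0, 1:]"] by simp
  have "\<exists>x\<ge>0. x \<le> 3 + V \<and> x ^ 3 - (2 + V) * x - 1 = 0"
  proof (rule IVT')
    have "(3 + V) ^ 3 - (2 + V) * (3 + V) - 1 = V ^ 3 + 8 * V ^ 2 + 22 * V + 20"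
      by algebra
    with assms show "0 \<le> (3 + V) ^ 3 - (2 + V) * (3 + V) - 1"
      by simp
    show "continuous_on {0..3 + V} (\<lambda>x. x ^ 3 - (2 + V) * x - 1)"
      by (intro continuous_intros)
  qed (use assms in auto)
  then obtain r where r: "r \<ge> 0" "r \<in> ?R"
    by auto
  then have "r \<noteq> 0"
    by auto
  have "Max ?R \<in> ?R"
    using r(2) by (intro Max_in fin) blast
  then show "largest_root V ^ 3 - (2 + V) * largest_root V - 1 = 0"
    by (simp add: largest_root_def)
  have "r \<le> Max ?R"
    using fin r(2) by (rule Max_ge)
  then show "largest_root V > 0"
    using r(1) \<open>r \<noteq> 0\<close> by (simp add: largest_root_def)
  show "x \<le> largest_root V" if "x ^ 3 - (2 + V) * x - 1 = 0" for x
    using Max_ge[OF fin, of x] that by (simp add: largest_root_def)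
qed

lemma ell2_norm_nonneg [simp]: "ell2_norm \<psi> \<ge> 0"
  by (simp add: ell2_norm_def infsum_nonneg)

lemma L2_set_le_ell2_norm:
  assumes "\<psi> \<in> ell2" "finite F"
  shows "L2_set (\<lambda>n. cmod (\<psi> n)) F \<le> ell2_norm \<psi>"
  using assms unfolding L2_set_def ell2_norm_def ell2_def
  by (auto intro!: finite_sum_le_infsum)

lemma ell2_bound:
  assumes "\<And>F. finite F \<Longrightarrow> L2_set (\<lambda>n. cmod (\<psi> n)) F \<le> B"
  shows "\<psi> \<in> ell2" "ell2_norm \<psi> \<le> B"
proof -
  have "B \<ge> 0"
    using assms[of "{}"] by simp
  have sq: "(\<Sum>n\<in>F. (cmod (\<psi> n))\<^sup>2) \<le> B\<^sup>2" if "finite F" for F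
  proof -
    have "(L2_set (\<lambda>n. cmod (\<psi> n)) F)\<^sup>2 \<le> B\<^sup>2"
      using assms[OF that] by (intro power_mono) auto
    then show ?thesis
      by (simp add: L2_set_def sum_nonneg)
  qed
  have sum: "(\<lambda>n. (cmod (\<psi> n))\<^sup>2) summable_on UNIV"
    by (rule nonneg_bdd_above_summable_on) (auto intro!: bdd_aboveI2 sq)
  then show "\<psi> \<in> ell2"
    by (simp add: ell2_def)
  have "(\<Sum>\<^sub>\<infinity>n. (cmod (\<psi> n))\<^sup>2) \<le> B\<^sup>2"
    using sum by (rule infsum_le_finite_sums) (use sq in auto)
  then have "ell2_norm \<psi> \<le> sqrt (B\<^sup>2)"
    unfolding ell2_norm_def by (rule real_sqrt_le_mono)
  then show "ell2_norm \<psi> \<le> B"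
    using \<open>B \<ge> 0\<close> by simp
qed

lemma cmod_le_ell2_norm:
  assumes "\<psi> \<in> ell2"
  shows "cmod (\<psi> n) \<le> ell2_norm \<psi>"
  using L2_set_le_ell2_norm[OF assms, of "{n}"] by simp

lemma fib_potential_bounds:
  assumes "V > 0"
  shows "0 \<le> fib_potential V \<omega> n" "fib_potential V \<omega> n \<le> V"
  using assms by (auto simp: fib_potential_def indicator_def)

lemma fib_H_ell2:
  assumes V: "V > 0" and \<psi>: "\<psi> \<in> ell2"
  shows "fib_H V \<omega> \<psi> \<in> ell2" "ell2_norm (fib_H V \<omega> \<psi>) \<le> (2 + V) * ell2_norm \<psi>"
proof -
  have shift: "L2_set (\<lambda>n. cmod (\<psi> (n + c))) F \<le> ell2_norm \<psi>" if "finite F" for F c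
  proof -
    have "L2_set (\<lambda>n. cmod (\<psi> (n + c))) F = L2_set (\<lambda>n. cmod (\<psi> n)) ((\<lambda>n. n + c) ` F)"
      unfolding L2_set_def by (subst sum.reindex) auto
    also have "\<dots> \<le> ell2_norm \<psi>"
      using \<psi> that by (intro L2_set_le_ell2_norm) auto
    finally show ?thesis .
  qed
  have "L2_set (\<lambda>n. cmod (fib_H V \<omega> \<psi> n)) F \<le> (2 + V) * ell2_norm \<psi>" if F: "finite F" for F
  proof -
    have "L2_set (\<lambda>n. cmod (fib_H V \<omega> \<psi> n)) F
        \<le> L2_set (\<lambda>n. (cmod (\<psi> (n + 1)) + cmod (\<psi> (n + -1))) + V * cmod (\<psi> n)) F"
    proof (rule L2_set_mono)
      fix n
      have "cmod (fib_H V \<omega> \<psi> n)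
          \<le> cmod (\<psi> (n + 1)) + cmod (\<psi> (n - 1)) + fib_potential V \<omega> n * cmod (\<psi> n)"
        unfolding fib_H_def
        by (intro norm_triangle_mono norm_triangle_ineq)
           (simp add: norm_mult fib_potential_bounds[OF V])
      also have "\<dots> \<le> cmod (\<psi> (n + 1)) + cmod (\<psi> (n - 1)) + V * cmod (\<psi> n)"
        using fib_potential_bounds[OF V] by (intro add_left_mono mult_right_mono) auto
      finally show "cmod (fib_H V \<omega> \<psi> n)
          \<le> (cmod (\<psi> (n + 1)) + cmod (\<psi> (n + -1))) + V * cmod (\<psi> n)"
        by simp
    qed simp
    also have "\<dots> \<le> L2_set (\<lambda>n. cmod (\<psi> (n + 1)) + cmod (\<psi> (n + -1))) F
        + L2_set (\<lambda>n. V * cmod (\<psi> n)) F"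
      by (rule L2_set_triangle_ineq)
    also have "\<dots> \<le> (L2_set (\<lambda>n. cmod (\<psi> (n + 1))) F + L2_set (\<lambda>n. cmod (\<psi> (n + -1))) F)
        + V * L2_set (\<lambda>n. cmod (\<psi> n)) F"
      using V by (intro add_mono L2_set_triangle_ineq) (simp add: L2_set_right_distrib)
    also have "\<dots> \<le> (ell2_norm \<psi> + ell2_norm \<psi>) + V * ell2_norm \<psi>"
      using V F \<psi> by (intro add_mono shift mult_left_mono L2_set_le_ell2_norm) auto
    finally show ?thesis
      by (simp add: algebra_simps)
  qed
  then show "fib_H V \<omega> \<psi> \<in> ell2" "ell2_norm (fib_H V \<omega> \<psi>) \<le> (2 + V) * ell2_norm \<psi>"
    using ell2_bound by blast+
qed

lemma fib_H_power_ell2: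
  assumes V: "V > 0" and \<psi>: "\<psi> \<in> ell2"
  shows "(fib_H V \<omega> ^^ k) \<psi> \<in> ell2 \<and>
    ell2_norm ((fib_H V \<omega> ^^ k) \<psi>) \<le> (2 + V) ^ k * ell2_norm \<psi>"
proof (induction k)
  case 0
  show ?case using \<psi> by simp
next
  case (Suc k)
  let ?\<phi> = "(fib_H V \<omega> ^^ k) \<psi>"
  have "ell2_norm (fib_H V \<omega> ?\<phi>) \<le> (2 + V) * ell2_norm ?\<phi>"
    using Suc by (intro fib_H_ell2 V) auto
  also have "\<dots> \<le> (2 + V) * ((2 + V) ^ k * ell2_norm \<psi>)"
    using Suc V by (intro mult_left_mono) auto
  finally show ?case
    using Suc fib_H_ell2(1)[OF V] by (auto simp: mult.assoc)
qed

lemma evolution_ell2_limit: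
  fixes V \<omega> t :: real and \<psi> :: "int \<Rightarrow> complex"
  assumes V: "V > 0" and \<psi>: "\<psi> \<in> ell2"
  defines "s \<equiv> \<lambda>N n. \<Sum>k<N. (- \<i> * of_real t) ^ k / fact k * (fib_H V \<omega> ^^ k) \<psi> n"
  shows "evolution V \<omega> t \<psi> \<in> ell2"
    "(\<lambda>N. ell2_norm (\<lambda>n. evolution V \<omega> t \<psi> n - s N n)) \<longlonglongrightarrow> 0"
proof -
  define a where "a k = (\<bar>t\<bar> * (2 + V)) ^ k / fact k * ell2_norm \<psi>" for k
  define u where "u k n = (- \<i> * of_real t) ^ k / fact k * (fib_H V \<omega> ^^ k) \<psi> n" for k n
  have a_nonneg: "a k \<ge> 0" for k
    using V by (simp add: a_def)
  have "summable (\<lambda>k. (\<bar>t\<bar> * (2 + V)) ^ k / fact k)"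
    using summable_exp[of "\<bar>t\<bar> * (2 + V)"] by (simp add: field_simps)
  then have a_summable: "summable a"
    unfolding a_def by (rule summable_mult2)
  have u_bound: "L2_set (\<lambda>n. cmod (u k n)) F \<le> a k" if "finite F" for k F
  proof -
    have "L2_set (\<lambda>n. cmod (u k n)) F
        = \<bar>t\<bar> ^ k / fact k * L2_set (\<lambda>n. cmod ((fib_H V \<omega> ^^ k) \<psi> n)) F"
      by (subst L2_set_right_distrib) (simp_all add: u_def norm_mult norm_divide norm_power)
    also have "\<dots> \<le> \<bar>t\<bar> ^ k / fact k * ((2 + V) ^ k * ell2_norm \<psi>)"
      using fib_H_power_ell2[OF V \<psi>] L2_set_le_ell2_norm[OF _ that]
      by (intro mult_left_mono) (auto intro: order_trans)
    finally show ?thesis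
      by (simp add: a_def power_mult_distrib)
  qed
  have u_summable: "summable (\<lambda>k. u k n)" for n
    by (rule summable_comparison_test'[OF a_summable, of 0]) (use u_bound[of "{n}"] in simp)
  have part: "L2_set (\<lambda>n. cmod (\<Sum>k<M. u (k + N) n)) F \<le> (\<Sum>k<M. a (k + N))"
    if F: "finite F" for F M N
  proof (induction M)
    case (Suc M)
    have "L2_set (\<lambda>n. cmod (\<Sum>k<Suc M. u (k + N) n)) F
        \<le> L2_set (\<lambda>n. cmod (\<Sum>k<M. u (k + N) n) + cmod (u (M + N) n)) F"
      by (intro L2_set_mono) (auto intro: norm_triangle_ineq)
    also have "\<dots> \<le> L2_set (\<lambda>n. cmod (\<Sum>k<M. u (k + N) n)) F + L2_set (\<lambda>n. cmod (u (M + N) n)) F"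
      by (rule L2_set_triangle_ineq)
    also have "\<dots> \<le> (\<Sum>k<Suc M. a (k + N))"
      using Suc u_bound[OF F] by (simp add: add_mono)
    finally show ?case .
  qed (simp add: L2_set_def)
  have tail: "L2_set (\<lambda>n. cmod (evolution V \<omega> t \<psi> n - s N n)) F \<le> (\<Sum>k. a (k + N))"
    if F: "finite F" for F N
  proof (rule LIMSEQ_le_const2)
    have "(\<lambda>M. \<Sum>k<M. u (k + N) n) \<longlonglongrightarrow> evolution V \<omega> t \<psi> n - s N n" for n
      using summable_LIMSEQ[OF summable_ignore_initial_segment[OF u_summable[of n], of N]]
        suminf_minus_initial_segment[OF u_summable, of N n]
      unfolding evolution_def s_def u_def[symmetric] by simp
    then show "(\<lambda>M. L2_set (\<lambda>n. cmod (\<Sum>k<M. u (k + N) n)) F)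
        \<longlonglongrightarrow> L2_set (\<lambda>n. cmod (evolution V \<omega> t \<psi> n - s N n)) F"
      unfolding L2_set_def by (intro tendsto_intros)
    have "(\<Sum>k<M. a (k + N)) \<le> (\<Sum>k. a (k + N))" for M
      using a_summable a_nonneg by (intro sum_le_suminf summable_ignore_initial_segment) auto
    then show "\<exists>M0. \<forall>M\<ge>M0. L2_set (\<lambda>n. cmod (\<Sum>k<M. u (k + N) n)) F \<le> (\<Sum>k. a (k + N))"
      using part[OF F] order_trans by blast
  qed
  show "evolution V \<omega> t \<psi> \<in> ell2"
    using ell2_bound(1)[of "evolution V \<omega> t \<psi>" "\<Sum>k. a k"] tail[of _ 0] by (simp add: s_def)
  have le: "ell2_norm (\<lambda>n. evolution V \<omega> t \<psi> n - s N n) \<le> (\<Sum>k. a (k + N))" for N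
    by (rule ell2_bound(2)) (rule tail)
  have "(\<lambda>N. \<Sum>k. a (k + N)) \<longlonglongrightarrow> 0"
    using suminf_exist_split2[OF a_summable] by simp
  then show "(\<lambda>N. ell2_norm (\<lambda>n. evolution V \<omega> t \<psi> n - s N n)) \<longlonglongrightarrow> 0"
    by (rule tendsto_sandwich[OF _ _ tendsto_const, rotated 2]) (simp_all add: le)
qed

end

theory Submission
  imports Defs "HOL-Number_Theory.Fib" "HOL-Probability.Probability"
begin

text \<open>
  The exponent comes from a stationary argument at complex energies \<open>z = E + i / T\<close>. The Laplace transform
  of \<open>exp (- i t H) \<delta>\<^sub>m\<close> solves the difference equation at \<open>z\<close> away from \<open>m\<close>, and by Plancherel the
  averaged probability of finding the particle near \<open>m\<close> is an integral over \<open>E\<close> of the mass of these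
  solutions in a window around \<open>m\<close>.

  On the right and on the left of any point, one of four consecutive Fibonacci numbers \<open>p\<close> is a period of the
  potential over more than \<open>p\<close> sites, so that \<open>u (n) + u (n + 2 p) = x u (n + p)\<close> for solutions, where
  \<open>x\<close> is the trace of the transfer matrix over one period. As long as these traces are bounded, the mass in a window
  is hence a fixed fraction smaller than the mass in a window a constant factor longer.

  If the Laplace transform is not small in norm, then it is an approximate eigenvector; cutting it off and placing it on a
  ring of Fibonacci length produces a true eigenvalue \<open>E'\<close> of a periodic operator close to \<open>E\<close>. There one trace
  of high index is 2, so the trace map cannot have escaped before, all earlier traces are bounded, and the
  recursion carries the bound over to \<open>z\<close> up to a scale that is a power of \<open>T\<close>.

  The result is the exponent \<open>ln 8 / (48 ln (8 + V))\<close>, which exceeds the claimed one. Linear combinations and an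
  approximation in norm extend it from point masses to all initial states.
\<close>

section \<open>Transfer matrices and the trace map\<close>

text \<open>The growth factor of the mass does not enter the exponent. A window of about 8^i sites
  (Fibonacci index 6 i) is compared with one of index 12 i, and i growth steps fit in between. It is
  enough that the i-th power of the factor tends to infinity: then at most a quarter of the squared
  norm stays in the window on time average, and the moment of order p is at least of order 8^(i p).
  Only the relation between i and T counts.

  A period may be as long as the Fibonacci number of index k + 4, and two periods plus a window fit
  into index k + 6, so a growth step costs 6 indices and traces up to index 12 i have to be bounded.
  Carrying the bounds from E' to z costs a factor 8 + V per index.

  The obstacle is the energies where the Laplace transform is small in norm and nothing is known
  about the traces. The tolerance for |z - E'| is therefore of order T^(-1/4) instead of 1/T: at the
  bad energies the squared norm is at most a constant times sqrt T / (1 + E^2), with an integral of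
  order sqrt T, negligible against the total of order T. This fourth root turns the 12 into the 48
  of the exponent.\<close>

definition tmat :: "complex \<Rightarrow> complex \<Rightarrow> complex^2^2" where
  "tmat z s = vector [vector [z - s, - 1], vector [1, 0]]"

primrec tprod :: "(int \<Rightarrow> complex) \<Rightarrow> complex \<Rightarrow> int \<Rightarrow> nat \<Rightarrow> complex^2^2" where
  "tprod q z a 0 = mat 1"
| "tprod q z a (Suc k) = tmat z (q (a + int k)) ** tprod q z a k"

lemma tprod_add: "tprod q z a (j + k) = tprod q z (a + int j) k ** tprod q z a j"
  by (induction k) (simp_all add: matrix_mul_assoc add.assoc)

lemma tprod_Suc_left: "tprod q z a (Suc k) = tprod q z (a + 1) k ** tmat z (q a)"
  using tprod_add[of q z a 1 k] by simp

lemma det_tmat [simp]: "det (tmat z s) = 1"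
  by (simp add: det_2 tmat_def)

lemma det_tprod [simp]: "det (tprod q z a k) = 1"
  by (induction k) (simp_all add: det_mul)

lemma tprod_cong:
  assumes "\<And>n. a \<le> n \<Longrightarrow> n < a + int k \<Longrightarrow> q' (n + b) = q n"
  shows "tprod q' z (a + b) k = tprod q z a k"
  using assms
proof (induction k)
  case (Suc k)
  have "q' (a + b + int k) = q (a + int k)"
    using Suc.prems[of "a + int k"] by (simp add: add_ac)
  with Suc show ?case by simp
qed simp

lemma tprod_solution:
  assumes "\<And>n. a \<le> n \<Longrightarrow> n < a + int k \<Longrightarrow> u (n + 1) + u (n - 1) + q n * u n = z * u n"
  shows "tprod q z a k *v vector [u a, u (a - 1)] = vector [u (a + int k), u (a + int k - 1)]"
  using assms
proof (induction k)
  case (Suc k)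
  have "u (a + int k + 1) = (z - q (a + int k)) * u (a + int k) - u (a + int k - 1)"
    using Suc.prems[of "a + int k"] by (simp add: algebra_simps)
  then have "tmat z (q (a + int k)) *v vector [u (a + int k), u (a + int k - 1)]
      = vector [u (a + int (Suc k)), u (a + int (Suc k) - 1)]"
    by (simp add: vec_eq_iff forall_2 tmat_def matrix_vector_mult_def sum_2 add_ac)
  moreover have "tprod q z a k *v vector [u a, u (a - 1)] = vector [u (a + int k), u (a + int k - 1)]"
    by (rule Suc.IH) (use Suc.prems in auto)
  ultimately show ?case
    by (simp add: matrix_vector_mul_assoc[symmetric])
qed simp

lemma trace_2: "trace (A :: complex^2^2) = A $ 1 $ 1 + A $ 2 $ 2"
  by (simp add: trace_def sum_2)

lemma matrix_square_2:
  fixes A :: "complex^2^2"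
  assumes "det A = 1"
  shows "(A ** A) $ i $ j = trace A * A $ i $ j - mat 1 $ i $ j"
proof -
  have "A $ 1 $ 2 * A $ 2 $ 1 = A $ 1 $ 1 * A $ 2 $ 2 - 1"
    using assms unfolding det_2 by algebra
  then have "\<forall>i j. (A ** A) $ i $ j = trace A * A $ i $ j - mat 1 $ i $ j"
    by (simp add: forall_2 matrix_matrix_mult_def sum_2 trace_2 mat_def algebra_simps)
  then show ?thesis by blast
qed

lemma cayley_hamilton_2:
  fixes A :: "complex^2^2"
  assumes "det A = 1"
  shows "A *v (A *v x) = trace A *s (A *v x) - x"
proof -
  have "(A ** A) *v x = trace A *s (A *v x) - x"
    by (simp add: vec_eq_iff forall_2 matrix_vector_mult_def sum_2 matrix_square_2[OF assms] mat_def
        algebra_simps)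
  then show ?thesis by (simp add: matrix_vector_mul_assoc)
qed

text \<open>Cayley-Hamilton under the trace; this is what closes the recursion for the
  traces.\<close>

lemma trace_square_mult:
  fixes A B :: "complex^2^2"
  assumes "det A = 1"
  shows "trace (A ** (A ** B)) = trace A * trace (A ** B) - trace B"
proof -
  have tr: "trace (M ** B) = M$1$1 * B$1$1 + M$1$2 * B$2$1 + (M$2$1 * B$1$2 + M$2$2 * B$2$2)"
    for M :: "complex^2^2"
    by (simp add: trace_2 matrix_matrix_mult_def sum_2)
  have "trace ((A ** A) ** B) = trace A * trace (A ** B) - trace B"
    unfolding tr matrix_square_2[OF assms] trace_2[of B] by (simp add: mat_def field_simps)
  then show ?thesis by (simp add: matrix_mul_assoc)
qed

text \<open>A unimodular matrix satisfies A^2 = x A - 1, and periodicity over the first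
  \<open>p\<close> sites makes the second period use the same A. The two conclusions are the two
  components of the resulting vector identity.\<close>

lemma two_periods:
  fixes p :: nat
  assumes per: "\<And>n. a \<le> n \<Longrightarrow> n < a + int p \<Longrightarrow> q (n + int p) = q n"
    and sol: "\<And>n. a \<le> n \<Longrightarrow> n < a + 2 * int p \<Longrightarrow> u (n + 1) + u (n - 1) + q n * u n = z * u n"
  defines "x \<equiv> trace (tprod q z a p)"
  shows "u a + u (a + 2 * int p) = x * u (a + int p)"
    "u (a - 1) + u (a - 1 + 2 * int p) = x * u (a - 1 + int p)"
proof -
  let ?A = "tprod q z a p" and ?U = "\<lambda>n. vector [u n, u (n - 1)] :: complex^2"
  have 1: "?A *v ?U a = ?U (a + int p)"
    by (rule tprod_solution) (use sol in auto)
  have "tprod q z (a + int p) p = ?A"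
    by (rule tprod_cong) (rule per)
  moreover have "tprod q z (a + int p) p *v ?U (a + int p) = ?U (a + int p + int p)"
    by (rule tprod_solution) (use sol in auto)
  moreover have "a + int p + int p = a + 2 * int p"
    by simp
  ultimately have "?A *v ?U (a + int p) = ?U (a + 2 * int p)"
    by metis
  then have "?U (a + 2 * int p) = x *s ?U (a + int p) - ?U a"
    using cayley_hamilton_2[of ?A "?U a"] 1 by (simp add: x_def)
  then have "u (a + 2 * int p) = x * u (a + int p) - u a"
    "u (a + 2 * int p - 1) = x * u (a + int p - 1) - u (a - 1)"
    by (auto simp: vec_eq_iff forall_2)
  then show "u a + u (a + 2 * int p) = x * u (a + int p)"
    "u (a - 1) + u (a - 1 + 2 * int p) = x * u (a - 1 + int p)"
    by (simp_all add: algebra_simps)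
qed

text \<open>Moving the window by one site conjugates the product by \<open>tmat z (q a)\<close>,
  because the factor that enters on the left equals the one that leaves on the right.
  \<open>N\<close> below is its inverse.\<close>

lemma trace_tprod_Suc:
  assumes "q (a + int p) = q a"
  shows "trace (tprod q z (a + 1) p) = trace (tprod q z a p)"
proof -
  have eq: "tmat z (q a) ** tprod q z a p = tprod q z (a + 1) p ** tmat z (q a)"
    using tprod_Suc_left[of q z a p] assms by simp
  define N :: "complex^2^2" where "N = vector [vector [0, 1], vector [- 1, z - q a]]"
  have N: "tmat z (q a) ** N = mat 1"
    by (simp add: N_def tmat_def vec_eq_iff forall_2 matrix_matrix_mult_def sum_2 mat_def)
  then have N': "N ** tmat z (q a) = mat 1"
    by (simp add: matrix_left_right_inverse)
  have "trace (tprod q z (a + 1) p) = trace (tprod q z (a + 1) p ** tmat z (q a) ** N)"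
    by (simp add: matrix_mul_assoc[symmetric] N)
  also have "\<dots> = trace (tmat z (q a) ** (tprod q z a p ** N))"
    by (simp add: eq[symmetric] matrix_mul_assoc)
  also have "\<dots> = trace (tprod q z a p)"
    by (subst trace_mul_sym) (simp add: matrix_mul_assoc[symmetric] N')
  finally show ?thesis .
qed

section \<open>Fibonacci words of transfer matrices and the trace map\<close>

fun fib_mat :: "real \<Rightarrow> complex \<Rightarrow> nat \<Rightarrow> complex^2^2" where
  "fib_mat V z 0 = tmat z 0"
| "fib_mat V z (Suc 0) = tmat z (of_real V)"
| "fib_mat V z (Suc (Suc j)) = fib_mat V z (Suc j) ** fib_mat V z j"

text \<open>Shifted by one against \<open>fib_mat\<close>: the entry 2 in front is the trace of the matrix
  \<open>((1, - V), (0, 1))\<close> that precedes the two letter matrices in the recursion.\<close>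

fun fib_trace :: "real \<Rightarrow> complex \<Rightarrow> nat \<Rightarrow> complex" where
  "fib_trace V z 0 = 2"
| "fib_trace V z (Suc 0) = z"
| "fib_trace V z (Suc (Suc 0)) = z - of_real V"
| "fib_trace V z (Suc (Suc (Suc n))) = fib_trace V z (Suc (Suc n)) * fib_trace V z (Suc n) - fib_trace V z n"

lemma det_fib_mat: "det (fib_mat V z j) = 1"
  by (induction V z j rule: fib_mat.induct) (simp_all add: det_mul)

text \<open>With M for \<open>fib_mat\<close>, cyclicity of the trace turns M(i+1) M(i) M(i+1) into
  M(i+1)^2 M(i), to which the Cayley-Hamilton identity applies.\<close>

lemma trace_fib_mat: "trace (fib_mat V z j) = fib_trace V z (Suc j)"
proof (induction j rule: less_induct)
  case (less j)
  consider "j = 0" | "j = 1" | "j = 2" | i where "j = Suc (Suc (Suc i))"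
    by (metis One_nat_def Suc_1 not0_implies_Suc)
  then show ?case
  proof cases
    case 4
    have "trace (fib_mat V z j) = trace (fib_mat V z (Suc i) ** (fib_mat V z (Suc i) ** fib_mat V z i))"
      unfolding 4 fib_mat.simps(3)[of V z "Suc i"] by (subst trace_mul_sym) simp
    also have "\<dots> = trace (fib_mat V z (Suc i)) * trace (fib_mat V z (Suc (Suc i))) - trace (fib_mat V z i)"
      by (subst trace_square_mult) (simp_all add: det_fib_mat)
    finally show ?thesis
      using less.IH[of i] less.IH[of "Suc i"] less.IH[of "Suc (Suc i)"] by (simp add: 4 mult.commute)
  qed (simp_all add: trace_2 tmat_def matrix_matrix_mult_def sum_2 numeral_2_eq_2 algebra_simps)
qed

text \<open>The Fricke-Vogt invariant of the trace map. Its value at the start (2, z, z - V) does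
  not depend on \<open>z\<close>.\<close>

lemma fib_trace_invariant:
  "(fib_trace V z n)\<^sup>2 + (fib_trace V z (Suc n))\<^sup>2 + (fib_trace V z (Suc (Suc n)))\<^sup>2
    - fib_trace V z n * fib_trace V z (Suc n) * fib_trace V z (Suc (Suc n)) = 4 + (of_real V)\<^sup>2"
proof (induction n)
  case 0
  show ?case by (simp add: power2_eq_square algebra_simps)
next
  case (Suc n)
  then show ?case by (simp add: power2_eq_square algebra_simps)
qed

text \<open>Two consecutive moduli above 2 after one of at most 2 can never come back, because the
  product in the recursion then dominates the subtracted term.\<close>

lemma fib_trace_escape:
  assumes "cmod (fib_trace V z n) \<le> 2" "cmod (fib_trace V z (Suc n)) > 2"
    "cmod (fib_trace V z (Suc (Suc n))) > 2"
  shows "cmod (fib_trace V z (Suc n + i)) > 2"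
proof -
  define x where "x i = cmod (fib_trace V z (n + i))" for i
  have rec: "x (Suc (Suc (Suc i))) \<ge> x (Suc (Suc i)) * x (Suc i) - x i" for i
    using norm_triangle_ineq2[of "fib_trace V z (Suc (Suc (n + i))) * fib_trace V z (Suc (n + i))"
        "fib_trace V z (n + i)"] by (simp add: norm_mult x_def)
  \<comment> \<open>The last clause absorbs the subtracted term: it gives x (i + 3) at least x (i +
    2) (x (i + 1) - 1), which exceeds 2 (x (i + 1) - 1), hence both 2 and x (i + 1).\<close>
  have "x (Suc i) > 2 \<and> x (Suc (Suc i)) > 2 \<and> x i \<le> x (Suc (Suc i))" for i
  proof (induction i)
    case 0
    show ?case using assms by (simp add: x_def)
  next
    case (Suc i)
    have "2 * (x (Suc i) - 1) < x (Suc (Suc i)) * (x (Suc i) - 1)"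
      using Suc by (intro mult_strict_right_mono) auto
    also have "\<dots> \<le> x (Suc (Suc (Suc i)))"
      using rec[of i] Suc by (simp add: algebra_simps)
    finally show ?case
      using Suc by auto
  qed
  from this[of i] show ?thesis by (simp add: x_def)
qed

text \<open>A small trace at index \<open>m\<close> excludes an earlier escape. Since the sequence
  starts with 2, no two neighbours up to \<open>m\<close> exceed 2, so a large trace X stands
  between two small ones. The invariant, read as a quadratic equation for X, yields |X|^2 \<le> 4
  |X| + 12 + V^2, which fails beyond 6 + V because (6 + V) (2 + V) > 12 + V^2.\<close>

lemma fib_trace_bounded:
  assumes V: "V > 0" and m: "cmod (fib_trace V z m) \<le> 2" and "n \<le> m"
  shows "cmod (fib_trace V z n) \<le> 6 + V"
proof (cases "cmod (fib_trace V z n) \<le> 2")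
  case False
  let ?x = "\<lambda>i. cmod (fib_trace V z i)"
  have pair: "?x j \<le> 2 \<or> ?x (Suc j) \<le> 2" if "Suc j \<le> m" for j
    using that
  proof (induction j)
    case (Suc j)
    show ?case
    proof (rule ccontr)
      assume contr: "\<not> ?thesis"
      with Suc have "?x j \<le> 2" by auto
      from fib_trace_escape[OF this, of "m - Suc j"] contr m Suc.prems show False
        by simp
    qed
  qed simp
  from False obtain k where k: "n = Suc k"
    by (cases n) auto
  have "n \<noteq> m" using False m by auto
  then have y: "?x k \<le> 2" and w: "?x (Suc n) \<le> 2"
    using pair[of k] pair[of n] False assms k by auto
  let ?X = "fib_trace V z n" and ?y = "fib_trace V z k" and ?w = "fib_trace V z (Suc n)"
  have "?X\<^sup>2 = ?y * ?w * ?X + (4 + (of_real V)\<^sup>2) - ?y\<^sup>2 - ?w\<^sup>2"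
    using fib_trace_invariant[of V z k] unfolding k by algebra
  then have "(cmod ?X)\<^sup>2 = cmod (?y * ?w * ?X + (4 + (of_real V)\<^sup>2) - ?y\<^sup>2 - ?w\<^sup>2)"
    by (metis norm_power)
  also have "\<dots> \<le> cmod (?y * ?w * ?X) + cmod (4 + (of_real V)\<^sup>2) + cmod (?y\<^sup>2) + cmod (?w\<^sup>2)"
    by (meson add_mono norm_triangle_ineq norm_triangle_ineq4 order.refl order_trans)
  also have "\<dots> \<le> 4 * cmod ?X + (4 + V\<^sup>2) + 4 + 4"
  proof (intro add_mono)
    show "cmod (?y * ?w * ?X) \<le> 4 * cmod ?X"
      using mult_mono[OF y w] by (auto simp: norm_mult intro!: mult_right_mono)
    show "cmod (4 + (of_real V)\<^sup>2) \<le> 4 + V\<^sup>2"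
      by (rule order_trans[OF norm_triangle_ineq]) (simp add: norm_power)
    show "cmod (?y\<^sup>2) \<le> 4" "cmod (?w\<^sup>2) \<le> 4"
      using power_mono[OF y, of 2] power_mono[OF w, of 2] by (simp_all add: norm_power)
  qed
  finally have le: "(cmod ?X)\<^sup>2 \<le> 4 * cmod ?X + 12 + V\<^sup>2" by simp
  show ?thesis
  proof (rule ccontr)
    assume "\<not> ?thesis"
    then have "(6 + V) * (2 + V) < cmod ?X * (cmod ?X - 4)"
      using V by (intro mult_strict_mono) auto
    with le V show False
      by (simp add: power2_eq_square algebra_simps)
  qed
qed (use V in simp)

text \<open>The differences of the two trace sequences satisfy a linear recursion with bounded
  coefficients, hence grow by at most a factor 8 + V per index. The coefficient taken at
  \<open>z\<close> is under control because the error accumulated so far is at most 1.\<close>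

lemma fib_trace_perturb:
  assumes V: "V > 0" and y: "\<And>i. i \<le> k \<Longrightarrow> cmod (fib_trace V y i) \<le> 6 + V"
    and close: "cmod (z - y) * (8 + V) ^ k \<le> 1" and "i \<le> k"
  shows "cmod (fib_trace V z i) \<le> 7 + V"
proof -
  define d where "d i = cmod (fib_trace V z i - fib_trace V y i)" for i
  let ?C = "8 + V" and ?e = "cmod (z - y)"
  have d_le: "d i \<le> ?e * ?C ^ i" if "i \<le> k" for i
    using that
  proof (induction i rule: less_induct)
    case (less i)
    consider "i = 0" | "i = 1" | "i = 2" | j where "i = Suc (Suc (Suc j))"
      by (metis One_nat_def Suc_1 not0_implies_Suc)
    then show ?case
    proof cases
      case 4
      let ?z = "fib_trace V z" and ?y = "fib_trace V y"
      have IH: "d j \<le> ?e * ?C ^ j" "d (Suc j) \<le> ?e * ?C ^ Suc j" "d (Suc (Suc j)) \<le> ?e * ?C ^ Suc (Suc j)"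
        using less.IH[of j] less.IH[of "Suc j"] less.IH[of "Suc (Suc j)"] less.prems 4 by simp_all
      have "?e * ?C ^ Suc (Suc j) \<le> ?e * ?C ^ k"
        using V less.prems 4 by (intro mult_left_mono power_increasing) auto
      then have "d (Suc (Suc j)) \<le> 1"
        using IH(3) close by linarith
      then have z2: "cmod (?z (Suc (Suc j))) \<le> 7 + V"
        using y[of "Suc (Suc j)"] 4 less.prems norm_triangle_ineq2[of "?z (Suc (Suc j))" "?y (Suc (Suc j))"]
        by (simp add: d_def)
      have "?z i - ?y i = ?z (Suc (Suc j)) * (?z (Suc j) - ?y (Suc j))
          + ?y (Suc j) * (?z (Suc (Suc j)) - ?y (Suc (Suc j))) - (?z j - ?y j)"
        by (simp add: 4 algebra_simps)
      then have "d i = cmod (?z (Suc (Suc j)) * (?z (Suc j) - ?y (Suc j))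
          + ?y (Suc j) * (?z (Suc (Suc j)) - ?y (Suc (Suc j))) - (?z j - ?y j))"
        by (simp only: d_def)
      also have "\<dots> \<le> cmod (?z (Suc (Suc j)) * (?z (Suc j) - ?y (Suc j)))
          + cmod (?y (Suc j) * (?z (Suc (Suc j)) - ?y (Suc (Suc j)))) + d j"
        using norm_triangle_ineq4[of "?z (Suc (Suc j)) * (?z (Suc j) - ?y (Suc j))
          + ?y (Suc j) * (?z (Suc (Suc j)) - ?y (Suc (Suc j)))" "?z j - ?y j"]
          norm_triangle_ineq[of "?z (Suc (Suc j)) * (?z (Suc j) - ?y (Suc j))"
            "?y (Suc j) * (?z (Suc (Suc j)) - ?y (Suc (Suc j)))"]
        unfolding d_def by linarith
      also have "\<dots> \<le> (7 + V) * d (Suc j) + (6 + V) * d (Suc (Suc j)) + d j"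
        unfolding norm_mult d_def using y[of "Suc j"] z2 4 less.prems
        by (intro add_mono mult_right_mono) auto
      also have "\<dots> \<le> (7 + V) * (?e * ?C ^ Suc j) + (6 + V) * (?e * ?C ^ Suc (Suc j)) + ?e * ?C ^ j"
        using V IH by (intro add_mono mult_left_mono) auto
      also have "\<dots> = ?e * ?C ^ j * ((7 + V) * ?C + (6 + V) * ?C\<^sup>2 + 1)"
        by (simp add: algebra_simps power2_eq_square)
      also have "\<dots> \<le> ?e * ?C ^ j * ?C ^ 3"
      proof (intro mult_left_mono)
        \<comment> \<open>For C = 8 + V the right side minus (6 + V) C^2 is 2 C^2, and 2 C^2 - (7 +
          V) C = C (9 + V). The choice C = 7 + V would miss by exactly the summand 1.\<close>
        show "(7 + V) * ?C + (6 + V) * ?C\<^sup>2 + 1 \<le> ?C ^ 3"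
          using V by (simp add: power2_eq_square power3_eq_cube algebra_simps)
      qed (use V in auto)
      also have "\<dots> = ?e * ?C ^ i"
        by (simp add: 4 power3_eq_cube)
      finally show ?thesis .
    next
      case 1
      then show ?thesis by (simp add: d_def)
    next
      case 2
      then show ?thesis using V mult_left_mono[of 1 ?C ?e] by (simp add: d_def)
    next
      case 3
      have "1 \<le> ?C\<^sup>2" using V by (simp add: power2_eq_square algebra_simps)
      then show ?thesis using 3 mult_left_mono[of 1 "?C\<^sup>2" ?e] by (simp add: d_def numeral_2_eq_2)
    qed
  qed
  have "?e * ?C ^ i \<le> ?e * ?C ^ k"
    using V \<open>i \<le> k\<close> by (intro mult_left_mono power_increasing) auto
  then have "d i \<le> 1" using d_le[OF \<open>i \<le> k\<close>] close by linarith
  then show ?thesis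
    using y[OF \<open>i \<le> k\<close>] norm_triangle_ineq2[of "fib_trace V z i" "fib_trace V y i"] by (simp add: d_def)
qed

section \<open>Local periods of the Fibonacci potential\<close>

lemma alpha_square: "alpha * alpha = 1 - alpha"
  by (simp add: alpha_def field_simps)

lemma alpha_bounds: "0 < alpha" "alpha < 1" "1 / 2 < alpha"
proof -
  have "2 < sqrt 5" "sqrt 5 < 3"
    using real_sqrt_less_mono[of 4 5] real_sqrt_less_mono[of 5 9] by simp_all
  then show "0 < alpha" "alpha < 1" "1 / 2 < alpha"
    by (simp_all add: alpha_def)
qed

lemma alpha_power_sum: "alpha ^ Suc j + alpha ^ Suc (Suc j) = alpha ^ j"
proof -
  have "alpha ^ Suc j + alpha ^ Suc (Suc j) = alpha ^ j * (alpha + alpha * alpha)"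
    by (simp only: power_Suc2 distrib_left mult.assoc)
  then show ?thesis by (simp add: alpha_square)
qed

text \<open>The approximation errors satisfy the Fibonacci recursion, and \<open>- alpha\<close> is
  its contracting characteristic root. The alternating sign decides on which side of an integer
  everything below happens.\<close>

lemma fib_alpha: "of_nat (fib (Suc j)) * alpha - of_nat (fib j) = alpha * (- alpha) ^ j"
proof (induction j rule: fib.induct)
  case (3 n)
  have "of_nat (fib (Suc (Suc (Suc n)))) * alpha - of_nat (fib (Suc (Suc n)))
      = (of_nat (fib (Suc (Suc n))) * alpha - of_nat (fib (Suc n)))
        + (of_nat (fib (Suc n)) * alpha - of_nat (fib n))"
    by (simp add: algebra_simps)
  also have "\<dots> = alpha * (- alpha) ^ Suc n + alpha * (- alpha) ^ n"
    using 3 by simp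
  also have "\<dots> = alpha * (- alpha) ^ n * (alpha * alpha)"
    unfolding alpha_square by (simp add: algebra_simps)
  finally show ?case by simp
qed (simp_all add: alpha_square)

lemma fib_alpha_even: "even j \<Longrightarrow> of_nat (fib (Suc j)) * alpha - of_nat (fib j) = alpha ^ Suc j"
  and fib_alpha_odd: "odd j \<Longrightarrow> of_nat (fib (Suc j)) * alpha - of_nat (fib j) = - (alpha ^ Suc j)"
  by (simp_all add: fib_alpha power_minus_even power_minus_odd)

text \<open>A step of the rotation by alpha passes an integer exactly when the fractional part is at
  least 1 - alpha. In this form a period of the potential is a matter of two neighbouring floors
  moving by the same integer.\<close>

lemma fib_potential_floor:
  "fib_potential V \<omega> n = V * of_int (\<lfloor>of_int (n + 1) * alpha + \<omega>\<rfloor> - \<lfloor>of_int n * alpha + \<omega>\<rfloor>)"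
proof -
  define x where "x = of_int n * alpha + \<omega>"
  have "(indicator {1 - alpha..<1} (frac x) :: real) = of_int (\<lfloor>x + alpha\<rfloor> - \<lfloor>x\<rfloor>)"
  proof (cases "1 - alpha \<le> frac x")
    case True
    then have "\<lfloor>x + alpha\<rfloor> = \<lfloor>x\<rfloor> + 1"
      using alpha_bounds by (intro floor_unique) (auto simp: frac_def, linarith)
    then show ?thesis using True frac_lt_1[of x] by simp
  next
    case False
    then have "\<lfloor>x + alpha\<rfloor> = \<lfloor>x\<rfloor>"
      using alpha_bounds by (intro floor_unique) (auto simp: frac_def, linarith)
    then show ?thesis using False by simp
  qed
  moreover have "of_int (n + 1) * alpha + \<omega> = x + alpha"
    by (simp add: x_def algebra_simps)
  ultimately show ?thesis
    by (simp only: fib_potential_def x_def[symmetric])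
qed

text \<open>A hit at \<open>c\<close> breaks the period \<open>fib (Suc j)\<close> of the potential at the sites \<open>c - 1\<close> and
  \<open>c\<close>.\<close>

definition hit :: "real \<Rightarrow> nat \<Rightarrow> int \<Rightarrow> bool" where
  "hit \<omega> j c \<longleftrightarrow>
    \<lfloor>of_int (c + int (fib (Suc j))) * alpha + \<omega>\<rfloor> \<noteq> \<lfloor>of_int c * alpha + \<omega>\<rfloor> + int (fib j)"

text \<open>The side of 0 alternates with \<open>j\<close> because \<open>fib (Suc j) * alpha - fib j\<close> changes its sign.\<close>

definition slot :: "nat \<Rightarrow> real \<Rightarrow> real \<Rightarrow> bool" where
  "slot j r s \<longleftrightarrow> (if even j then - r \<le> s \<and> s < 0 else 0 \<le> s \<and> s < r)"

definition near :: "real \<Rightarrow> nat \<Rightarrow> real \<Rightarrow> int \<Rightarrow> bool" where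
  "near \<omega> j r c \<longleftrightarrow> (\<exists>k::int. slot j r (of_int c * alpha + \<omega> - of_int k))"

lemma near_mono: "near \<omega> j r c \<Longrightarrow> r \<le> r' \<Longrightarrow> near \<omega> j r' c"
  unfolding near_def slot_def by (force split: if_splits)

text \<open>A translation by \<open>fib (Suc j)\<close> sites moves the orbit modulo 1 by
  \<open>alpha ^ Suc j\<close>, upwards for even \<open>j\<close> and downwards for odd
  \<open>j\<close>. The floor fails to follow only if an integer is crossed, so the orbit lies just
  below or just above one.\<close>

lemma hit_near:
  assumes "hit \<omega> j c"
  shows "near \<omega> j (alpha ^ Suc j) c"
proof -
  define x where "x = of_int c * alpha + \<omega>"
  define e where "e = of_nat (fib (Suc j)) * alpha - of_nat (fib j)"
  have "of_int (c + int (fib (Suc j))) * alpha + \<omega> = x + e + of_int (int (fib j))"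
    by (simp add: x_def e_def algebra_simps)
  then have ne: "\<lfloor>x + e\<rfloor> \<noteq> \<lfloor>x\<rfloor>"
    using assms unfolding hit_def x_def[symmetric] by (metis floor_add_int)
  have pos: "0 < alpha ^ Suc j" using alpha_bounds by simp
  show ?thesis
  proof (cases "even j")
    case True
    then have e: "e = alpha ^ Suc j" unfolding e_def by (rule fib_alpha_even)
    then have "\<lfloor>x\<rfloor> \<le> \<lfloor>x + e\<rfloor>" using pos by (intro floor_mono) simp
    with ne have "\<lfloor>x\<rfloor> + 1 \<le> \<lfloor>x + e\<rfloor>" by linarith
    then have "of_int (\<lfloor>x\<rfloor> + 1) \<le> x + e" by (simp only: le_floor_iff)
    then show ?thesis
      unfolding near_def slot_def x_def[symmetric] using True e
      by (intro exI[of _ "\<lfloor>x\<rfloor> + 1"]) (simp; linarith?)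
  next
    case False
    then have e: "e = - (alpha ^ Suc j)" unfolding e_def by (rule fib_alpha_odd)
    then have "\<lfloor>x + e\<rfloor> \<le> \<lfloor>x\<rfloor>" using pos by (intro floor_mono) simp
    with ne have "\<lfloor>x + e\<rfloor> < \<lfloor>x\<rfloor>" by linarith
    then have "x + e < of_int \<lfloor>x\<rfloor>" by (simp only: floor_less_iff)
    then show ?thesis
      unfolding near_def slot_def x_def[symmetric] using False e
      by (intro exI[of _ "\<lfloor>x\<rfloor>"]) auto
  qed
qed

section \<open>Distances between hits, and a scale without hits among any four\<close>

lemma fib_basis:
  "\<exists>a b. (m::int) = a * int (fib (Suc j)) + b * int (fib (Suc (Suc j))) \<and>
    q = a * int (fib j) + b * int (fib (Suc j))"
proof (induction j)
  case 0
  show ?case by (intro exI[of _ "m - q"] exI[of _ q]) simp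
next
  case (Suc j)
  then obtain a b where "m = a * int (fib (Suc j)) + b * int (fib (Suc (Suc j)))"
    "q = a * int (fib j) + b * int (fib (Suc j))" by blast
  then show ?case
    by (intro exI[of _ "b - a"] exI[of _ a]) (simp add: algebra_simps)
qed

text \<open>In the basis of two consecutive Fibonacci vectors with coefficients a and b, the linear
  form is alpha^(j+1) (a - alpha b) up to sign, and 1 / alpha = 1 + alpha, so 0 < a - alpha b < 1 +
  alpha. Coefficients of equal sign make |m| at least \<open>fib (j + 3)\<close>, and opposite signs
  of the form a > 0 > b push the form to its upper limit. What is left is (1, 0) and (0, -
  1).\<close>

lemma fib_best_approximation:
  fixes m q :: int
  assumes pos: "0 < (- 1) ^ j * (of_int m * alpha - of_int q)"
    and less: "(- 1) ^ j * (of_int m * alpha - of_int q) < alpha ^ j"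
    and m: "\<bar>m\<bar> < int (fib (j + 3))"
  shows "m = int (fib (Suc j)) \<or> m = - int (fib (Suc (Suc j)))"
proof -
  let ?F = "int (fib (Suc j))" and ?G = "int (fib (Suc (Suc j)))"
  obtain a b where ab: "m = a * ?F + b * ?G" "q = a * int (fib j) + b * ?F"
    using fib_basis by blast
  have "of_int m * alpha - of_int q
      = of_int a * (of_nat (fib (Suc j)) * alpha - of_nat (fib j))
        + of_int b * (of_nat (fib (Suc (Suc j))) * alpha - of_nat (fib (Suc j)))"
    by (simp add: ab algebra_simps)
  also have "\<dots> = (- 1) ^ j * (alpha ^ j * (alpha * (of_int a - alpha * of_int b)))"
    unfolding fib_alpha by (simp add: power_minus[of alpha] algebra_simps)
  finally have eq: "(- 1) ^ j * (of_int m * alpha - of_int q)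
      = alpha ^ j * (alpha * (of_int a - alpha * of_int b))"
    by (simp add: power_mult_distrib[symmetric] flip: mult.assoc)
  have aj: "alpha ^ j > 0" using alpha_bounds by simp
  have 1: "0 < of_int a - alpha * of_int b"
    using pos aj alpha_bounds unfolding eq by (simp add: zero_less_mult_iff)
  have "alpha * (of_int a - alpha * of_int b) < 1"
    using less aj unfolding eq by simp
  moreover have "1 = alpha * (1 + alpha)"
    using alpha_square by (simp add: algebra_simps)
  ultimately have "alpha * (of_int a - alpha * of_int b) < alpha * (1 + alpha)"
    by simp
  then have 2: "of_int a - alpha * of_int b < 1 + alpha"
    using alpha_bounds by simp
  have F: "1 \<le> ?F" using fib_neq_0_nat[of "Suc j"] by linarith
  have G: "?F \<le> ?G" using fib_Suc_mono[of "Suc j"] by simp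
  have "fib (j + 3) = fib (Suc j) + fib (Suc (Suc j))"
    by (simp add: eval_nat_numeral)
  then have 3: "\<bar>a * ?F + b * ?G\<bar> < ?F + ?G"
    using m ab by simp
  consider "b = 0" | "b \<ge> 1" | "b \<le> - 1" "a \<ge> 1" | "b \<le> - 1" "a = 0" | "b \<le> - 1" "a \<le> - 1"
    by linarith
  then show ?thesis
  proof cases
    case 1
    then have "a > 0" "real_of_int a < 2"
      using \<open>0 < of_int a - alpha * of_int b\<close> 2 alpha_bounds by simp_all
    then have "a = 1" by linarith
    then show ?thesis using 1 ab by simp
  next
    case 2
    then have "alpha * of_int b > 0" using alpha_bounds by simp
    then have "real_of_int a > 0" using 1 by linarith
    then have "a \<ge> 1" by simp
    then have "?F + ?G \<le> a * ?F + b * ?G"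
      using F G 2 mult_right_mono[of 1 a ?F] mult_right_mono[of 1 b ?G] by linarith
    then show ?thesis using 3 by linarith
  next
    case 3
    then have "alpha * of_int b \<le> alpha * (- 1)"
      using alpha_bounds by (intro mult_left_mono) linarith+
    then show ?thesis using 2 3 by linarith
  next
    case 4
    then have "- b * ?G < 2 * ?G" using 3 F G by simp
    then have "- b < 2" using F G by (simp only: mult_less_cancel_right)
    then have "b = - 1" using 4 by linarith
    then show ?thesis using 4 ab by simp
  next
    case 5
    then have "?F + ?G \<le> - (a * ?F + b * ?G)"
      using F G mult_right_mono[of a "- 1" ?F] mult_right_mono[of b "- 1" ?G] by linarith
    then show ?thesis using 3 by linarith
  qed
qed

text \<open>Each D(i) is smaller than the backward step available to it, which would therefore end
  below 0; hence all three steps go forward. Their sum 2 F(k+3) exceeds the last upper limit F(k+4)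
  + l because l < F(k+1). With one position fewer, the sum F(k+3) would still fit, which is why four
  scales are taken.\<close>

lemma fib_no_chain:
  fixes D :: "nat \<Rightarrow> int"
  assumes D: "\<And>i. i \<le> 3 \<Longrightarrow> 0 \<le> D i \<and> D i \<le> int (fib (Suc (k + i))) + l"
    and step: "\<And>i. i < 3 \<Longrightarrow> D (Suc i) - D i = int (fib (Suc (k + i))) \<or>
      D (Suc i) - D i = - int (fib (Suc (Suc (k + i))))"
    and l: "l < int (fib k)"
  shows False
proof -
  have "fib k \<le> fib (Suc k)" by (rule fib_Suc_mono)
  then show False
    using D[of 0] D[of 1] D[of 2] D[of 3] step[of 0] step[of 1] step[of 2] l
    by (simp add: eval_nat_numeral)
qed

text \<open>Hits of neighbouring orders lie on opposite sides of an integer, so their offsets do not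
  cancel but add up to less than alpha^(j+1) + alpha^(j+2) = alpha^j, the range of the best
  approximation property.\<close>

lemma hit_difference:
  assumes c: "hit \<omega> j c" and d: "hit \<omega> (Suc j) d"
    and m: "\<bar>d - c\<bar> < int (fib (j + 3))"
  shows "d - c = int (fib (Suc j)) \<or> d - c = - int (fib (Suc (Suc j)))"
proof -
  obtain k where k: "slot j (alpha ^ Suc j) (of_int c * alpha + \<omega> - of_int k)"
    using hit_near[OF c] unfolding near_def by blast
  obtain k' where k': "slot (Suc j) (alpha ^ Suc (Suc j)) (of_int d * alpha + \<omega> - of_int k')"
    using hit_near[OF d] unfolding near_def by blast
  have "0 < (- 1) ^ j * (of_int (d - c) * alpha - of_int (k' - k)) \<and>
      (- 1) ^ j * (of_int (d - c) * alpha - of_int (k' - k)) < alpha ^ j"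
    using k k' alpha_power_sum[of j] unfolding slot_def by (cases "even j") (auto simp: algebra_simps)
  then show ?thesis
    using fib_best_approximation[of j "d - c" "k' - k"] m by blast
qed

text \<open>A left-looking square is obstructed by the position one period to the right of a hit, where the
  orbit is on the opposite side of 0; hence the reversed sign.\<close>

lemma hit_difference_left:
  assumes c: "hit \<omega> j c" and d: "hit \<omega> (Suc j) d"
  defines "c' \<equiv> c + int (fib (Suc j))" and "d' \<equiv> d + int (fib (Suc (Suc j)))"
  assumes m: "\<bar>c' - d'\<bar> < int (fib (j + 3))"
  shows "c' - d' = int (fib (Suc j)) \<or> c' - d' = - int (fib (Suc (Suc j)))"
proof -
  obtain k where k: "slot j (alpha ^ Suc j) (of_int c * alpha + \<omega> - of_int k)"
    using hit_near[OF c] unfolding near_def by blast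
  obtain k' where k': "slot (Suc j) (alpha ^ Suc (Suc j)) (of_int d * alpha + \<omega> - of_int k')"
    using hit_near[OF d] unfolding near_def by blast
  define q where "q = k + int (fib j) - (k' + int (fib (Suc j)))"
  have "of_int (c' - d') * alpha - of_int q
      = (of_int c * alpha + \<omega> - of_int k) + (of_nat (fib (Suc j)) * alpha - of_nat (fib j))
        - ((of_int d * alpha + \<omega> - of_int k') + (of_nat (fib (Suc (Suc j))) * alpha - of_nat (fib (Suc j))))"
    by (simp add: c'_def d'_def q_def algebra_simps)
  then have "0 < (- 1) ^ j * (of_int (c' - d') * alpha - of_int q) \<and>
      (- 1) ^ j * (of_int (c' - d') * alpha - of_int q) < alpha ^ j"
    using k k' alpha_power_sum[of j] fib_alpha_even[of j] fib_alpha_even[of "Suc j"] fib_alpha_odd[of j]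
      fib_alpha_odd[of "Suc j"]
    unfolding slot_def by (cases "even j") auto
  then show ?thesis
    using fib_best_approximation[of j "c' - d'" q] m by blast
qed

text \<open>If all four orders \<open>k\<close> to \<open>k + 3\<close> were obstructed, the chosen
  obstructions would form a chain of the excluded kind; the ranges keep neighbours close enough for
  \<open>diff\<close>. \<open>P\<close> is abstract and \<open>D\<close> a distance from a reference
  site, so that the argument serves both directions.\<close>

lemma obstruction_free_scale:
  fixes P :: "nat \<Rightarrow> int \<Rightarrow> bool"
  assumes diff: "\<And>j D D'. P j D \<Longrightarrow> P (Suc j) D' \<Longrightarrow> \<bar>D' - D\<bar> < int (fib (j + 3)) \<Longrightarrow>
      D' - D = int (fib (Suc j)) \<or> D' - D = - int (fib (Suc (Suc j)))"
    and l: "0 \<le> l" "l < int (fib k)"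
  shows "\<exists>j\<ge>k. j \<le> k + 3 \<and> (\<forall>D. 0 \<le> D \<longrightarrow> D \<le> int (fib (Suc j)) + l \<longrightarrow> \<not> P j D)"
proof (rule ccontr)
  assume "\<not> ?thesis"
  then have "\<exists>D. i \<le> 3 \<longrightarrow> 0 \<le> D \<and> D \<le> int (fib (Suc (k + i))) + l \<and> P (k + i) D" for i
    by (meson add_le_cancel_left le_add1)
  then obtain D where D: "\<And>i. i \<le> 3 \<Longrightarrow> 0 \<le> D i \<and> D i \<le> int (fib (Suc (k + i))) + l \<and> P (k + i) (D i)"
    by metis
  show False
  proof (rule fib_no_chain[of D k l])
    fix i :: nat assume i: "i < 3"
    have "fib k \<le> fib (Suc (k + i))" by (rule fib_mono) simp
    moreover have "fib (Suc (k + i)) \<le> fib (Suc (k + Suc i))" by (rule fib_mono) simp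
    moreover have "fib (k + i + 3) = fib (Suc (k + Suc i)) + fib (Suc (k + i))"
      by (simp add: eval_nat_numeral)
    ultimately have "\<bar>D (Suc i) - D i\<bar> < int (fib (k + i + 3))"
      using D[of i] D[of "Suc i"] i l by (auto simp: abs_if)
    then show "D (Suc i) - D i = int (fib (Suc (k + i))) \<or> D (Suc i) - D i = - int (fib (Suc (Suc (k + i))))"
      using diff[of "k + i" "D i" "D (Suc i)"] D[of i] D[of "Suc i"] i by simp
  qed (use D l in auto)
qed

lemma hit_free_right:
  assumes l: "0 \<le> l" "l < int (fib k)"
  obtains j where "k \<le> j" "j \<le> k + 3"
    "\<And>c. a \<le> c \<Longrightarrow> c \<le> a + int (fib (Suc j)) + l \<Longrightarrow> \<not> hit \<omega> j c"
proof -
  obtain j where j: "k \<le> j" "j \<le> k + 3"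
    and no: "\<And>D. 0 \<le> D \<Longrightarrow> D \<le> int (fib (Suc j)) + l \<Longrightarrow> \<not> hit \<omega> j (a + D)"
    using obstruction_free_scale[OF _ l, of "\<lambda>j D. hit \<omega> j (a + D)"] hit_difference[of \<omega>]
    by (metis add_diff_cancel_left)
  have "\<not> hit \<omega> j c" if "a \<le> c" "c \<le> a + int (fib (Suc j)) + l" for c
    using no[of "c - a"] that by simp
  with j show thesis by (rule that)
qed

lemma hit_free_left:
  assumes l: "0 \<le> l" "l < int (fib k)"
  obtains j where "k \<le> j" "j \<le> k + 3"
    "\<And>c. a - 2 * int (fib (Suc j)) - l \<le> c \<Longrightarrow> c \<le> a - int (fib (Suc j)) \<Longrightarrow> \<not> hit \<omega> j c"
proof -
  have "D' - D = int (fib (Suc j)) \<or> D' - D = - int (fib (Suc (Suc j)))"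
    if "hit \<omega> j (a - D - int (fib (Suc j)))" "hit \<omega> (Suc j) (a - D' - int (fib (Suc (Suc j))))"
      "\<bar>D' - D\<bar> < int (fib (j + 3))" for j D D'
    using hit_difference_left[OF that(1,2)] that(3) by simp
  then obtain j where j: "k \<le> j" "j \<le> k + 3"
    and no: "\<And>D. 0 \<le> D \<Longrightarrow> D \<le> int (fib (Suc j)) + l \<Longrightarrow> \<not> hit \<omega> j (a - D - int (fib (Suc j)))"
    using obstruction_free_scale[OF _ l, of "\<lambda>j D. hit \<omega> j (a - D - int (fib (Suc j)))"] by blast
  have "\<not> hit \<omega> j c" if "a - 2 * int (fib (Suc j)) - l \<le> c" "c \<le> a - int (fib (Suc j))" for c
    using no[of "a - c - int (fib (Suc j))"] that by simp
  with j show thesis by (rule that)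
qed

section \<open>Identification of the trace over one local period\<close>

lemma fib_potential_period:
  assumes "\<not> hit \<omega> j n" "\<not> hit \<omega> j (n + 1)"
  shows "fib_potential V \<omega> (n + int (fib (Suc j))) = fib_potential V \<omega> n"
  using assms unfolding fib_potential_floor hit_def by (simp add: algebra_simps)

text \<open>If the orbit is close enough to an integer on the right side, the sites from
  \<open>n\<close> on spell the Fibonacci word. The word of order i + 2 is the one of order i
  followed by the one of order i + 1: after \<open>fib (Suc i)\<close> sites the orbit has moved by
  alpha^(i+1) across the integer, into the slot of order i + 1. The closeness is required at n + 1
  because the potential at n is the increment of the floor up to n + 1. For order 0 the condition
  would be void, hence the base cases 1 and 2.\<close>

lemma tprod_fib_mat:
  assumes "near \<omega> j (alpha ^ j) (n + 1)" "j \<ge> 1"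
  shows "tprod (\<lambda>n. of_real (fib_potential V \<omega> n)) z n (fib (Suc j)) = fib_mat V z j"
  using assms
proof (induction j arbitrary: n rule: less_induct)
  case (less j)
  let ?x = "\<lambda>n. of_int n * alpha + \<omega>"
  consider "j = 1" | "j = 2" | i where "j = Suc (Suc i)" "i \<ge> 1"
    by (metis One_nat_def Suc_1 less.prems(2) not_less_eq_eq not0_implies_Suc le_zero_eq le_Suc_eq)
  then show ?case
  proof cases
    case 1
    obtain k where "0 \<le> ?x (n + 1) - of_int k" "?x (n + 1) - of_int k < alpha"
      using less.prems(1) unfolding near_def slot_def 1 by auto
    then have "\<lfloor>?x (n + 1)\<rfloor> = k"
      using alpha_bounds by (intro floor_unique) auto
    moreover have "\<lfloor>?x n\<rfloor> = k - 1"
      using \<open>0 \<le> ?x (n + 1) - of_int k\<close> \<open>?x (n + 1) - of_int k < alpha\<close> alpha_bounds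
      by (intro floor_unique) (auto simp: algebra_simps)
    ultimately show ?thesis by (simp add: 1 fib_potential_floor)
  next
    case 2
    obtain k where k: "- (alpha * alpha) \<le> ?x (n + 1) - of_int k" "?x (n + 1) - of_int k < 0"
      using less.prems(1) unfolding near_def slot_def 2 by (auto simp: power2_eq_square)
    have "?x n = ?x (n + 1) - alpha" "?x (n + 1 + 1) = ?x (n + 1) + alpha"
      by (simp_all add: algebra_simps)
    then have "\<lfloor>?x (n + 1)\<rfloor> = k - 1" "\<lfloor>?x n\<rfloor> = k - 1" "\<lfloor>?x (n + 1 + 1)\<rfloor> = k"
      using k alpha_bounds unfolding alpha_square by (intro floor_unique; simp; linarith)+
    then show ?thesis by (simp add: 2 fib_potential_floor eval_nat_numeral)
  next
    case 3
    let ?q = "\<lambda>n. of_real (fib_potential V \<omega> n) :: complex"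
    have le: "alpha ^ Suc (Suc i) \<le> alpha ^ Suc i" "alpha ^ Suc (Suc i) \<le> alpha ^ i"
      using alpha_bounds by (intro power_decreasing; simp)+
    obtain k where k: "if even i then - (alpha ^ Suc (Suc i)) \<le> ?x (n + 1) - of_int k \<and> ?x (n + 1) - of_int k < 0
      else 0 \<le> ?x (n + 1) - of_int k \<and> ?x (n + 1) - of_int k < alpha ^ Suc (Suc i)"
      using less.prems(1) unfolding near_def slot_def 3 by auto
    have "near \<omega> i (alpha ^ Suc (Suc i)) (n + 1)"
      using k unfolding near_def slot_def by blast
    then have "near \<omega> i (alpha ^ i) (n + 1)"
      using le(2) by (rule near_mono)
    then have first: "tprod ?q z n (fib (Suc i)) = fib_mat V z i"
      using less.IH 3 by simp
    have "?x (n + int (fib (Suc i)) + 1) - of_int (k + int (fib i))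
        = (?x (n + 1) - of_int k) + (of_nat (fib (Suc i)) * alpha - of_nat (fib i))"
      by (simp add: algebra_simps)
    then have "near \<omega> (Suc i) (alpha ^ Suc i) (n + int (fib (Suc i)) + 1)"
      unfolding near_def slot_def using k le fib_alpha_even[of i] fib_alpha_odd[of i]
      by (intro exI[of _ "k + int (fib i)"]) (auto split: if_splits)
    then have second: "tprod ?q z (n + int (fib (Suc i))) (fib (Suc (Suc i))) = fib_mat V z (Suc i)"
      using less.IH[of "Suc i"] 3 by simp
    have "fib (Suc j) = fib (Suc i) + fib (Suc (Suc i))" by (simp add: 3)
    then show ?thesis
      using first second by (simp add: tprod_add 3 del: fib.simps)
  qed
qed

text \<open>Steps of \<open>fib (Suc j)\<close> sites move the orbit towards an integer in equal
  portions \<open>alpha ^ Suc j\<close>. These are not larger than the slot in front of the integer,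
  so the slot cannot be jumped over.\<close>

lemma ex_near:
  "\<exists>c\<ge>a. near \<omega> j (alpha ^ j) c"
proof -
  define x where "x = of_int a * alpha + \<omega>"
  define r where "r = alpha ^ Suc j"
  have r: "0 < r" "r \<le> alpha ^ j"
    using alpha_bounds by (auto simp: r_def)
  show ?thesis
  proof (cases "even j")
    case True
    define s where "s = of_int (\<lfloor>x\<rfloor> + 1) - x"
    define i where "i = nat (\<lceil>s / r\<rceil> - 1)"
    have "s > 0" unfolding s_def by linarith
    then have "s / r > 0" using r by simp
    then have i: "real i < s / r" "s / r \<le> real i + 1"
      unfolding i_def by linarith+
    then have i: "real i * r < s" "s \<le> real i * r + r"
      using r by (simp_all add: field_simps)
    have "of_int (a + int i * int (fib (Suc j))) * alpha + \<omega> - of_int (\<lfloor>x\<rfloor> + 1 + int i * int (fib j))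
        = - s + real i * (of_nat (fib (Suc j)) * alpha - of_nat (fib j))"
      by (simp add: x_def s_def algebra_simps)
    then have "near \<omega> j (alpha ^ j) (a + int i * int (fib (Suc j)))"
      unfolding near_def slot_def using i r True
      by (intro exI[of _ "\<lfloor>x\<rfloor> + 1 + int i * int (fib j)"]) (simp add: fib_alpha_even r_def)
    then show ?thesis by (intro exI[of _ "a + int i * int (fib (Suc j))"]) simp
  next
    case False
    define s where "s = x - of_int \<lfloor>x\<rfloor>"
    define i where "i = nat \<lfloor>s / r\<rfloor>"
    have "s \<ge> 0" by (simp add: s_def)
    then have "s / r \<ge> 0" using r by simp
    then have i: "real i \<le> s / r" "s / r < real i + 1"
      unfolding i_def by linarith+
    then have i: "real i * r \<le> s" "s < real i * r + r"
      using r by (simp_all add: field_simps)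
    have "of_int (a + int i * int (fib (Suc j))) * alpha + \<omega> - of_int (\<lfloor>x\<rfloor> + int i * int (fib j))
        = s + real i * (of_nat (fib (Suc j)) * alpha - of_nat (fib j))"
      by (simp add: x_def s_def algebra_simps)
    then have "near \<omega> j (alpha ^ j) (a + int i * int (fib (Suc j)))"
      unfolding near_def slot_def using i r False
      by (intro exI[of _ "\<lfloor>x\<rfloor> + int i * int (fib j)"]) (simp add: fib_alpha_odd r_def)
    then show ?thesis by (intro exI[of _ "a + int i * int (fib (Suc j))"]) simp
  qed
qed

text \<open>The window is moved to the right until its start spells the Fibonacci word for the first
  time. Before that no site is near an integer, hence none is a hit, the potential keeps the period,
  and the trace does not change. Only the starting site itself has to be assumed free of a
  hit.\<close>

lemma trace_tprod_fib:
  assumes a: "\<not> hit \<omega> j a" and "j \<ge> 1"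
  shows "trace (tprod (\<lambda>n. of_real (fib_potential V \<omega> n)) z a (fib (Suc j))) = fib_trace V z (Suc j)"
proof -
  let ?q = "\<lambda>n. of_real (fib_potential V \<omega> n) :: complex"
  define P where "P i \<longleftrightarrow> near \<omega> j (alpha ^ j) (a + 1 + int i)" for i
  obtain c where "c \<ge> a + 1" "near \<omega> j (alpha ^ j) c"
    using ex_near by blast
  then have "P (nat (c - (a + 1)))" by (simp add: P_def)
  then have P: "P (LEAST i. P i)" by (rule LeastI)
  define N where "N = (LEAST i. P i)"
  have le: "alpha ^ Suc j \<le> alpha ^ j" using alpha_bounds by simp
  have no: "\<not> hit \<omega> j (a + int i)" if "i \<le> N" for i
  proof (cases i)
    case (Suc i')
    then have "\<not> P i'" using that not_less_Least[of i' P] by (simp add: N_def)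
    then show ?thesis
      using near_mono[OF hit_near le] by (auto simp: P_def Suc add_ac)
  qed (use a in simp)
  have "trace (tprod ?q z (a + int i) (fib (Suc j))) = trace (tprod ?q z a (fib (Suc j)))" if "i \<le> N" for i
    using that
  proof (induction i)
    case (Suc i)
    have "fib_potential V \<omega> (a + int i + int (fib (Suc j))) = fib_potential V \<omega> (a + int i)"
      using no[of i] no[of "Suc i"] Suc.prems by (intro fib_potential_period) (simp_all add: add_ac)
    then have "trace (tprod ?q z (a + int i + 1) (fib (Suc j))) = trace (tprod ?q z (a + int i) (fib (Suc j)))"
      by (intro trace_tprod_Suc) simp
    then show ?case using Suc by (simp add: add_ac)
  qed simp
  from this[of N] show ?thesis
    using tprod_fib_mat[of \<omega> j "a + int N" V z] P \<open>j \<ge> 1\<close> trace_fib_mat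
    by (simp add: P_def N_def add_ac)
qed

text \<open>Two adjacent hits would put alpha closer than alpha^2 = 1 - alpha to an integer, but 1 -
  alpha is its distance to the nearest one.\<close>

lemma not_hit_pair:
  assumes "j \<ge> 1" "hit \<omega> j c"
  shows "\<not> hit \<omega> j (c + 1)"
proof
  assume "hit \<omega> j (c + 1)"
  obtain k where k: "slot j (alpha ^ Suc j) (of_int c * alpha + \<omega> - of_int k)"
    using hit_near[OF assms(2)] unfolding near_def by blast
  obtain k' where k': "slot j (alpha ^ Suc j) (of_int (c + 1) * alpha + \<omega> - of_int k')"
    using hit_near[OF \<open>hit \<omega> j (c + 1)\<close>] unfolding near_def by blast
  have "\<bar>(of_int c * alpha + \<omega> - of_int k) - (of_int (c + 1) * alpha + \<omega> - of_int k')\<bar> < alpha ^ Suc j"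
    using k k' unfolding slot_def by (cases "even j") (simp_all only: if_True if_False, linarith+)
  then have "\<bar>of_int (k' - k) - alpha\<bar> < alpha ^ Suc j" by (simp add: algebra_simps)
  also have "alpha ^ Suc j \<le> alpha ^ 2"
    using alpha_bounds assms by (intro power_decreasing) auto
  also have "alpha ^ 2 = 1 - alpha" by (simp add: power2_eq_square alpha_square)
  finally have *: "\<bar>of_int (k' - k) - alpha\<bar> < 1 - alpha" .
  then have "k' - k < 1" "k' - k > - 1" using alpha_bounds by linarith+
  then have "k' - k = 0" by linarith
  then show False using * alpha_bounds by simp
qed

section \<open>Growth of solutions with bounded traces\<close>

abbreviation mass :: "(int \<Rightarrow> complex) \<Rightarrow> int set \<Rightarrow> real" where
  "mass u S \<equiv> (\<Sum>n\<in>S. (cmod (u n))\<^sup>2)"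

definition window_mass :: "(int \<Rightarrow> complex) \<Rightarrow> int \<Rightarrow> int \<Rightarrow> real" where
  "window_mass u m r = mass u {m..m + r}"

lemma window_mass_nonneg [simp]: "0 \<le> window_mass u m r"
  by (simp add: window_mass_def sum_nonneg)

lemma window_mass_mono: "r \<le> r' \<Longrightarrow> window_mass u m r \<le> window_mass u m r'"
  unfolding window_mass_def by (rule sum_mono2) auto

text \<open>Since \<open>l < p\<close>, both translates of the short window lie in the part that is
  added to it. The relation expresses the values on the short window by those on the translates, so
  the added part carries at least the fraction 1 / (2 B^2 + 2) of the old mass.\<close>

lemma window_mass_step:
  assumes rec: "\<And>n. m \<le> n \<Longrightarrow> n \<le> m + l \<Longrightarrow> u n + u (n + 2 * p) = x * u (n + p)"
    and x: "cmod x \<le> B" and l: "0 \<le> l" "l < p"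
  shows "(1 + 1 / (2 * B\<^sup>2 + 2)) * window_mass u m l \<le> window_mass u m (2 * p + l)"
proof -
  let ?f = "\<lambda>n. (cmod (u n))\<^sup>2"
  have split: "window_mass u m (2 * p + l) = window_mass u m l + sum ?f {m + l + 1..m + 2 * p + l}"
  proof -
    have "{m..m + (2 * p + l)} = {m..m + l} \<union> {m + l + 1..m + 2 * p + l}"
      using l by auto
    then show ?thesis unfolding window_mass_def by (simp add: sum.union_disjoint)
  qed
  have shift: "(\<Sum>n\<in>{m..m + l}. ?f (n + d)) \<le> sum ?f {m + l + 1..m + 2 * p + l}"
    if "d = p \<or> d = 2 * p" for d
  proof -
    have "(\<Sum>n\<in>{m..m + l}. ?f (n + d)) = sum ?f ((\<lambda>n. n + d) ` {m..m + l})"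
      by (subst sum.reindex) auto
    also have "\<dots> \<le> sum ?f {m + l + 1..m + 2 * p + l}"
      using that l by (intro sum_mono2) auto
    finally show ?thesis .
  qed
  have "?f n \<le> 2 * B\<^sup>2 * ?f (n + p) + 2 * ?f (n + 2 * p)" if "n \<in> {m..m + l}" for n
  proof -
    have "u n = x * u (n + p) - u (n + 2 * p)"
      using rec[of n] that by (simp add: algebra_simps)
    then have "cmod (u n) \<le> cmod x * cmod (u (n + p)) + cmod (u (n + 2 * p))"
      by (metis norm_mult norm_triangle_ineq4)
    also have "\<dots> \<le> B * cmod (u (n + p)) + cmod (u (n + 2 * p))"
      using x by (intro add_mono mult_right_mono) auto
    finally have "?f n \<le> (B * cmod (u (n + p)) + cmod (u (n + 2 * p)))\<^sup>2"
      by (intro power_mono) auto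
    also have "\<dots> \<le> 2 * (B * cmod (u (n + p)))\<^sup>2 + 2 * ?f (n + 2 * p)"
      using sum_squares_bound[of "B * cmod (u (n + p))" "cmod (u (n + 2 * p))"]
      by (simp add: power2_sum)
    finally show ?thesis by (simp add: power_mult_distrib)
  qed
  then have "window_mass u m l
      \<le> 2 * B\<^sup>2 * (\<Sum>n\<in>{m..m + l}. ?f (n + p)) + 2 * (\<Sum>n\<in>{m..m + l}. ?f (n + 2 * p))"
    unfolding window_mass_def sum_distrib_left sum.distrib[symmetric] by (intro sum_mono)
  also have "\<dots> \<le> 2 * B\<^sup>2 * sum ?f {m + l + 1..m + 2 * p + l} + 2 * sum ?f {m + l + 1..m + 2 * p + l}"
    by (intro add_mono mult_left_mono shift) auto
  also have "\<dots> = (2 * B\<^sup>2 + 2) * (window_mass u m (2 * p + l) - window_mass u m l)"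
    unfolding split by (simp add: algebra_simps)
  finally have "window_mass u m l / (2 * B\<^sup>2 + 2) \<le> window_mass u m (2 * p + l) - window_mass u m l"
    by (subst pos_divide_le_eq) (auto simp: add_nonneg_pos mult.commute)
  then show ?thesis by (simp add: algebra_simps)
qed

text \<open>A step with a period of at most \<open>fib (k + 4)\<close> ends inside the window of
  index k + 6, because fib (k + 6) = 2 fib (k + 4) + fib (k + 3). The period may differ from step to
  step. The hypothesis speaks only of a three-term relation so that it also covers reflected
  sequences.\<close>

lemma window_mass_growth:
  assumes rec: "\<And>k l. 1 \<le> k \<Longrightarrow> k + 4 \<le> N \<Longrightarrow> 0 \<le> l \<Longrightarrow> l < int (fib k) \<Longrightarrow>
      \<exists>p x. int (fib (Suc k)) \<le> p \<and> p \<le> int (fib (k + 4)) \<and> cmod x \<le> B \<and>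
        (\<forall>n. m \<le> n \<longrightarrow> n \<le> m + l \<longrightarrow> u n + u (n + 2 * p) = x * u (n + p))"
    and k: "1 \<le> k" and "k + 6 * r \<le> N"
  shows "(1 + 1 / (2 * B\<^sup>2 + 2)) ^ r * window_mass u m (int (fib k) - 1)
    \<le> window_mass u m (int (fib (k + 6 * r)) - 1)"
  using \<open>k + 6 * r \<le> N\<close>
proof (induction r)
  case (Suc r)
  let ?c = "1 + 1 / (2 * B\<^sup>2 + 2)" and ?k = "k + 6 * r"
  have c: "?c \<ge> 0" by (simp add: add_nonneg_nonneg)
  define l where "l = int (fib ?k) - 1"
  have "fib ?k > 0" using k by (intro fib_neq_0_nat) simp
  then have l: "0 \<le> l" "l < int (fib ?k)" by (simp_all add: l_def)
  then obtain p x where p: "int (fib (Suc ?k)) \<le> p" "p \<le> int (fib (?k + 4))" and x: "cmod x \<le> B"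
    and "\<And>n. m \<le> n \<Longrightarrow> n \<le> m + l \<Longrightarrow> u n + u (n + 2 * p) = x * u (n + p)"
    using rec[of ?k l] k Suc.prems by auto
  moreover have "l < p" using l p(1) fib_Suc_mono[of ?k] by linarith
  ultimately have step: "?c * window_mass u m l \<le> window_mass u m (2 * p + l)"
    using l by (intro window_mass_step) auto
  have "fib (?k + 6) = 2 * fib (?k + 4) + fib (?k + 3)"
    by (simp add: eval_nat_numeral)
  moreover have "fib ?k \<le> fib (?k + 3)" by (rule fib_mono) simp
  ultimately have le: "2 * p + l \<le> int (fib (k + 6 * Suc r)) - 1"
    using p(2) by (simp add: l_def add_ac)
  have "?c ^ Suc r * window_mass u m (int (fib k) - 1) \<le> ?c * window_mass u m l"
    using Suc c by (auto simp: l_def mult.assoc intro!: mult_left_mono)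
  also have "\<dots> \<le> window_mass u m (int (fib (k + 6 * Suc r)) - 1)"
    using step window_mass_mono[OF le, of u m] by linarith
  finally show ?case .
qed simp

text \<open>The equation may fail at \<open>a - 1\<close>, the place of a point source. The second
  component of the period relation nevertheless includes this site, so the windows can be centred at
  the source.\<close>

lemma gordon_right:
  assumes no_hit: "\<And>c. a \<le> c \<Longrightarrow> c \<le> a + int (fib (Suc j)) + l \<Longrightarrow> \<not> hit \<omega> j c"
    and sol: "\<And>n. a \<le> n \<Longrightarrow> u (n + 1) + u (n - 1) + of_real (fib_potential V \<omega> n) * u n = z * u n"
    and "j \<ge> 1" "a \<le> n" "n \<le> a + l"
  shows "u (n - 1) + u (n - 1 + 2 * int (fib (Suc j)))
    = fib_trace V z (Suc j) * u (n - 1 + int (fib (Suc j)))"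
proof -
  have "u (n - 1) + u (n - 1 + 2 * int (fib (Suc j)))
    = trace (tprod (\<lambda>n. of_real (fib_potential V \<omega> n)) z n (fib (Suc j))) * u (n - 1 + int (fib (Suc j)))"
    by (rule two_periods) (use assms in \<open>auto intro!: fib_potential_period\<close>)
  then show ?thesis
    using trace_tprod_fib[of \<omega> j n V z] no_hit[of n] assms by simp
qed

lemma gordon_left:
  assumes no_hit: "\<And>c. a - 2 * int (fib (Suc j)) - l \<le> c \<Longrightarrow> c \<le> a - int (fib (Suc j)) \<Longrightarrow> \<not> hit \<omega> j c"
    and sol: "\<And>n. n < a \<Longrightarrow> u (n + 1) + u (n - 1) + of_real (fib_potential V \<omega> n) * u n = z * u n"
    and "j \<ge> 1" "a - l \<le> n" "n \<le> a"
  shows "u n + u (n - 2 * int (fib (Suc j))) = fib_trace V z (Suc j) * u (n - int (fib (Suc j)))"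
proof -
  let ?b = "n - 2 * int (fib (Suc j))"
  have "u ?b + u (?b + 2 * int (fib (Suc j)))
    = trace (tprod (\<lambda>n. of_real (fib_potential V \<omega> n)) z ?b (fib (Suc j))) * u (?b + int (fib (Suc j)))"
    by (rule two_periods) (use assms in \<open>auto intro!: fib_potential_period\<close>)
  then show ?thesis
    using trace_tprod_fib[of \<omega> j ?b V z] no_hit[of ?b] assms by (simp add: add.commute)
qed

text \<open>The two half-lines on both sides of the source \<open>m\<close> are treated separately,
  the left one after a reflection; the periods found on them need not agree.\<close>

lemma mass_growth:
  fixes u :: "int \<Rightarrow> complex"
  assumes sol: "\<And>n. n \<noteq> m \<Longrightarrow> u (n + 1) + u (n - 1) + of_real (fib_potential V \<omega> n) * u n = z * u n"
    and tr: "\<And>i. i \<le> N \<Longrightarrow> cmod (fib_trace V z i) \<le> B"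
    and k: "1 \<le> k" and N: "k + 6 * r \<le> N"
  shows "(1 + 1 / (2 * B\<^sup>2 + 2)) ^ r * mass u {n. \<bar>n - m\<bar> < int (fib k)}
    \<le> 2 * mass u {n. \<bar>n - m\<bar> < int (fib (k + 6 * r))}"
proof -
  let ?c = "(1 + 1 / (2 * B\<^sup>2 + 2)) ^ r" and ?f = "\<lambda>n. (cmod (u n))\<^sup>2"
  define u' where "u' n = u (- n)" for n
  have fib_bounds: "int (fib (Suc k)) \<le> int (fib (Suc j))" "int (fib (Suc j)) \<le> int (fib (k + 4))"
    if "k \<le> j" "j \<le> k + 3" for j k
    using that by (auto intro!: fib_mono)
  have right: "?c * window_mass u m (int (fib k) - 1) \<le> window_mass u m (int (fib (k + 6 * r)) - 1)"
  proof (rule window_mass_growth[OF _ k N])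
    fix k l assume kl: "1 \<le> k" "k + 4 \<le> N" "0 \<le> l" "l < int (fib k)"
    obtain j where j: "k \<le> j" "j \<le> k + 3"
      and no: "\<And>c. m + 1 \<le> c \<Longrightarrow> c \<le> m + 1 + int (fib (Suc j)) + l \<Longrightarrow> \<not> hit \<omega> j c"
      using hit_free_right[OF kl(3,4)] by blast
    have "u n + u (n + 2 * int (fib (Suc j))) = fib_trace V z (Suc j) * u (n + int (fib (Suc j)))"
      if "m \<le> n" "n \<le> m + l" for n
      using gordon_right[of "m + 1" j l \<omega> u V z "n + 1", OF no sol] that kl(1) j by simp
    then show "\<exists>p x. int (fib (Suc k)) \<le> p \<and> p \<le> int (fib (k + 4)) \<and> cmod x \<le> B \<and>
        (\<forall>n. m \<le> n \<longrightarrow> n \<le> m + l \<longrightarrow> u n + u (n + 2 * p) = x * u (n + p))"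
      using tr[of "Suc j"] j kl(2) fib_bounds[OF j]
      by (intro exI[of _ "int (fib (Suc j))"] exI[of _ "fib_trace V z (Suc j)"]) auto
  qed
  have left: "?c * window_mass u' (- m) (int (fib k) - 1) \<le> window_mass u' (- m) (int (fib (k + 6 * r)) - 1)"
  proof (rule window_mass_growth[OF _ k N])
    fix k l assume kl: "1 \<le> k" "k + 4 \<le> N" "0 \<le> l" "l < int (fib k)"
    obtain j where j: "k \<le> j" "j \<le> k + 3"
      and no: "\<And>c. m - 2 * int (fib (Suc j)) - l \<le> c \<Longrightarrow> c \<le> m - int (fib (Suc j)) \<Longrightarrow> \<not> hit \<omega> j c"
      using hit_free_left[OF kl(3,4)] by blast
    have "u' n + u' (n + 2 * int (fib (Suc j))) = fib_trace V z (Suc j) * u' (n + int (fib (Suc j)))"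
      if "- m \<le> n" "n \<le> - m + l" for n
      using gordon_left[of m j l \<omega> u V z "- n", OF no sol] that kl(1) j by (simp add: u'_def)
    then show "\<exists>p x. int (fib (Suc k)) \<le> p \<and> p \<le> int (fib (k + 4)) \<and> cmod x \<le> B \<and>
        (\<forall>n. - m \<le> n \<longrightarrow> n \<le> - m + l \<longrightarrow> u' n + u' (n + 2 * p) = x * u' (n + p))"
      using tr[of "Suc j"] j kl(2) fib_bounds[OF j]
      by (intro exI[of _ "int (fib (Suc j))"] exI[of _ "fib_trace V z (Suc j)"]) auto
  qed
  have u': "window_mass u' (- m) (L - 1) = sum ?f {n. n \<le> m \<and> m - L < n}" for L
    unfolding window_mass_def
    by (rule sum.reindex_bij_witness[of _ uminus uminus]) (auto simp: u'_def)
  have u: "window_mass u m (L - 1) = sum ?f {n. m \<le> n \<and> n < m + L}" for L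
    unfolding window_mass_def by (rule sum.cong) auto
  have fin: "finite {n. n \<le> m \<and> m - L < n}" "finite {n. m \<le> n \<and> n < m + L}" "finite {n. \<bar>n - m\<bar> < L}" for L
    by (rule finite_subset[of _ "{m - L..m + L}"]; auto)+
  have upper: "sum ?f {n. \<bar>n - m\<bar> < L} \<le> window_mass u m (L - 1) + window_mass u' (- m) (L - 1)" for L
  proof -
    have "sum ?f {n. \<bar>n - m\<bar> < L} \<le> sum ?f ({n. m \<le> n \<and> n < m + L} \<union> {n. n \<le> m \<and> m - L < n})"
      by (rule sum_mono2) (auto simp: fin)
    also have "\<dots> \<le> sum ?f {n. m \<le> n \<and> n < m + L} + sum ?f {n. n \<le> m \<and> m - L < n}"
      by (subst sum_Un) (auto simp: fin sum_nonneg)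
    finally show ?thesis by (simp only: u u')
  qed
  \<comment> \<open>The centre belongs to both half windows, whence the factor 2.\<close>
  have lower: "window_mass u m (L - 1) + window_mass u' (- m) (L - 1) \<le> 2 * sum ?f {n. \<bar>n - m\<bar> < L}" for L
  proof -
    have "window_mass u m (L - 1) \<le> sum ?f {n. \<bar>n - m\<bar> < L}"
      unfolding u by (rule sum_mono2) (auto simp: fin)
    moreover have "window_mass u' (- m) (L - 1) \<le> sum ?f {n. \<bar>n - m\<bar> < L}"
      unfolding u' by (rule sum_mono2) (auto simp: fin)
    ultimately show ?thesis by linarith
  qed
  have "?c * sum ?f {n. \<bar>n - m\<bar> < int (fib k)}
      \<le> ?c * (window_mass u m (int (fib k) - 1) + window_mass u' (- m) (int (fib k) - 1))"
    by (intro mult_left_mono upper zero_le_power add_nonneg_nonneg) simp_all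
  also have "\<dots> \<le> window_mass u m (int (fib (k + 6 * r)) - 1) + window_mass u' (- m) (int (fib (k + 6 * r)) - 1)"
    unfolding distrib_left by (intro add_mono left right)
  also have "\<dots> \<le> 2 * sum ?f {n. \<bar>n - m\<bar> < int (fib (k + 6 * r))}"
    by (rule lower)
  finally show ?thesis .
qed

section \<open>Square-summable sequences\<close>

lemma ell2_add:
  assumes f: "f \<in> ell2" and g: "g \<in> ell2"
  shows "(\<lambda>n. f n + g n) \<in> ell2" "ell2_norm (\<lambda>n. f n + g n) \<le> ell2_norm f + ell2_norm g"
proof -
  have *: "L2_set (\<lambda>n. cmod (f n + g n)) F \<le> ell2_norm f + ell2_norm g" if "finite F" for F
  proof -
    have "L2_set (\<lambda>n. cmod (f n + g n)) F \<le> L2_set (\<lambda>n. cmod (f n) + cmod (g n)) F"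
      by (intro L2_set_mono) (auto intro: norm_triangle_ineq)
    also have "\<dots> \<le> L2_set (\<lambda>n. cmod (f n)) F + L2_set (\<lambda>n. cmod (g n)) F"
      by (rule L2_set_triangle_ineq)
    also have "\<dots> \<le> ell2_norm f + ell2_norm g"
      by (intro add_mono L2_set_le_ell2_norm that f g)
    finally show ?thesis .
  qed
  show "(\<lambda>n. f n + g n) \<in> ell2" "ell2_norm (\<lambda>n. f n + g n) \<le> ell2_norm f + ell2_norm g"
    by (rule ell2_bound, rule *, assumption)+
qed

lemma ell2_scale:
  assumes f: "f \<in> ell2"
  shows "(\<lambda>n. c * f n) \<in> ell2" "ell2_norm (\<lambda>n. c * f n) \<le> cmod c * ell2_norm f"
proof -
  have *: "L2_set (\<lambda>n. cmod (c * f n)) F \<le> cmod c * ell2_norm f" if "finite F" for F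
    using mult_left_mono[OF L2_set_le_ell2_norm[OF f that], of "cmod c"]
    by (simp add: norm_mult L2_set_right_distrib)
  show "(\<lambda>n. c * f n) \<in> ell2" "ell2_norm (\<lambda>n. c * f n) \<le> cmod c * ell2_norm f"
    by (rule ell2_bound, rule *, assumption)+
qed

lemma sum_le_ell2_norm:
  assumes "\<psi> \<in> ell2" "finite F"
  shows "mass \<psi> F \<le> (ell2_norm \<psi>)\<^sup>2"
  using power_mono[OF L2_set_le_ell2_norm[OF assms], of 2] by (simp add: L2_set_def sum_nonneg)

lemma ell2_norm_square: "(ell2_norm \<psi>)\<^sup>2 = (\<Sum>\<^sub>\<infinity>n. (cmod (\<psi> n))\<^sup>2)"
  by (simp add: ell2_norm_def infsum_nonneg)

lemma ell2_boundI:
  assumes "\<And>F. finite F \<Longrightarrow> mass \<psi> F \<le> B\<^sup>2" "B \<ge> 0"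
  shows "\<psi> \<in> ell2" "ell2_norm \<psi> \<le> B"
proof -
  have *: "L2_set (\<lambda>n. cmod (\<psi> n)) F \<le> B" if "finite F" for F
    unfolding L2_set_def using assms(1)[OF that] assms(2) by (rule real_le_lsqrt[rotated 1])
  show "\<psi> \<in> ell2" "ell2_norm \<psi> \<le> B"
    by (rule ell2_bound, rule *, assumption)+
qed

lemma ell2_tail:
  assumes \<psi>: "\<psi> \<in> ell2" and "\<eta> > 0"
  obtains W :: nat where "(\<lambda>n. if \<bar>n\<bar> \<le> int W then 0 else \<psi> n) \<in> ell2"
    "ell2_norm (\<lambda>n. if \<bar>n\<bar> \<le> int W then 0 else \<psi> n) \<le> \<eta>"
proof -
  let ?f = "\<lambda>n. (cmod (\<psi> n))\<^sup>2"
  have hs: "(?f has_sum infsum ?f UNIV) UNIV"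
    using \<psi> by (simp add: ell2_def)
  obtain F where F: "finite F" "dist (sum ?f F) (infsum ?f UNIV) \<le> \<eta>\<^sup>2"
    using has_sum_finite_approximation[OF hs, of "\<eta>\<^sup>2"] \<open>\<eta> > 0\<close> by auto
  obtain W where W: "F \<subseteq> {- int W..int W}"
  proof -
    obtain W where "\<forall>n\<in>F. \<bar>n\<bar> \<le> int W"
    proof
      show "\<forall>n\<in>F. \<bar>n\<bar> \<le> int (nat (\<Sum>n\<in>F. \<bar>n\<bar>))"
      proof
        fix n assume "n \<in> F"
        then have "\<bar>n\<bar> \<le> (\<Sum>n\<in>F. \<bar>n\<bar>)" using F(1) by (intro member_le_sum) auto
        then show "\<bar>n\<bar> \<le> int (nat (\<Sum>n\<in>F. \<bar>n\<bar>))" by simp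
      qed
    qed
    then have "n \<in> {- int W..int W}" if "n \<in> F" for n using that by (force simp: abs_le_iff)
    then show thesis by (intro that[of W] subsetI)
  qed
  have "(\<Sum>n\<in>G. (cmod (if \<bar>n\<bar> \<le> int W then 0 else \<psi> n))\<^sup>2) \<le> \<eta>\<^sup>2" if G: "finite G" for G
  proof -
    have "(\<Sum>n\<in>G. (cmod (if \<bar>n\<bar> \<le> int W then 0 else \<psi> n))\<^sup>2) \<le> (\<Sum>n\<in>G \<union> F. (cmod (if \<bar>n\<bar> \<le> int W then 0 else \<psi> n))\<^sup>2)"
      using F G by (intro sum_mono2) auto
    also have "\<dots> = (\<Sum>n\<in>(G \<union> F) - F. (cmod (if \<bar>n\<bar> \<le> int W then 0 else \<psi> n))\<^sup>2)"
      using F G W by (intro sum.mono_neutral_right) (auto simp: abs_le_iff subset_iff minus_le_iff)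
    also have "\<dots> \<le> (\<Sum>n\<in>(G \<union> F) - F. ?f n)"
      by (intro sum_mono) auto
    also have "\<dots> = sum ?f (G \<union> F) - sum ?f F"
      using F G by (intro sum_diff) auto
    also have "sum ?f (G \<union> F) \<le> infsum ?f UNIV"
      using F G \<psi> by (intro finite_sum_le_infsum) (auto simp: ell2_def)
    finally show ?thesis using F(2) by (simp add: dist_real_def)
  qed
  from ell2_boundI[OF this] \<open>\<eta> > 0\<close> show thesis
    by (intro that[of W]) auto
qed

section \<open>Approximate eigenvectors and periodic approximants\<close>

text \<open>The first-order condition at a minimum, to be used for the variational characterisation
  of eigenvectors.\<close>

lemma quadratic_nonneg_linear_zero:
  fixes b c :: real
  assumes "\<And>t. 0 \<le> 2 * t * b + t\<^sup>2 * c" "c \<ge> 0"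
  shows "b = 0"
proof (rule ccontr)
  assume "b \<noteq> 0"
  define k where "k = 1 / (c + 1)"
  have k: "k > 0" "k * c \<le> 1"
    using \<open>c \<ge> 0\<close> by (simp_all add: k_def)
  have "2 * (- b * k) * b + (- b * k)\<^sup>2 * c = b\<^sup>2 * k * (k * c - 2)"
    by (simp add: algebra_simps power2_eq_square)
  also have "\<dots> < 0"
    using \<open>b \<noteq> 0\<close> k by (intro mult_pos_neg) auto
  finally show False using assms(1)[of "- b * k"] by simp
qed

text \<open>Functions that vanish outside \<open>P\<close> stand for vectors with index set
  \<open>P\<close>. In the product topology the sphere is a closed part of a product of discs, and
  the size of \<open>P\<close> can remain a variable.\<close>

lemma compact_unit_sphere_fun:
  assumes "finite P"
  shows "compact {f :: 'i \<Rightarrow> complex. (\<forall>i. i \<notin> P \<longrightarrow> f i = 0) \<and> (\<Sum>i\<in>P. (cmod (f i))\<^sup>2) = 1}"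
proof -
  let ?S = "\<lambda>i. if i \<in> P then cball 0 1 else {0 :: complex}"
  have "compactin (product_topology (\<lambda>i :: 'i. euclidean) UNIV) (PiE UNIV ?S)"
    unfolding compactin_PiE by (auto simp: compactin_euclidean_iff)
  then have comp: "compact (PiE UNIV ?S)"
    unfolding euclidean_product_topology compactin_euclidean_iff .
  have "closed {f :: 'i \<Rightarrow> complex. (\<Sum>i\<in>P. (cmod (f i))\<^sup>2) = 1}"
    by (intro closed_Collect_eq continuous_intros continuous_on_product_coordinates)
  moreover have "{f :: 'i \<Rightarrow> complex. (\<Sum>i\<in>P. (cmod (f i))\<^sup>2) = 1}
      = (\<lambda>f. \<Sum>i\<in>P. (cmod (f i))\<^sup>2) -` {1}"
    by auto
  ultimately have "closed ((\<lambda>f :: 'i \<Rightarrow> complex. \<Sum>i\<in>P. (cmod (f i))\<^sup>2) -` {1})"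
    by simp
  with comp have "compact (PiE UNIV ?S \<inter> (\<lambda>f. \<Sum>i\<in>P. (cmod (f i))\<^sup>2) -` {1})"
    by (rule compact_Int_closed)
  also have "PiE UNIV ?S \<inter> (\<lambda>f. \<Sum>i\<in>P. (cmod (f i))\<^sup>2) -` {1}
      = {f. (\<forall>i. i \<notin> P \<longrightarrow> f i = 0) \<and> (\<Sum>i\<in>P. (cmod (f i))\<^sup>2) = 1}"
  proof (intro equalityI subsetI)
    fix f :: "'i \<Rightarrow> complex"
    assume f: "f \<in> {f. (\<forall>i. i \<notin> P \<longrightarrow> f i = 0) \<and> (\<Sum>i\<in>P. (cmod (f i))\<^sup>2) = 1}"
    have "cmod (f i) \<le> 1" if "i \<in> P" for i
    proof -
      have "(cmod (f i))\<^sup>2 \<le> 1"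
        using member_le_sum[OF that, of "\<lambda>i. (cmod (f i))\<^sup>2"] f assms by simp
      then show ?thesis by (simp add: abs_square_le_1)
    qed
    with f show "f \<in> PiE UNIV ?S \<inter> (\<lambda>f. \<Sum>i\<in>P. (cmod (f i))\<^sup>2) -` {1}"
      by auto
  next
    fix f :: "'i \<Rightarrow> complex"
    assume f: "f \<in> PiE UNIV ?S \<inter> (\<lambda>f. \<Sum>i\<in>P. (cmod (f i))\<^sup>2) -` {1}"
    have "f i = 0" if "i \<notin> P" for i
      using PiE_mem[of f UNIV ?S i] f that by simp
    with f show "f \<in> {f. (\<forall>i. i \<notin> P \<longrightarrow> f i = 0) \<and> (\<Sum>i\<in>P. (cmod (f i))\<^sup>2) = 1}"
      by simp
  qed
  finally show ?thesis .
qed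

lemma cmod_square_add_scaled:
  "(cmod (x + of_real t * y))\<^sup>2 = (cmod x)\<^sup>2 + 2 * t * Re (cnj y * x) + t\<^sup>2 * (cmod y)\<^sup>2"
  unfolding cmod_power2 by (simp add: power2_eq_square algebra_simps)

text \<open>Let A = h - E and let f minimise the norm of A f on the unit sphere, with minimum s; the
  test vector g shows s \<le> d. Stationarity gives A^2 f = s^2 f, that is (A + s) (A - s) f = 0. So
  either f is an eigenvector of h for E + s, or (A - s) f is one for E - s.\<close>

lemma hermitian_eigenvalue_near:
  fixes h :: "'i \<Rightarrow> 'i \<Rightarrow> complex" and E d :: real
  assumes fin: "finite P" and herm: "\<And>i j. i \<in> P \<Longrightarrow> j \<in> P \<Longrightarrow> h i j = cnj (h j i)"
    and g: "(\<Sum>i\<in>P. (cmod (g i))\<^sup>2) > 0" and "d \<ge> 0"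
    and le: "(\<Sum>i\<in>P. (cmod ((\<Sum>j\<in>P. h i j * g j) - of_real E * g i))\<^sup>2) \<le> d\<^sup>2 * (\<Sum>i\<in>P. (cmod (g i))\<^sup>2)"
  obtains ev :: real and f where "\<bar>ev - E\<bar> \<le> d" "\<exists>i\<in>P. f i \<noteq> 0"
    "\<And>i. i \<in> P \<Longrightarrow> (\<Sum>j\<in>P. h i j * f j) = of_real ev * f i"
proof -
  define A where "A f i = (\<Sum>j\<in>P. h i j * f j) - of_real E * f i" for f i
  define N where "N f = (\<Sum>i\<in>P. (cmod (f i))\<^sup>2)" for f :: "'i \<Rightarrow> complex"
  define S where "S = {f :: 'i \<Rightarrow> complex. (\<forall>i. i \<notin> P \<longrightarrow> f i = 0) \<and> N f = 1}"
  have N_nonneg: "N f \<ge> 0" for f by (simp add: N_def sum_nonneg)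
  have A_scale: "A (\<lambda>i. of_real c * f i) i = of_real c * A f i" for c f i
    by (simp add: A_def sum_distrib_left algebra_simps)
  have A_cong: "A f i = A f' i" if "\<And>j. j \<in> P \<Longrightarrow> f j = f' j" "i \<in> P" for f f' i
    using that by (simp add: A_def)
  have N_cong: "N f = N f'" if "\<And>i. i \<in> P \<Longrightarrow> f i = f' i" for f f'
    using that by (simp add: N_def)
  have A_add: "A (\<lambda>i. f i + of_real c * f' i) i = A f i + of_real c * A f' i" for c f f' i
    by (simp add: A_def sum_distrib_left sum.distrib algebra_simps)
  have N_scale: "N (\<lambda>i. of_real c * f i) = c\<^sup>2 * N f" for c f
    by (simp add: N_def sum_distrib_left norm_mult power_mult_distrib)
  have normalise: "(\<lambda>i. if i \<in> P then of_real (1 / sqrt (N f)) * f i else 0) \<in> S"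
    "N (A (\<lambda>i. if i \<in> P then of_real (1 / sqrt (N f)) * f i else 0)) = N (A f) / N f" if "N f > 0" for f
  proof -
    let ?f = "\<lambda>i. if i \<in> P then of_real (1 / sqrt (N f)) * f i else 0"
    have "N ?f = N (\<lambda>i. of_real (1 / sqrt (N f)) * f i)" by (simp add: N_def)
    also have "\<dots> = 1" using that unfolding N_scale by (simp add: power_divide)
    finally show "?f \<in> S" by (simp add: S_def)
    have "A ?f i = of_real (1 / sqrt (N f)) * A f i" if "i \<in> P" for i
      unfolding A_scale[symmetric] by (rule A_cong) (use that in auto)
    then have "N (A ?f) = N (\<lambda>i. of_real (1 / sqrt (N f)) * A f i)"
      by (rule N_cong)
    also have "\<dots> = N (A f) / N f" using that unfolding N_scale by (simp add: power_divide)
    finally show "N (A ?f) = N (A f) / N f" .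
  qed
  have Ng: "N g > 0" using g by (simp add: N_def)
  have "compact S" using compact_unit_sphere_fun[OF fin] by (simp add: S_def N_def)
  moreover have "S \<noteq> {}" using normalise(1)[OF Ng] by blast
  moreover have "continuous_on S (\<lambda>f. N (A f))"
    unfolding N_def A_def
    by (intro continuous_intros continuous_on_subset[OF continuous_on_product_coordinates]) auto
  ultimately obtain f where f: "f \<in> S" and min: "\<And>f'. f' \<in> S \<Longrightarrow> N (A f) \<le> N (A f')"
    using continuous_attains_inf by metis
  define s where "s = sqrt (N (A f))"
  have s: "s \<ge> 0" "s\<^sup>2 = N (A f)" using N_nonneg by (simp_all add: s_def)
  have min': "s\<^sup>2 * N f' \<le> N (A f')" for f'
  proof (cases "N f' > 0")
    case True
    then have "s\<^sup>2 \<le> N (A f') / N f'"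
      using min[OF normalise(1)[OF True]] normalise(2)[OF True] s by simp
    with True show ?thesis by (simp add: field_simps)
  qed (use N_nonneg[of f'] N_nonneg[of "A f'"] in simp)
  have "s\<^sup>2 * N g \<le> d\<^sup>2 * N g"
    using min'[of g] le by (simp add: N_def A_def)
  then have "s\<^sup>2 \<le> d\<^sup>2" using Ng by simp
  then have "s \<le> d" using \<open>d \<ge> 0\<close> by (rule power2_le_imp_le)
  define ip where "ip f f' = Re (\<Sum>i\<in>P. cnj (f i) * f' i)" for f f' :: "'i \<Rightarrow> complex"
  have N_add: "N (\<lambda>i. f i + of_real t * f' i) = N f + 2 * t * ip f' f + t\<^sup>2 * N f'" for f f' t
    unfolding N_def ip_def cmod_square_add_scaled Re_sum by (simp only: sum.distrib sum_distrib_left)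
  have symm: "ip (A f) f' = ip f (A f')" for f f'
  proof -
    have "(\<Sum>i\<in>P. cnj (\<Sum>j\<in>P. h i j * f j) * f' i) = (\<Sum>i\<in>P. \<Sum>j\<in>P. cnj (f j) * (h j i * f' i))"
      unfolding cnj_sum sum_distrib_right
      by (intro sum.cong refl) (simp add: herm[symmetric] complex_cnj_mult mult_ac)
    also have "\<dots> = (\<Sum>j\<in>P. cnj (f j) * (\<Sum>i\<in>P. h j i * f' i))"
      by (subst sum.swap) (simp add: sum_distrib_left)
    finally have *: "(\<Sum>i\<in>P. cnj (\<Sum>j\<in>P. h i j * f j) * f' i) = (\<Sum>j\<in>P. cnj (f j) * (\<Sum>i\<in>P. h j i * f' i))" .
    have **: "(\<Sum>i\<in>P. cnj (of_real E * f i) * f' i) = (\<Sum>i\<in>P. cnj (f i) * (of_real E * f' i))"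
      by (intro sum.cong refl) simp
    show ?thesis
      unfolding ip_def A_def complex_cnj_diff left_diff_distrib right_diff_distrib sum_subtractf * ** ..
  qed
  have ip_diff: "ip f' (\<lambda>i. f1 i - of_real c * f2 i) = ip f' f1 - c * ip f' f2" for f' f1 f2 c
    by (simp add: ip_def right_diff_distrib sum_subtractf sum_distrib_left mult.left_commute)
  have ip_self: "ip f f = N f" for f
    unfolding ip_def N_def cmod_power2 by (simp add: power2_eq_square)
  define w where "w i = A (A f) i - of_real (s\<^sup>2) * f i" for i
  \<comment> \<open>In the direction \<open>w\<close> the linear coefficient of N (A (f + t w)) -
    s^2 N (f + t w) is 2 \<open>ip w w\<close>, by symmetry of A. This difference is nonnegative and
    vanishes at t = 0.\<close>
  have "ip w w = 0"
  proof (rule quadratic_nonneg_linear_zero)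
    show "0 \<le> N (A w) - s\<^sup>2 * N w" using min'[of w] by simp
    have "ip (A w) (A f) - s\<^sup>2 * ip w f = ip w w"
      unfolding symm using ip_diff[of w "A (A f)" "s\<^sup>2" f] by (simp add: w_def[abs_def])
    moreover have "N (A (\<lambda>i. f i + of_real t * w i)) = N (A f) + 2 * t * ip (A w) (A f) + t\<^sup>2 * N (A w)" for t
      using N_add[of "A f" t "A w"] by (simp add: A_add[abs_def])
    ultimately show "0 \<le> 2 * t * ip w w + t\<^sup>2 * (N (A w) - s\<^sup>2 * N w)" for t
      using min'[of "\<lambda>i. f i + of_real t * w i"] f s N_add[of f t w]
      by (simp add: S_def algebra_simps)
  qed
  then have w: "w i = 0" if "i \<in> P" for i
    using that fin by (simp add: ip_self N_def sum_nonneg_eq_0_iff)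
  have fnz: "\<exists>i\<in>P. f i \<noteq> 0"
  proof (rule ccontr)
    assume "\<not> ?thesis"
    then have "N f = 0" by (simp add: N_def)
    then show False using f by (simp add: S_def)
  qed
  define v where "v i = A f i - of_real s * f i" for i
  have eigen: "(\<Sum>j\<in>P. h i j * f' j) = of_real (E + c) * f' i" if "A f' i = of_real c * f' i" for f' c i
    using that by (simp add: A_def algebra_simps)
  show thesis
  proof (cases "\<forall>i\<in>P. v i = 0")
    case True
    then show thesis
      using \<open>s \<le> d\<close> s fnz by (intro that[of "E + s" f] eigen) (auto simp: v_def)
  next
    case False
    have "A v i = of_real (- s) * v i" if "i \<in> P" for i
    proof -
      have "A v i = A (A f) i + of_real (- s) * A f i"
        using A_add[of "A f" "- s" f i] by (simp add: v_def[abs_def])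
      then show ?thesis using w[OF that] by (simp add: w_def v_def algebra_simps power2_eq_square)
    qed
    then show thesis
      using \<open>s \<le> d\<close> s False by (intro that[of "E + (- s)" v] eigen) auto
  qed
qed

lemma fib_gt_self: "n < fib (n + 3)"
proof (induction n)
  case (Suc n)
  have "fib (n + 2) > 0" by (rule fib_neq_0_nat) simp
  moreover have "fib (Suc n + 3) = fib (n + 3) + fib (n + 2)" by (simp add: eval_nat_numeral)
  ultimately show ?case using Suc by linarith
qed (simp add: eval_nat_numeral)

text \<open>Because \<open>u\<close> vanishes next to the cut, the operator on the ring acts on it
  as on the line, and the ring has an eigenvalue within \<open>d\<close> of \<open>E\<close>. The
  periodic extension g of the eigenvector satisfies 2 g = x g at \<open>a\<close> and at
  \<open>a - 1\<close>. A trace x other than 2 would give two neighbouring zeros and hence g = 0.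
  That x is a value of the trace map requires the cut \<open>a\<close> to be free of a hit.\<close>

lemma ring_trace:
  fixes u :: "int \<Rightarrow> complex" and E d :: real
  assumes a: "\<not> hit \<omega> j a" and "j \<ge> 1" and "d \<ge> 0"
  defines "p \<equiv> int (fib (Suc j))"
  assumes supp: "\<And>n. n \<le> a \<or> n \<ge> a + p - 1 \<Longrightarrow> u n = 0"
    and u: "mass u {a..<a + p} > 0"
    and le: "(\<Sum>n\<in>{a..<a + p}. (cmod (fib_H V \<omega> u n - of_real E * u n))\<^sup>2)
      \<le> d\<^sup>2 * mass u {a..<a + p}"
  shows "\<exists>ev::real. \<bar>ev - E\<bar> \<le> d \<and> fib_trace V (of_real ev) (Suc j) = 2"
proof -
  let ?P = "{a..<a + p}" and ?q = "\<lambda>n. of_real (fib_potential V \<omega> n) :: complex"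
  define r where "r n = a + (n - a) mod p" for n
  have "fib (Suc j) > 0" by (rule fib_neq_0_nat) simp
  then have p: "p > 0" by (simp add: p_def)
  have r_in: "r n \<in> ?P" for n using p by (simp add: r_def)
  have r_id: "r n = n" if "n \<in> ?P" for n using that by (simp add: r_def)
  have r_eq: "r m = r n \<longleftrightarrow> (m - n) mod p = 0" for m n
    by (simp add: r_def mod_eq_dvd_iff mod_eq_0_iff_dvd)
  \<comment> \<open>The indicator terms are added instead of being distinguished by cases, since the
    two neighbours of a site coincide on a ring of length 2.\<close>
  define h :: "int \<Rightarrow> int \<Rightarrow> complex" where
    "h i k = (if k = r (i + 1) then 1 else 0) + (if k = r (i - 1) then 1 else 0) + (if k = i then ?q i else 0)" for i k
  have h_sum: "(\<Sum>k\<in>?P. h i k * g k) = g (r (i + 1)) + g (r (i - 1)) + ?q i * g i" if "i \<in> ?P" for i g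
    using that r_in by (simp add: h_def distrib_right sum.distrib if_distrib[of "\<lambda>x. x * _"] cong: if_cong)
  have "p > 1" using u supp p
  proof -
    have "p \<noteq> 1"
    proof
      assume "p = 1"
      then have "?P = {a}" by auto
      then show False using u supp[of a] by simp
    qed
    then show ?thesis using p by simp
  qed
  have herm: "h i k = cnj (h k i)" if "i \<in> ?P" "k \<in> ?P" for i k
  proof -
    have "k = r (i + 1) \<longleftrightarrow> i = r (k - 1)" "k = r (i - 1) \<longleftrightarrow> i = r (k + 1)"
      using r_eq[of k "i + 1"] r_eq[of i "k - 1"] r_eq[of k "i - 1"] r_eq[of i "k + 1"] r_id that
        mod_eq_0_iff_dvd dvd_minus_iff by (metis (no_types, opaque_lifting) add_diff_eq diff_add_eq diff_diff_eq2 minus_diff_eq)+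
    then show ?thesis by (auto simp: h_def)
  qed
  have Hu: "(\<Sum>k\<in>?P. h i k * u k) = fib_H V \<omega> u i" if "i \<in> ?P" for i
  proof -
    have "u (r (i + 1)) = u (i + 1)"
    proof (cases "i + 1 \<in> ?P")
      case False
      then have "i + 1 = a + p" using that by simp
      then have "r (i + 1) = a" by (simp add: r_def)
      then show ?thesis using supp[of a] supp[of "i + 1"] \<open>i + 1 = a + p\<close> by simp
    qed (simp add: r_id)
    moreover have "u (r (i - 1)) = u (i - 1)"
    proof (cases "i - 1 \<in> ?P")
      case False
      then have i: "i = a" using that by simp
      have "r (i - 1) = a + p - 1" using p by (simp add: r_def i zmod_minus1)
      then show ?thesis using supp[of "a + p - 1"] supp[of "i - 1"] i by simp
    qed (simp add: r_id)
    ultimately show ?thesis by (simp add: h_sum[OF that] fib_H_def)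
  qed
  obtain ev f where ev: "\<bar>ev - E\<bar> \<le> d" and fnz: "\<exists>i\<in>?P. f i \<noteq> 0"
    and f: "\<And>i. i \<in> ?P \<Longrightarrow> (\<Sum>k\<in>?P. h i k * f k) = of_real ev * f i"
    by (rule hermitian_eigenvalue_near[of ?P h u d E, OF _ herm u \<open>d \<ge> 0\<close>]) (use le Hu in auto)
  define g where "g n = f (r n)" for n
  define q' where "q' n = ?q (r n)" for n
  have r_r: "r (r n + 1) = r (n + 1)" "r (r n - 1) = r (n - 1)" for n
    by (simp_all add: r_def mod_simps algebra_simps)
  have sol: "g (n + 1) + g (n - 1) + q' n * g n = of_real ev * g n" for n
    using f[OF r_in[of n]] h_sum[OF r_in[of n], of f] by (simp add: g_def q'_def r_r)
  have per: "g (n + p) = g n" "q' (n + p) = q' n" for n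
  proof -
    have "n + p - a = (n - a) + p" by simp
    then have "r (n + p) = r n" by (simp only: r_def mod_add_self2)
    then show "g (n + p) = g n" "q' (n + p) = q' n" by (simp_all add: g_def q'_def)
  qed
  have tp: "tprod q' z a (fib (Suc j)) = tprod ?q z a (fib (Suc j))" for z
    using tprod_cong[of a "fib (Suc j)" q' 0 ?q z] by (simp add: q'_def r_id p_def)
  define x where "x = fib_trace V (of_real ev) (Suc j)"
  have x: "trace (tprod q' (of_real ev) a (fib (Suc j))) = x"
    using trace_tprod_fib[OF a \<open>j \<ge> 1\<close>] by (simp add: tp x_def)
  have two: "g a + g (a + 2 * p) = x * g (a + p)" "g (a - 1) + g (a - 1 + 2 * p) = x * g (a - 1 + p)"
    using two_periods[of a "fib (Suc j)" q' g "of_real ev", OF per(2)[unfolded p_def] sol]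
    unfolding p_def x .
  have per2: "g (n + 2 * p) = g n" for n
  proof -
    have "n + 2 * p = n + p + p" by simp
    then show ?thesis by (simp only: per(1))
  qed
  have "x = 2"
  proof (rule ccontr)
    assume "x \<noteq> 2"
    then have zero: "g a = 0" "g (a - 1) = 0"
      using two unfolding per2 per by (simp_all add: mult_2[symmetric] mult_cancel_right)
    have "g (a + int k) = 0 \<and> g (a + int k - 1) = 0" for k
    proof (induction k)
      case (Suc k)
      then have "g (a + int k + 1) = 0" using sol[of "a + int k"] by simp
      then show ?case using Suc by (simp add: add_ac)
    qed (use zero in simp)
    moreover obtain i where "i \<in> ?P" "f i \<noteq> 0" using fnz by blast
    ultimately show False
      using r_id[of i] by (metis (no_types, opaque_lifting) atLeastLessThan_iff g_def zle_iff_zadd)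
  qed
  then show ?thesis using ev by (auto simp: x_def)
qed

lemma fib_H_diff: "fib_H V \<omega> (\<lambda>n. f n - g n) n = fib_H V \<omega> f n - fib_H V \<omega> g n"
  by (simp add: fib_H_def algebra_simps)

text \<open>An approximate eigenvector is cut off to finite support and placed on a ring longer than
  the support. Any longer Fibonacci ring will do, so the index can be made as large as desired,
  which later bounds all traces below it.\<close>

lemma spectral_trace:
  fixes \<phi> :: "int \<Rightarrow> complex" and E d :: real
  assumes V: "V > 0" and \<phi>: "\<phi> \<in> ell2" and d: "d \<ge> 0"
    and less: "ell2_norm (\<lambda>n. fib_H V \<omega> \<phi> n - of_real E * \<phi> n) < d * ell2_norm \<phi>"
  shows "\<exists>ev::real. \<exists>j\<ge>K. \<bar>ev - E\<bar> \<le> d \<and> fib_trace V (of_real ev) (Suc j) = 2"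
proof -
  define A where "A f n = fib_H V \<omega> f n - of_real E * f n" for f n
  define M where "M = 2 + V + \<bar>E\<bar> + d"
  have M: "M > 0" using V d by (simp add: M_def)
  \<comment> \<open>The cut-off costs at most (2 + V + |E|) \<eta> in the residual and
    \<open>d * \<eta>\<close> in the norm of the vector, together \<open>M * \<eta>\<close>. This is
    half of the slack in the strict inequality.\<close>
  define \<eta> where "\<eta> = (d * ell2_norm \<phi> - ell2_norm (A \<phi>)) / (2 * M)"
  have \<eta>: "\<eta> > 0" using less M by (simp add: \<eta>_def A_def[abs_def])
  obtain W where tail: "(\<lambda>n. if \<bar>n\<bar> \<le> int W then 0 else \<phi> n) \<in> ell2"
    "ell2_norm (\<lambda>n. if \<bar>n\<bar> \<le> int W then 0 else \<phi> n) \<le> \<eta>"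
    using ell2_tail[OF \<phi> \<eta>] by blast
  define \<tau> where "\<tau> = (\<lambda>n. if \<bar>n\<bar> \<le> int W then 0 else \<phi> n)"
  define u where "u n = \<phi> n - \<tau> n" for n
  have u0: "u n = 0" if "\<bar>n\<bar> > int W" for n using that by (simp add: u_def \<tau>_def)
  have A_ell2: "A f \<in> ell2" "ell2_norm (A f) \<le> (2 + V + \<bar>E\<bar>) * ell2_norm f" if f: "f \<in> ell2" for f
  proof -
    have "A f = (\<lambda>n. fib_H V \<omega> f n + of_real (- E) * f n)" by (simp add: A_def[abs_def])
    then have "A f \<in> ell2" "ell2_norm (A f) \<le> ell2_norm (fib_H V \<omega> f) + ell2_norm (\<lambda>n. of_real (- E) * f n)"
      using ell2_add[OF fib_H_ell2(1)[OF V f] ell2_scale(1)[OF f, of "of_real (- E)"]] by simp_all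
    moreover have "ell2_norm (\<lambda>n. of_real (- E) * f n) \<le> \<bar>E\<bar> * ell2_norm f"
      using ell2_scale(2)[OF f, of "of_real (- E)"] by simp
    ultimately show "A f \<in> ell2" "ell2_norm (A f) \<le> (2 + V + \<bar>E\<bar>) * ell2_norm f"
      using fib_H_ell2(2)[OF V f, of \<omega>] by (simp_all add: distrib_right)
  qed
  have neg: "(\<lambda>n. - f n) \<in> ell2" "ell2_norm (\<lambda>n. - f n) \<le> ell2_norm f" if "f \<in> ell2" for f
    using ell2_scale[OF that, of "- 1"] by simp_all
  have \<tau>: "\<tau> \<in> ell2" "ell2_norm \<tau> \<le> \<eta>" using tail by (simp_all add: \<tau>_def)
  have u: "u \<in> ell2"
    using ell2_add(1)[OF \<phi> neg(1)[OF \<tau>(1)]] by (simp add: u_def[abs_def])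
  have "ell2_norm \<phi> \<le> ell2_norm u + ell2_norm \<tau>"
    using ell2_add(2)[OF u \<tau>(1)] by (simp add: u_def)
  then have nu: "ell2_norm u \<ge> ell2_norm \<phi> - \<eta>" using \<tau> by simp
  have "A u = (\<lambda>n. A \<phi> n + - A \<tau> n)"
    by (auto simp: A_def u_def[abs_def] fib_H_diff algebra_simps)
  then have "ell2_norm (A u) \<le> ell2_norm (A \<phi>) + ell2_norm (A \<tau>)"
    using ell2_add(2)[OF A_ell2(1)[OF \<phi>] neg(1)[OF A_ell2(1)[OF \<tau>(1)]]] neg(2)[OF A_ell2(1)[OF \<tau>(1)]]
    by simp
  also have "\<dots> \<le> ell2_norm (A \<phi>) + (2 + V + \<bar>E\<bar>) * \<eta>"
    using A_ell2(2)[OF \<tau>(1)] mult_left_mono[OF \<tau>(2), of "2 + V + \<bar>E\<bar>"] V by simp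
  also have "\<dots> < d * (ell2_norm \<phi> - \<eta>)"
  proof -
    have "M * \<eta> < d * ell2_norm \<phi> - ell2_norm (A \<phi>)"
      using M less by (simp add: \<eta>_def A_def[abs_def])
    then show ?thesis by (simp add: M_def algebra_simps)
  qed
  also have "\<dots> \<le> d * ell2_norm u" using nu d by (intro mult_left_mono)
  finally have Au: "ell2_norm (A u) < d * ell2_norm u" .
  then have "ell2_norm u > 0"
    using d by (metis ell2_norm_nonneg less_le mult_zero_right not_le order_trans)
  define j where "j = K + 2 * W + 6"
  \<comment> \<open>Adjacent sites are not both hits, so one of two sites to the left of the support
    can serve as the cut.\<close>
  obtain a where a: "\<not> hit \<omega> j a" "a = - int W - 2 \<or> a = - int W - 1"
  proof (cases "hit \<omega> j (- int W - 2)")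
    case True
    moreover have "- int W - 2 + 1 = - int W - 1" by simp
    ultimately have "\<not> hit \<omega> j (- int W - 1)"
      using not_hit_pair[of j \<omega> "- int W - 2"] j_def by (metis le_add2 le_trans one_le_numeral)
    then show thesis by (intro that[of "- int W - 1"]) auto
  qed (use that in blast)
  let ?p = "int (fib (Suc j))"
  have "2 * W + K + 4 < fib (Suc j)"
    using fib_gt_self[of "2 * W + K + 4"] by (simp add: j_def add_ac)
  then have p: "?p > 2 * int W + 4" by linarith
  let ?P = "{a..<a + ?p}"
  have supp: "u n = 0" if "n \<le> a \<or> n \<ge> a + ?p - 1" for n
    using that a(2) p by (intro u0) auto
  have norm_u: "mass u ?P = (ell2_norm u)\<^sup>2"
  proof -
    have "mass u ?P = (\<Sum>\<^sub>\<infinity>n\<in>?P. (cmod (u n))\<^sup>2)" by simp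
    also have "\<dots> = (\<Sum>\<^sub>\<infinity>n. (cmod (u n))\<^sup>2)"
      using supp by (intro infsum_cong_neutral) auto
    finally show ?thesis by (simp add: ell2_norm_square)
  qed
  have "mass (A u) ?P \<le> (ell2_norm (A u))\<^sup>2"
    by (intro sum_le_ell2_norm A_ell2 u) simp
  also have "\<dots> \<le> (d * ell2_norm u)\<^sup>2"
    using Au by (intro power_mono) auto
  finally have "mass (A u) ?P \<le> d\<^sup>2 * mass u ?P"
    by (simp add: norm_u power_mult_distrib)
  moreover have "mass u ?P > 0"
    using \<open>ell2_norm u > 0\<close> by (simp only: norm_u zero_less_power)
  moreover have "j \<ge> 1" by (simp add: j_def)
  ultimately have "\<exists>ev::real. \<bar>ev - E\<bar> \<le> d \<and> fib_trace V (of_real ev) (Suc j) = 2"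
    using supp d unfolding A_def by (intro ring_trace[OF a(1), of d u V E])
  moreover have "j \<ge> K" by (simp add: j_def)
  ultimately show ?thesis by blast
qed

section \<open>Plancherel's identity\<close>

lemma integrable_std_normal_density [simp]: "integrable lborel std_normal_density"
  using integrable_std_normal_moment[of 0] by simp

lemma integral_std_normal_density [simp]: "(\<integral>x. std_normal_density x \<partial>lborel) = 1"
  using integral_std_normal_moment_even[of 0] by simp

lemma std_normal_density_fourier:
  "(\<integral>x. of_real (std_normal_density x) * iexp (s * x) \<partial>lborel) = of_real (exp (- s\<^sup>2 / 2))"
proof -
  have "char std_normal_distribution s = (\<integral>x. std_normal_density x *\<^sub>R iexp (s * x) \<partial>lborel)"
    unfolding char_def by (subst integral_density) auto
  then show ?thesis
    by (simp add: char_std_normal_distribution scaleR_conv_of_real)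
qed

lemma Fubini_tensor:
  fixes f g :: "real \<Rightarrow> complex" and h :: "real \<Rightarrow> real \<Rightarrow> complex"
  assumes f: "integrable lborel f" and g: "integrable lborel g"
    and h [measurable]: "(\<lambda>(x, y). h x y) \<in> borel_measurable (lborel \<Otimes>\<^sub>M lborel)"
    and bound: "\<And>x y. cmod (h x y) \<le> K"
  shows "(\<integral>x. \<integral>y. f x * g y * h x y \<partial>lborel \<partial>lborel) = (\<integral>y. \<integral>x. f x * g y * h x y \<partial>lborel \<partial>lborel)"
proof -
  have [measurable]: "f \<in> borel_measurable lborel" "g \<in> borel_measurable lborel"
    using f g by auto
  have "integrable (lborel \<Otimes>\<^sub>M lborel) (\<lambda>(x, y). f x * g y)"
  proof (rule lborel_pair.Fubini_integrable)
    show "integrable lborel (\<lambda>x. \<integral>y. norm ((\<lambda>(x, y). f x * g y) (x, y)) \<partial>lborel)"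
      using f by (simp add: norm_mult)
    show "AE x in lborel. integrable lborel (\<lambda>y. (\<lambda>(x, y). f x * g y) (x, y))"
      using g by simp
  qed simp
  then have "integrable (lborel \<Otimes>\<^sub>M lborel) (\<lambda>(x, y). K *\<^sub>R (f x * g y))"
    by (simp add: case_prod_unfold)
  then have "integrable (lborel \<Otimes>\<^sub>M lborel) (\<lambda>(x, y). f x * g y * h x y)"
  proof (rule Bochner_Integration.integrable_bound)
    have "cmod (f x * g y * h x y) \<le> cmod (K *\<^sub>R (f x * g y))" for x y
    proof -
      have "cmod (f x * g y * h x y) \<le> cmod (f x * g y) * K"
        unfolding norm_mult[of "f x * g y"] using bound by (intro mult_left_mono) auto
      also have "\<dots> \<le> cmod (f x * g y) * \<bar>K\<bar>" by (intro mult_left_mono) auto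
      finally show ?thesis by (simp add: mult.commute)
    qed
    then show "AE x in lborel \<Otimes>\<^sub>M lborel. norm (case x of (x, y) \<Rightarrow> f x * g y * h x y)
        \<le> norm (case x of (x, y) \<Rightarrow> K *\<^sub>R (f x * g y))"
      by (auto simp: case_prod_unfold)
  qed measurable
  from lborel_pair.Fubini_integral[OF this] show ?thesis by simp
qed

text \<open>A Gaussian weight of width l makes Fubini applicable and turns the weighted energy into
  an integral of g against its convolution with a Gaussian of width 1 / l. For l to infinity the
  energy side converges monotonically and the time side by domination. Continuity away from 0
  suffices for convergence almost everywhere; the damped evolution jumps at 0.\<close>

lemma plancherel_integrable:
  fixes g :: "real \<Rightarrow> complex"
  assumes g: "integrable lborel g" and K: "\<And>t. cmod (g t) \<le> K"
    and cont: "\<And>t. t \<noteq> 0 \<Longrightarrow> isCont g t"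
  shows "(\<integral>\<^sup>+E. ennreal ((cmod (\<integral>t. g t * iexp (E * t) \<partial>lborel))\<^sup>2) \<partial>lborel)
    = ennreal (2 * pi) * (\<integral>\<^sup>+t. ennreal ((cmod (g t))\<^sup>2) \<partial>lborel)"
proof -
  have K0: "0 \<le> K" using norm_ge_zero[of "g 0"] K[of 0] by linarith
  let ?D = "\<lambda>x. complex_of_real (std_normal_density x)"
  define G where "G E = (\<integral>t. g t * iexp (E * t) \<partial>lborel)" for E
  define N where "N = (\<integral>t. cmod (g t) \<partial>lborel)"
  have [measurable]: "g \<in> borel_measurable borel" using g by auto
  have [measurable]: "G \<in> borel_measurable borel"
    unfolding G_def by measurable
  have [measurable]: "cnj \<in> borel_measurable borel"
    by (intro borel_measurable_continuous_onI continuous_intros)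
  have int_g: "integrable lborel (\<lambda>t. g t * iexp (E * t))" for E
    by (rule Bochner_Integration.integrable_bound[OF g]) (auto simp: norm_mult)
  have G_bound: "cmod (G E) \<le> N" for E
    unfolding G_def N_def by (rule order_trans[OF integral_norm_bound]) (simp add: norm_mult)
  have cnj_G: "cnj (G E) = (\<integral>s. cnj (g s) * iexp (- (E * s)) \<partial>lborel)" for E
  proof -
    have "cnj (G E) = (\<integral>s. cnj (g s * iexp (E * s)) \<partial>lborel)"
      unfolding G_def by (rule Bochner_Integration.integral_cnj[symmetric])
    also have "\<dots> = (\<integral>s. cnj (g s) * iexp (- (E * s)) \<partial>lborel)"
      by (intro Bochner_Integration.integral_cong refl) (simp add: exp_cnj)
    finally show ?thesis .
  qed
  have int_cnj: "integrable lborel (\<lambda>s. cnj (g s))" using g by simp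
  have D: "integrable lborel (\<lambda>x. complex_of_real (std_normal_density x))"
    by simp
  have inner: "(\<integral>x. ?D x * (iexp (l * x * t) * cnj (G (l * x))) \<partial>lborel)
      = (\<integral>s. cnj (g s) * of_real (exp (- (l * (t - s))\<^sup>2 / 2)) \<partial>lborel)" for l t
  proof -
    have "(\<integral>x. ?D x * (iexp (l * x * t) * cnj (G (l * x))) \<partial>lborel)
        = (\<integral>x. \<integral>s. ?D x * cnj (g s) * iexp (l * (t - s) * x) \<partial>lborel \<partial>lborel)"
    proof (rule Bochner_Integration.integral_cong[OF refl])
      fix x
      have "?D x * (iexp (l * x * t) * cnj (G (l * x)))
          = (\<integral>s. (?D x * iexp (l * x * t)) * (cnj (g s) * iexp (- (l * x * s))) \<partial>lborel)"
        unfolding cnj_G by (subst integral_mult_right_zero) (simp add: mult.assoc)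
      also have "\<dots> = (\<integral>s. ?D x * cnj (g s) * iexp (l * (t - s) * x) \<partial>lborel)"
        by (rule Bochner_Integration.integral_cong[OF refl]) (simp add: exp_add[symmetric] exp_diff exp_minus field_simps)
      finally show "?D x * (iexp (l * x * t) * cnj (G (l * x)))
          = (\<integral>s. ?D x * cnj (g s) * iexp (l * (t - s) * x) \<partial>lborel)" .
    qed
    also have "\<dots> = (\<integral>s. \<integral>x. ?D x * cnj (g s) * iexp (l * (t - s) * x) \<partial>lborel \<partial>lborel)"
      by (rule Fubini_tensor[OF D int_cnj, of _ 1]) auto
    also have "\<dots> = (\<integral>s. cnj (g s) * of_real (exp (- (l * (t - s))\<^sup>2 / 2)) \<partial>lborel)"
    proof (rule Bochner_Integration.integral_cong[OF refl])
      fix s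
      have "(\<integral>x. ?D x * cnj (g s) * iexp (l * (t - s) * x) \<partial>lborel)
          = (\<integral>x. cnj (g s) * (?D x * iexp (l * (t - s) * x)) \<partial>lborel)"
        by (simp only: mult.assoc mult.left_commute)
      also have "\<dots> = cnj (g s) * (\<integral>x. ?D x * iexp (l * (t - s) * x) \<partial>lborel)"
        by (rule integral_mult_right_zero)
      finally show "(\<integral>x. ?D x * cnj (g s) * iexp (l * (t - s) * x) \<partial>lborel)
          = cnj (g s) * of_real (exp (- (l * (t - s))\<^sup>2 / 2))"
        by (simp only: std_normal_density_fourier)
    qed
    finally show ?thesis .
  qed
  \<comment> \<open>After the substitution s = t - w / l the Gaussian is fixed and \<open>l\<close>
    occurs only in the argument of \<open>g\<close>, as dominated convergence needs.\<close>
  define R where "R l t = (\<integral>w. cnj (g (t - w / l)) * of_real (exp (- w\<^sup>2 / 2)) \<partial>lborel)" for l t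
  have gauss: "integrable lborel (\<lambda>w::real. exp (- w\<^sup>2 / 2))" "(\<integral>w. exp (- w\<^sup>2 / 2 :: real) \<partial>lborel) = sqrt (2 * pi)"
  proof -
    have eq: "exp (- w\<^sup>2 / 2) = sqrt (2 * pi) * std_normal_density w" for w :: real
      by (simp add: std_normal_density_def)
    show "integrable lborel (\<lambda>w::real. exp (- w\<^sup>2 / 2))" "(\<integral>w. exp (- w\<^sup>2 / 2 :: real) \<partial>lborel) = sqrt (2 * pi)"
      unfolding eq by simp_all
  qed
  have subst: "of_real l * (\<integral>s. cnj (g s) * of_real (exp (- (l * (t - s))\<^sup>2 / 2)) \<partial>lborel) = R l t"
    if "l > 0" for l t
    using that lborel_integral_real_affine[of "- 1 / l" "\<lambda>s. cnj (g s) * of_real (exp (- (l * (t - s))\<^sup>2 / 2))" t]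
    by (simp add: R_def scaleR_conv_of_real)
  have main: "of_real l * (\<integral>x. of_real (std_normal_density x * (cmod (G (l * x)))\<^sup>2) \<partial>lborel)
      = (\<integral>t. g t * R l t \<partial>lborel)" if l: "l > 0" for l
  proof -
    have "(\<integral>x. of_real (std_normal_density x * (cmod (G (l * x)))\<^sup>2) \<partial>lborel)
        = (\<integral>x. \<integral>t. ?D x * g t * (iexp (l * x * t) * cnj (G (l * x))) \<partial>lborel \<partial>lborel)"
    proof (rule Bochner_Integration.integral_cong[OF refl])
      fix x
      have "of_real (std_normal_density x * (cmod (G (l * x)))\<^sup>2)
          = (?D x * cnj (G (l * x))) * G (l * x)"
        by (simp only: of_real_mult complex_norm_square mult_ac)
      also have "\<dots> = (\<integral>t. (?D x * cnj (G (l * x))) * (g t * iexp (l * x * t)) \<partial>lborel)"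
        unfolding G_def[of "l * x"] by (simp add: integral_mult_right_zero)
      finally show "of_real (std_normal_density x * (cmod (G (l * x)))\<^sup>2)
          = (\<integral>t. ?D x * g t * (iexp (l * x * t) * cnj (G (l * x))) \<partial>lborel)"
        by (simp add: mult_ac)
    qed
    also have "\<dots> = (\<integral>t. \<integral>x. ?D x * g t * (iexp (l * x * t) * cnj (G (l * x))) \<partial>lborel \<partial>lborel)"
      by (rule Fubini_tensor[OF D g, of _ N], measurable) (simp add: norm_mult G_bound)
    also have "\<dots> = (\<integral>t. g t * (\<integral>s. cnj (g s) * of_real (exp (- (l * (t - s))\<^sup>2 / 2)) \<partial>lborel) \<partial>lborel)"
    proof (rule Bochner_Integration.integral_cong[OF refl])
      fix t
      have "(\<integral>x. ?D x * g t * (iexp (l * x * t) * cnj (G (l * x))) \<partial>lborel)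
          = (\<integral>x. g t * (?D x * (iexp (l * x * t) * cnj (G (l * x)))) \<partial>lborel)"
        by (simp only: mult.assoc mult.left_commute)
      also have "\<dots> = g t * (\<integral>x. ?D x * (iexp (l * x * t) * cnj (G (l * x))) \<partial>lborel)"
        by (rule integral_mult_right_zero)
      finally show "(\<integral>x. ?D x * g t * (iexp (l * x * t) * cnj (G (l * x))) \<partial>lborel)
          = g t * (\<integral>s. cnj (g s) * of_real (exp (- (l * (t - s))\<^sup>2 / 2)) \<partial>lborel)"
        by (simp only: inner)
    qed
    finally have "of_real l * (\<integral>x. of_real (std_normal_density x * (cmod (G (l * x)))\<^sup>2) \<partial>lborel)
        = (\<integral>t. of_real l * (g t * (\<integral>s. cnj (g s) * of_real (exp (- (l * (t - s))\<^sup>2 / 2)) \<partial>lborel)) \<partial>lborel)"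
      by (simp only: integral_mult_right_zero)
    also have "\<dots> = (\<integral>t. g t * R l t \<partial>lborel)"
      by (simp only: mult.left_commute[of "of_real l"] subst[OF l])
    finally show ?thesis .
  qed
  have left: "(\<integral>\<^sup>+E. ennreal ((cmod (G E))\<^sup>2 * exp (- (E / l)\<^sup>2 / 2)) \<partial>lborel)
      = ennreal (sqrt (2 * pi) * (l * (\<integral>x. std_normal_density x * (cmod (G (l * x)))\<^sup>2 \<partial>lborel)))"
    if l: "l > 0" for l
  proof -
    have int: "integrable lborel (\<lambda>x. std_normal_density x * (cmod (G (l * x)))\<^sup>2)"
    proof (rule Bochner_Integration.integrable_bound[of _ "\<lambda>x. std_normal_density x * N\<^sup>2"])
      show "AE x in lborel. norm (std_normal_density x * (cmod (G (l * x)))\<^sup>2) \<le> norm (std_normal_density x * N\<^sup>2)"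
        using G_bound by (auto simp: abs_mult intro!: mult_left_mono power_mono)
    qed auto
    have "(\<integral>\<^sup>+E. ennreal ((cmod (G E))\<^sup>2 * exp (- (E / l)\<^sup>2 / 2)) \<partial>lborel)
        = ennreal l * (\<integral>\<^sup>+x. ennreal ((cmod (G (l * x)))\<^sup>2 * exp (- x\<^sup>2 / 2)) \<partial>lborel)"
      using nn_integral_real_affine[of "\<lambda>E. ennreal ((cmod (G E))\<^sup>2 * exp (- (E / l)\<^sup>2 / 2))" l 0] l by simp
    also have "(\<integral>\<^sup>+x. ennreal ((cmod (G (l * x)))\<^sup>2 * exp (- x\<^sup>2 / 2)) \<partial>lborel)
        = (\<integral>\<^sup>+x. ennreal (sqrt (2 * pi) * (std_normal_density x * (cmod (G (l * x)))\<^sup>2)) \<partial>lborel)"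
      by (simp add: std_normal_density_def mult_ac)
    also have "\<dots> = ennreal (\<integral>x. sqrt (2 * pi) * (std_normal_density x * (cmod (G (l * x)))\<^sup>2) \<partial>lborel)"
      using int by (intro nn_integral_eq_integral) auto
    also have "(\<integral>x. sqrt (2 * pi) * (std_normal_density x * (cmod (G (l * x)))\<^sup>2) \<partial>lborel)
        = sqrt (2 * pi) * (\<integral>x. std_normal_density x * (cmod (G (l * x)))\<^sup>2 \<partial>lborel)"
      by (rule integral_mult_right_zero)
    also have "ennreal l * ennreal (sqrt (2 * pi) * (\<integral>x. std_normal_density x * (cmod (G (l * x)))\<^sup>2 \<partial>lborel))
        = ennreal (sqrt (2 * pi) * (l * (\<integral>x. std_normal_density x * (cmod (G (l * x)))\<^sup>2 \<partial>lborel)))"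
      using l by (subst ennreal_mult[symmetric]) (auto simp: integral_nonneg mult.left_commute)
    finally show ?thesis .
  qed
  have R_lim: "(\<lambda>k. R (real (Suc k)) t) \<longlonglongrightarrow> cnj (g t) * of_real (sqrt (2 * pi))" if "t \<noteq> 0" for t
  proof -
    have "(\<lambda>k. R (real (Suc k)) t) \<longlonglongrightarrow> (\<integral>w. cnj (g t) * of_real (exp (- w\<^sup>2 / 2)) \<partial>lborel)"
      unfolding R_def
    proof (rule integral_dominated_convergence[where w = "\<lambda>w. K * exp (- w\<^sup>2 / 2)"])
      show "AE w in lborel. (\<lambda>k. cnj (g (t - w / real (Suc k))) * of_real (exp (- w\<^sup>2 / 2)))
          \<longlonglongrightarrow> cnj (g t) * of_real (exp (- w\<^sup>2 / 2))"
      proof (rule AE_I2)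
        fix w :: real
        have "(\<lambda>k. w / real (Suc k)) \<longlonglongrightarrow> 0"
          using lim_const_over_n[of w] LIMSEQ_Suc by fastforce
        then have "(\<lambda>k. t - w / real (Suc k)) \<longlonglongrightarrow> t - 0"
          by (intro tendsto_intros)
        then have "(\<lambda>k. g (t - w / real (Suc k))) \<longlonglongrightarrow> g t"
          using isCont_tendsto_compose[OF cont[OF that]] by simp
        then show "(\<lambda>k. cnj (g (t - w / real (Suc k))) * of_real (exp (- w\<^sup>2 / 2)))
            \<longlonglongrightarrow> cnj (g t) * of_real (exp (- w\<^sup>2 / 2))"
          by (intro tendsto_intros)
      qed
      show "AE w in lborel. norm (cnj (g (t - w / real (Suc k))) * of_real (exp (- w\<^sup>2 / 2))) \<le> K * exp (- w\<^sup>2 / 2)" for k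
        using K by (intro AE_I2) (simp add: norm_mult)
      show "integrable lborel (\<lambda>w. K * exp (- w\<^sup>2 / 2))"
        using gauss(1) by (rule integrable_mult_right)
    qed measurable
    then show ?thesis by (simp add: gauss(2)[simplified])
  qed
  have R_bound: "cmod (R l t) \<le> K * sqrt (2 * pi)" for l t
  proof -
    have "cmod (R l t) \<le> (\<integral>w. cmod (cnj (g (t - w / l)) * of_real (exp (- w\<^sup>2 / 2))) \<partial>lborel)"
      unfolding R_def by (rule integral_norm_bound)
    also have "\<dots> \<le> (\<integral>w. K * exp (- w\<^sup>2 / 2) \<partial>lborel)"
      using gauss K K0 by (intro integral_mono_AE' AE_I2) (auto simp: norm_mult intro!: mult_right_mono mult_nonneg_nonneg)
    finally show ?thesis by (simp add: gauss(2)[simplified])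
  qed
  have [measurable]: "(\<lambda>t. R l t) \<in> borel_measurable borel" for l
    unfolding R_def by measurable
  have int_g2: "integrable lborel (\<lambda>t. (cmod (g t))\<^sup>2)"
  proof (rule Bochner_Integration.integrable_bound)
    show "integrable lborel (\<lambda>t. K * cmod (g t))" using g by simp
    show "AE t in lborel. norm ((cmod (g t))\<^sup>2) \<le> norm (K * cmod (g t))"
      using K by (intro AE_I2) (auto simp: power2_eq_square abs_mult intro!: mult_right_mono order_trans[OF K])
  qed auto
  have right: "(\<lambda>k. \<integral>t. g t * R (real (Suc k)) t \<partial>lborel) \<longlonglongrightarrow> (\<integral>t. g t * (cnj (g t) * of_real (sqrt (2 * pi))) \<partial>lborel)"
  proof (rule integral_dominated_convergence[where w = "\<lambda>t. cmod (g t) * (K * sqrt (2 * pi))"])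
    have "AE t in lborel. t \<noteq> (0::real)" by (rule AE_lborel_singleton)
    then show "AE t in lborel. (\<lambda>k. g t * R (real (Suc k)) t) \<longlonglongrightarrow> g t * (cnj (g t) * of_real (sqrt (2 * pi)))"
      by eventually_elim (intro tendsto_intros R_lim)
    show "AE t in lborel. norm (g t * R (real (Suc k)) t) \<le> cmod (g t) * (K * sqrt (2 * pi))" for k
      unfolding norm_mult by (intro AE_I2 mult_left_mono R_bound) auto
  qed (use g in auto)
  have right_val: "(\<integral>t. g t * (cnj (g t) * of_real (sqrt (2 * pi))) \<partial>lborel)
      = of_real (sqrt (2 * pi) * (\<integral>t. (cmod (g t))\<^sup>2 \<partial>lborel))"
  proof -
    have "g t * (cnj (g t) * of_real (sqrt (2 * pi))) = of_real (sqrt (2 * pi) * (cmod (g t))\<^sup>2)" for t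
      by (simp only: of_real_mult complex_norm_square mult_ac)
    then have "(\<integral>t. g t * (cnj (g t) * of_real (sqrt (2 * pi))) \<partial>lborel)
        = (\<integral>t. complex_of_real (sqrt (2 * pi) * (cmod (g t))\<^sup>2) \<partial>lborel)"
      by (simp only:)
    also have "\<dots> = of_real (\<integral>t. sqrt (2 * pi) * (cmod (g t))\<^sup>2 \<partial>lborel)"
      by (rule integral_complex_of_real)
    finally show ?thesis by (simp only: integral_mult_right_zero)
  qed
  let ?L = "\<lambda>k. \<integral>\<^sup>+E. ennreal ((cmod (G E))\<^sup>2 * exp (- (E / real (Suc k))\<^sup>2 / 2)) \<partial>lborel"
  have "(\<lambda>k. Re (\<integral>t. g t * R (real (Suc k)) t \<partial>lborel)) \<longlonglongrightarrow> sqrt (2 * pi) * (\<integral>t. (cmod (g t))\<^sup>2 \<partial>lborel)"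
    using tendsto_Re[OF right] unfolding right_val by simp
  moreover have "Re (\<integral>t. g t * R (real (Suc k)) t \<partial>lborel)
      = real (Suc k) * (\<integral>x. std_normal_density x * (cmod (G (real (Suc k) * x)))\<^sup>2 \<partial>lborel)" for k
    using main[of "real (Suc k)", symmetric] by (simp del: of_nat_Suc of_real_mult of_real_power add: of_real_mult[symmetric])
  ultimately have "(\<lambda>k. sqrt (2 * pi) * (real (Suc k) * (\<integral>x. std_normal_density x * (cmod (G (real (Suc k) * x)))\<^sup>2 \<partial>lborel)))
      \<longlonglongrightarrow> sqrt (2 * pi) * (sqrt (2 * pi) * (\<integral>t. (cmod (g t))\<^sup>2 \<partial>lborel))"
    by (intro tendsto_mult_left) (simp only:)
  then have "?L \<longlonglongrightarrow> ennreal (sqrt (2 * pi) * (sqrt (2 * pi) * (\<integral>t. (cmod (g t))\<^sup>2 \<partial>lborel)))"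
    unfolding left[OF of_nat_0_less_iff[THEN iffD2, OF zero_less_Suc]] by (rule tendsto_ennrealI)
  also have "sqrt (2 * pi) * (sqrt (2 * pi) * (\<integral>t. (cmod (g t))\<^sup>2 \<partial>lborel)) = 2 * pi * (\<integral>t. (cmod (g t))\<^sup>2 \<partial>lborel)"
    by (simp flip: mult.assoc)
  also have "ennreal \<dots> = ennreal (2 * pi) * (\<integral>\<^sup>+t. ennreal ((cmod (g t))\<^sup>2) \<partial>lborel)"
    using nn_integral_eq_integral[OF int_g2] by (simp add: ennreal_mult integral_nonneg)
  finally have lim1: "?L \<longlonglongrightarrow> ennreal (2 * pi) * (\<integral>\<^sup>+t. ennreal ((cmod (g t))\<^sup>2) \<partial>lborel)" .
  have lim2: "?L \<longlonglongrightarrow> (\<integral>\<^sup>+E. ennreal ((cmod (G E))\<^sup>2) \<partial>lborel)"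
  proof (rule nn_integral_LIMSEQ)
    have "(E / real (Suc k'))\<^sup>2 \<le> (E / real (Suc k))\<^sup>2" if "k \<le> k'" for E :: real and k k'
      using that unfolding power_divide by (intro divide_left_mono power_mono) (auto intro!: mult_pos_pos)
    then show "incseq (\<lambda>k E. ennreal ((cmod (G E))\<^sup>2 * exp (- (E / real (Suc k))\<^sup>2 / 2)))"
      by (auto simp: incseq_def le_fun_def intro!: ennreal_leI mult_left_mono)
    fix E :: real
    have "(\<lambda>k. E / real (Suc k)) \<longlonglongrightarrow> 0"
      using lim_const_over_n[of E] LIMSEQ_Suc by fastforce
    then have "(\<lambda>k. (cmod (G E))\<^sup>2 * exp (- (E / real (Suc k))\<^sup>2 / 2)) \<longlonglongrightarrow> (cmod (G E))\<^sup>2 * exp (- 0\<^sup>2 / 2)"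
      by (intro tendsto_intros) auto
    then show "(\<lambda>k. ennreal ((cmod (G E))\<^sup>2 * exp (- (E / real (Suc k))\<^sup>2 / 2))) \<longlonglongrightarrow> ennreal ((cmod (G E))\<^sup>2)"
      by (intro tendsto_ennrealI) simp
  qed measurable
  show ?thesis
    using LIMSEQ_unique[OF lim2 lim1] by (simp add: G_def)
qed

section \<open>Time evolution and its Laplace transform\<close>

text \<open>Each coordinate is an everywhere convergent power series in \<open>t\<close>, so the
  Schroedinger equation follows by termwise differentiation.\<close>

lemma evolution_power_series:
  fixes V \<omega> t :: real and \<psi> :: "int \<Rightarrow> complex" and z :: complex
  assumes V: "V > 0" and \<psi>: "\<psi> \<in> ell2"
  defines "c \<equiv> \<lambda>n k. (- \<i>) ^ k / fact k * (fib_H V \<omega> ^^ k) \<psi> n"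
  shows "summable (\<lambda>k. c n k * z ^ k)"
    and "evolution V \<omega> t \<psi> n = (\<Sum>k. c n k * of_real t ^ k)"
proof -
  have "summable (\<lambda>k. ((2 + V) * cmod z) ^ k / fact k)"
    using summable_exp[of "(2 + V) * cmod z"] by (simp add: field_simps)
  then have sm: "summable (\<lambda>k. ((2 + V) * cmod z) ^ k / fact k * ell2_norm \<psi>)"
    by (rule summable_mult2)
  show "summable (\<lambda>k. c n k * z ^ k)"
  proof (rule summable_comparison_test'[OF sm, of 0])
    fix k :: nat
    have "cmod ((fib_H V \<omega> ^^ k) \<psi> n) \<le> (2 + V) ^ k * ell2_norm \<psi>"
      using fib_H_power_ell2[OF V \<psi>, where \<omega> = \<omega> and k = k] cmod_le_ell2_norm order_trans by blast
    then have "cmod z ^ k / fact k * cmod ((fib_H V \<omega> ^^ k) \<psi> n)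
        \<le> cmod z ^ k / fact k * ((2 + V) ^ k * ell2_norm \<psi>)"
      by (intro mult_left_mono) auto
    then show "norm (c n k * z ^ k) \<le> ((2 + V) * cmod z) ^ k / fact k * ell2_norm \<psi>"
      by (simp add: c_def norm_mult norm_divide norm_power power_mult_distrib mult_ac)
  qed
  show "evolution V \<omega> t \<psi> n = (\<Sum>k. c n k * of_real t ^ k)"
    unfolding evolution_def c_def power_mult_distrib by (simp add: mult_ac)
qed

lemma evolution_deriv:
  assumes V: "V > 0" and \<psi>: "\<psi> \<in> ell2"
  shows "((\<lambda>t. evolution V \<omega> t \<psi> n) has_vector_derivative
    - \<i> * fib_H V \<omega> (evolution V \<omega> t \<psi>) n) (at t)"
proof -
  define c where "c n k = (- \<i>) ^ k / fact k * (fib_H V \<omega> ^^ k) \<psi> n" for n k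
  note ps = evolution_power_series[OF V \<psi>, where \<omega> = \<omega>, folded c_def]
  let ?x = "of_real t :: complex" and ?q = "of_real (fib_potential V \<omega> n) :: complex"
  have "((\<lambda>t. evolution V \<omega> t \<psi> n) has_vector_derivative (\<Sum>k. diffs (c n) k * ?x ^ k)) (at t)"
    unfolding ps(2)
    by (rule has_vector_derivative_real_field[OF termdiffs_strong_converges_everywhere])
       (rule ps(1))
  moreover have "(\<Sum>k. diffs (c n) k * ?x ^ k) = - \<i> * fib_H V \<omega> (evolution V \<omega> t \<psi>) n"
  proof -
    have "diffs (c n) k * ?x ^ k
        = - \<i> * (c (n + 1) k * ?x ^ k + c (n - 1) k * ?x ^ k + ?q * (c n k * ?x ^ k))" for k
    proof -
      have "diffs (c n) k = (- \<i>) ^ Suc k / fact k * fib_H V \<omega> ((fib_H V \<omega> ^^ k) \<psi>) n"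
        by (simp add: diffs_def c_def del: of_nat_Suc)
      then have "diffs (c n) k * ?x ^ k = (- \<i>) ^ Suc k / fact k * fib_H V \<omega> ((fib_H V \<omega> ^^ k) \<psi>) n * ?x ^ k"
        by (rule arg_cong)
      also have "\<dots> = - \<i> * (c (n + 1) k * ?x ^ k + c (n - 1) k * ?x ^ k + ?q * (c n k * ?x ^ k))"
        by (simp add: fib_H_def c_def algebra_simps add_divide_distrib)
      finally show ?thesis .
    qed
    moreover have "(\<lambda>k. - \<i> * (c (n + 1) k * ?x ^ k + c (n - 1) k * ?x ^ k + ?q * (c n k * ?x ^ k)))
        sums (- \<i> * fib_H V \<omega> (evolution V \<omega> t \<psi>) n)"
      unfolding fib_H_def ps(2) by (intro sums_mult sums_add summable_sums ps(1))
    ultimately show ?thesis by (simp add: sums_iff)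
  qed
  ultimately show ?thesis by simp
qed

lemma evolution_0: "evolution V \<omega> 0 \<psi> n = \<psi> n"
proof -
  have "(\<lambda>k. (- \<i> * of_real 0) ^ k / fact k * (fib_H V \<omega> ^^ k) \<psi> n) = (\<lambda>k. if k = 0 then \<psi> n else 0)"
    by (auto simp: fun_eq_iff)
  then show ?thesis unfolding evolution_def using sums_single[of 0 "\<lambda>_. \<psi> n"] by (simp add: sums_iff)
qed

lemma evolution_continuous [continuous_intros]:
  assumes "V > 0" "\<psi> \<in> ell2"
  shows "continuous_on S (\<lambda>t. evolution V \<omega> t \<psi> n)"
  using evolution_deriv[OF assms] by (intro continuous_at_imp_continuous_on ballI has_vector_derivative_continuous)

text \<open>An a priori bound, uniform on bounded time intervals. The proof of norm conservation
  needs it to control the error terms of the cut-off.\<close>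

lemma ell2_norm_evolution_crude:
  assumes V: "V > 0" and \<psi>: "\<psi> \<in> ell2"
  shows "ell2_norm (evolution V \<omega> t \<psi>) \<le> exp (\<bar>t\<bar> * (2 + V)) * ell2_norm \<psi>"
proof -
  define s where "s N n = (\<Sum>k<N. (- \<i> * of_real t) ^ k / fact k * (fib_H V \<omega> ^^ k) \<psi> n)" for N n
  let ?a = "\<lambda>k. (\<bar>t\<bar> * (2 + V)) ^ k / fact k"
  have s: "s N \<in> ell2 \<and> ell2_norm (s N) \<le> (\<Sum>k<N. ?a k) * ell2_norm \<psi>" for N
  proof (induction N)
    case 0
    show ?case using ell2_boundI[of "s 0" 0] by (simp add: s_def[abs_def])
  next
    case (Suc N)
    let ?u = "\<lambda>n. (- \<i> * of_real t) ^ N / fact N * (fib_H V \<omega> ^^ N) \<psi> n"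
    have H: "(fib_H V \<omega> ^^ N) \<psi> \<in> ell2" "ell2_norm ((fib_H V \<omega> ^^ N) \<psi>) \<le> (2 + V) ^ N * ell2_norm \<psi>"
      using fib_H_power_ell2[OF V \<psi>] by blast+
    have "ell2_norm ?u \<le> cmod ((- \<i> * of_real t) ^ N / fact N) * ell2_norm ((fib_H V \<omega> ^^ N) \<psi>)"
      by (rule ell2_scale(2)[OF H(1)])
    also have "\<dots> \<le> \<bar>t\<bar> ^ N / fact N * ((2 + V) ^ N * ell2_norm \<psi>)"
      using H(2) by (auto simp: norm_divide norm_power norm_mult intro!: mult_left_mono divide_right_mono)
    finally have n1: "ell2_norm ?u \<le> ?a N * ell2_norm \<psi>"
      by (simp add: power_mult_distrib)
    have Suc_eq: "s (Suc N) = (\<lambda>n. s N n + ?u n)" by (simp add: s_def fun_eq_iff)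
    have u: "?u \<in> ell2" by (rule ell2_scale(1)[OF H(1)])
    have n2: "ell2_norm (\<lambda>n. s N n + ?u n) \<le> ell2_norm (s N) + ell2_norm ?u"
      by (rule ell2_add(2)[OF _ u]) (use Suc in blast)
    have "ell2_norm (s (Suc N)) \<le> (\<Sum>k<N. ?a k) * ell2_norm \<psi> + ?a N * ell2_norm \<psi>"
      unfolding Suc_eq using n1 n2 conjunct2[OF Suc] by linarith
    moreover have "s (Suc N) \<in> ell2"
      unfolding Suc_eq by (rule ell2_add(1)[OF _ u]) (use Suc in blast)
    ultimately show ?case by (simp add: distrib_right)
  qed
  have sums: "?a sums exp (\<bar>t\<bar> * (2 + V))"
    using exp_converges[of "\<bar>t\<bar> * (2 + V)"] by (simp add: divide_inverse mult.commute)
  have "(\<Sum>k<N. ?a k) \<le> exp (\<bar>t\<bar> * (2 + V))" for N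
    using sums V by (simp add: sums_iff) (metis (no_types, lifting) V abs_ge_zero add_nonneg_nonneg
        divide_nonneg_nonneg fact_ge_zero less_eq_real_def mult_nonneg_nonneg sum_le_suminf
        finite_lessThan zero_le_numeral zero_le_power)
  then have K: "ell2_norm (s N) \<le> exp (\<bar>t\<bar> * (2 + V)) * ell2_norm \<psi>" for N
    using s[of N] mult_right_mono[OF _ ell2_norm_nonneg] order_trans by blast
  note lim = evolution_ell2_limit[OF V \<psi>, of \<omega> t, folded s_def]
  have "ell2_norm (evolution V \<omega> t \<psi>) - exp (\<bar>t\<bar> * (2 + V)) * ell2_norm \<psi>
      \<le> ell2_norm (\<lambda>n. evolution V \<omega> t \<psi> n - s N n)" for N
  proof -
    have "(\<lambda>n. evolution V \<omega> t \<psi> n - s N n) \<in> ell2"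
      using ell2_add(1)[OF lim(1) ell2_scale(1)[of "s N" "- 1"]] s by simp
    from ell2_add(2)[OF this, of "s N"] s K[of N] show ?thesis by simp
  qed
  then have "ell2_norm (evolution V \<omega> t \<psi>) - exp (\<bar>t\<bar> * (2 + V)) * ell2_norm \<psi> \<le> 0"
    by (intro LIMSEQ_le_const[OF lim(2)]) auto
  then show ?thesis by simp
qed

section \<open>Conservation of the norm\<close>

lemma cmod_square_deriv:
  assumes "(f has_vector_derivative D) (at t)"
  shows "((\<lambda>t. (cmod (f t))\<^sup>2) has_real_derivative 2 * Re (cnj (f t) * D)) (at t)"
  unfolding cmod_power2
  by (rule derivative_eq_intros has_field_derivative_Re has_field_derivative_Im assms refl)+ simp

text \<open>A cut-off of slope 1 / (N + 1): currents tested against its increments are small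
  uniformly in time, while a sharp cut-off would leave boundary currents of full size.\<close>

definition tent :: "nat \<Rightarrow> int \<Rightarrow> real" where
  "tent N n = max 0 (1 - \<bar>of_int n\<bar> / real (Suc N))"

lemma tent_bounds: "0 \<le> tent N n" "tent N n \<le> 1"
  by (simp_all add: tent_def)

lemma tent_zero: "\<bar>n\<bar> > int N \<Longrightarrow> tent N n = 0"
  by (simp add: tent_def field_simps)

lemma tent_diff: "\<bar>tent N n - tent N (n + 1)\<bar> \<le> 1 / real (Suc N)"
proof -
  have max_diff: "\<bar>max 0 x - max 0 y\<bar> \<le> \<bar>x - y\<bar>" for x y :: real
    by (simp add: max_def abs_if)
  have "\<bar>tent N n - tent N (n + 1)\<bar> \<le> \<bar>(1 - \<bar>of_int n\<bar> / real (Suc N)) - (1 - \<bar>of_int (n + 1)\<bar> / real (Suc N))\<bar>"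
    unfolding tent_def using max_diff by blast
  also have "\<dots> = \<bar>\<bar>of_int (n + 1)\<bar> - \<bar>of_int n\<bar>\<bar> / real (Suc N)"
    by (simp add: diff_divide_distrib[symmetric] del: of_nat_Suc)
  also have "\<dots> \<le> 1 / real (Suc N)"
    by (intro divide_right_mono) (auto simp: abs_if)
  finally show ?thesis .
qed

lemma tent_lim: "(\<lambda>N. tent N n) \<longlonglongrightarrow> 1"
proof -
  have "(\<lambda>N. \<bar>of_int n\<bar> / real (Suc N)) \<longlonglongrightarrow> 0"
    using lim_const_over_n[of "\<bar>of_int n\<bar>"] LIMSEQ_Suc by fastforce
  then have "(\<lambda>N. max 0 (1 - \<bar>of_int n\<bar> / real (Suc N))) \<longlonglongrightarrow> max 0 (1 - 0)"
    by (intro tendsto_intros)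
  then show ?thesis by (simp add: tent_def)
qed

text \<open>The sum extends one site beyond the support of the tent on each side, so that shifting
  the index by one loses nothing.\<close>

definition tent_mass :: "nat \<Rightarrow> (int \<Rightarrow> complex) \<Rightarrow> real" where
  "tent_mass N u = (\<Sum>n\<in>{- int (Suc N)..int (Suc N)}. tent N n * (cmod (u n))\<^sup>2)"

lemma tent_mass_compare:
  assumes u: "u \<in> ell2" and v: "v \<in> ell2" and C: "\<And>N. tent_mass N u \<le> tent_mass N v + C / real (Suc N)"
  shows "ell2_norm u \<le> ell2_norm v"
proof -
  have "mass u G \<le> (ell2_norm v)\<^sup>2" if G: "finite G" for G
  proof (rule LIMSEQ_le)
    show "(\<lambda>N. \<Sum>n\<in>G. tent N n * (cmod (u n))\<^sup>2) \<longlonglongrightarrow> mass u G"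
      using tent_lim by (intro tendsto_sum) (use tendsto_mult_right in fastforce)
    have "(\<lambda>N. C / real (Suc N)) \<longlonglongrightarrow> 0"
      using lim_const_over_n[of C] LIMSEQ_Suc by fastforce
    then show "(\<lambda>N. (ell2_norm v)\<^sup>2 + C / real (Suc N)) \<longlonglongrightarrow> (ell2_norm v)\<^sup>2"
      using tendsto_add[OF tendsto_const] by fastforce
    have "(\<Sum>n\<in>G. tent N n * (cmod (u n))\<^sup>2) \<le> (ell2_norm v)\<^sup>2 + C / real (Suc N)" for N
    proof -
      have "(\<Sum>n\<in>G. tent N n * (cmod (u n))\<^sup>2) = (\<Sum>n\<in>G \<inter> {- int (Suc N)..int (Suc N)}. tent N n * (cmod (u n))\<^sup>2)"
      proof (intro sum.mono_neutral_right ballI)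
        fix n assume "n \<in> G - G \<inter> {- int (Suc N)..int (Suc N)}"
        then have "\<bar>n\<bar> > int N" by auto
        then show "tent N n * (cmod (u n))\<^sup>2 = 0" by (simp add: tent_zero)
      qed (use G in auto)
      also have "\<dots> \<le> tent_mass N u"
        unfolding tent_mass_def by (intro sum_mono2) (auto simp: tent_bounds)
      also have "\<dots> \<le> tent_mass N v + C / real (Suc N)" by (rule C)
      also have "tent_mass N v \<le> mass v {- int (Suc N)..int (Suc N)}"
        unfolding tent_mass_def by (intro sum_mono mult_left_le_one_le) (auto simp: tent_bounds)
      also have "\<dots> \<le> (ell2_norm v)\<^sup>2" by (intro sum_le_ell2_norm v) simp
      finally show ?thesis by simp
    qed
    then show "\<exists>N0. \<forall>N\<ge>N0. (\<Sum>n\<in>G. tent N n * (cmod (u n))\<^sup>2) \<le> (ell2_norm v)\<^sup>2 + C / real (Suc N)"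
      by blast
  qed
  then show ?thesis by (rule ell2_boundI(2)[OF _ ell2_norm_nonneg])
qed

text \<open>Because the potential is real, the derivative of the squared modulus at n is a
  difference of currents, 2 (J n - J (n - 1)). Summation by parts moves the difference to the tent,
  so the tent mass changes by O(1 / N) up to time \<open>t\<close>. Comparing in both directions and
  letting N grow gives equality without differentiating an infinite sum.\<close>

lemma ell2_norm_evolution:
  assumes V: "V > 0" and \<psi>: "\<psi> \<in> ell2" and "t \<ge> 0"
  shows "ell2_norm (evolution V \<omega> t \<psi>) = ell2_norm \<psi>"
proof (cases "t = 0")
  case True
  then show ?thesis by (simp add: evolution_0[abs_def])
next
  case False
  with \<open>t \<ge> 0\<close> have t: "t > 0" by simp
  let ?a = "\<lambda>s. evolution V \<omega> s \<psi>"
  define B where "B = exp (t * (2 + V)) * ell2_norm \<psi>"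
  define J where "J s n = Im (cnj (?a s n) * ?a s (n + 1))" for s n
  have a_ell2: "?a s \<in> ell2" for s by (rule evolution_ell2_limit(1)[OF V \<psi>])
  have a_bound: "ell2_norm (?a s) \<le> B" if "0 \<le> s" "s \<le> t" for s
  proof -
    have "exp (\<bar>s\<bar> * (2 + V)) \<le> exp (t * (2 + V))" using that V by (simp add: mult_right_mono)
    then have "exp (\<bar>s\<bar> * (2 + V)) * ell2_norm \<psi> \<le> B"
      unfolding B_def by (intro mult_right_mono) auto
    then show ?thesis using ell2_norm_evolution_crude[OF V \<psi>, of \<omega> s] by linarith
  qed
  have deriv_n: "((\<lambda>s. (cmod (?a s n))\<^sup>2) has_real_derivative 2 * (J s n - J s (n - 1))) (at s)" for s n
  proof -
    have "Re (cnj (?a s n) * (- \<i> * fib_H V \<omega> (?a s) n)) = J s n - J s (n - 1)"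
      by (simp add: fib_H_def J_def algebra_simps)
    then show ?thesis
      using cmod_square_deriv[OF evolution_deriv[OF V \<psi>, of \<omega> n s]] by simp
  qed
  have bound: "\<bar>tent_mass N (?a t) - tent_mass N \<psi>\<bar> \<le> (2 * B\<^sup>2 * t) / real (Suc N)" for N
  proof -
    let ?M = "int (Suc N)"
    let ?I = "{- ?M..?M}"
    define F' where "F' s = (\<Sum>n\<in>?I. tent N n * (2 * (J s n - J s (n - 1))))" for s
    have "((\<lambda>s. tent_mass N (?a s)) has_real_derivative F' s) (at s)" for s
      unfolding tent_mass_def F'_def by (intro DERIV_sum DERIV_cmult deriv_n)
    then obtain s where s: "0 < s" "s < t" and eq: "tent_mass N (?a t) - tent_mass N (?a 0) = (t - 0) * F' s"
      using MVT2[OF t, of "\<lambda>s. tent_mass N (?a s)" F'] by blast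
    \<comment> \<open>Summation by parts; the boundary terms vanish together with the tent.\<close>
    have shift: "(\<Sum>n\<in>?I. tent N n * J s (n - 1)) = (\<Sum>n\<in>?I. tent N (n + 1) * J s n)"
    proof -
      have "(\<Sum>n\<in>?I. tent N n * J s (n - 1)) = (\<Sum>n\<in>{- ?M - 1..?M - 1}. tent N (n + 1) * J s n)"
        by (rule sum.reindex_bij_witness[of _ "\<lambda>n. n + 1" "\<lambda>n. n - 1"]) auto
      also have "\<dots> = (\<Sum>n\<in>{- ?M - 1..?M}. tent N (n + 1) * J s n)"
      proof (intro sum.mono_neutral_left ballI)
        fix n assume "n \<in> {- ?M - 1..?M} - {- ?M - 1..?M - 1}"
        then have "\<bar>n + 1\<bar> > int N" by auto
        then show "tent N (n + 1) * J s n = 0" by (simp add: tent_zero)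
      qed auto
      also have "\<dots> = (\<Sum>n\<in>?I. tent N (n + 1) * J s n)"
      proof (intro sum.mono_neutral_right ballI)
        fix n assume "n \<in> {- ?M - 1..?M} - ?I"
        then have "\<bar>n + 1\<bar> > int N" by auto
        then show "tent N (n + 1) * J s n = 0" by (simp add: tent_zero)
      qed auto
      finally show ?thesis .
    qed
    have "F' s = 2 * (\<Sum>n\<in>?I. (tent N n - tent N (n + 1)) * J s n)"
    proof -
      have "F' s = 2 * ((\<Sum>n\<in>?I. tent N n * J s n) - (\<Sum>n\<in>?I. tent N n * J s (n - 1)))"
        unfolding F'_def sum_subtractf[symmetric] sum_distrib_left by (intro sum.cong) (auto simp: algebra_simps)
      then show ?thesis unfolding shift by (simp add: sum_subtractf left_diff_distrib)
    qed
    also have "\<bar>\<dots>\<bar> \<le> 2 * (\<Sum>n\<in>?I. 1 / real (Suc N) * (((cmod (?a s n))\<^sup>2 + (cmod (?a s (n + 1)))\<^sup>2) / 2))"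
      unfolding abs_mult[of 2] abs_numeral
    proof (intro mult_left_mono order_trans[OF sum_abs] sum_mono)
      fix n
      have "\<bar>J s n\<bar> \<le> cmod (?a s n) * cmod (?a s (n + 1))"
        unfolding J_def using abs_Im_le_cmod[of "cnj (?a s n) * ?a s (n + 1)"] by (simp add: norm_mult)
      also have "\<dots> \<le> ((cmod (?a s n))\<^sup>2 + (cmod (?a s (n + 1)))\<^sup>2) / 2"
        using sum_squares_bound[of "cmod (?a s n)" "cmod (?a s (n + 1))"] by simp
      finally show "\<bar>(tent N n - tent N (n + 1)) * J s n\<bar>
          \<le> 1 / real (Suc N) * (((cmod (?a s n))\<^sup>2 + (cmod (?a s (n + 1)))\<^sup>2) / 2)"
        unfolding abs_mult by (intro mult_mono tent_diff) auto
    qed simp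
    also have "\<dots> = 1 / real (Suc N) * (mass (?a s) ?I + (\<Sum>n\<in>?I. (cmod (?a s (n + 1)))\<^sup>2))"
      unfolding sum_distrib_left[symmetric] sum_divide_distrib[symmetric] sum.distrib by (simp add: field_simps)
    also have "\<dots> \<le> 1 / real (Suc N) * (B\<^sup>2 + B\<^sup>2)"
    proof (intro mult_left_mono add_mono)
      have "(ell2_norm (?a s))\<^sup>2 \<le> B\<^sup>2" using s a_bound[of s] by (intro power_mono) auto
      then have *: "mass (?a s) G \<le> B\<^sup>2" if "finite G" for G
        using sum_le_ell2_norm[OF a_ell2[of s] that] by linarith
      then show "mass (?a s) ?I \<le> B\<^sup>2" by simp
      have "(\<Sum>n\<in>?I. (cmod (?a s (n + 1)))\<^sup>2) = (\<Sum>n\<in>(\<lambda>n. n + 1) ` ?I. (cmod (?a s n))\<^sup>2)"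
        by (subst sum.reindex) auto
      also have "\<dots> \<le> B\<^sup>2" by (rule *) simp
      finally show "(\<Sum>n\<in>?I. (cmod (?a s (n + 1)))\<^sup>2) \<le> B\<^sup>2" .
    qed simp
    finally have "\<bar>F' s\<bar> \<le> 2 * B\<^sup>2 / real (Suc N)" by simp
    then have "t * \<bar>F' s\<bar> \<le> t * (2 * B\<^sup>2 / real (Suc N))" using t by (intro mult_left_mono) auto
    then show ?thesis
      using eq t by (simp add: evolution_0[abs_def] abs_mult mult_ac)
  qed
  have le: "tent_mass N (?a t) \<le> tent_mass N \<psi> + (2 * B\<^sup>2 * t) / real (Suc N)"
    "tent_mass N \<psi> \<le> tent_mass N (?a t) + (2 * B\<^sup>2 * t) / real (Suc N)" for N
    using bound[of N] by linarith+
  from tent_mass_compare[OF a_ell2 \<psi> le(1)] tent_mass_compare[OF \<psi> a_ell2 le(2)]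
  show ?thesis by (rule antisym)
qed

section \<open>The Laplace transform as a solution of the stationary equation\<close>

abbreviation decay :: "real \<Rightarrow> real \<Rightarrow> real" where
  "decay \<epsilon> t \<equiv> indicator {0..} t * exp (- \<epsilon> * t)"

lemma nn_integral_exp_decay:
  assumes "\<epsilon> > 0"
  shows "(\<integral>\<^sup>+t. ennreal (decay \<epsilon> t) \<partial>lborel) = ennreal (1 / \<epsilon>)"
proof -
  have lim: "((\<lambda>t. - exp (- \<epsilon> * t) / \<epsilon>) \<longlongrightarrow> - 0 / \<epsilon>) at_top"
    using assms by (intro tendsto_intros filterlim_compose[OF exp_at_bot]
        filterlim_tendsto_neg_mult_at_bot[OF tendsto_const] filterlim_ident) auto
  have "(\<integral>\<^sup>+t. ennreal (exp (- \<epsilon> * t)) * indicator {0..} t \<partial>lborel) = ennreal (- 0 / \<epsilon> - - exp (- \<epsilon> * 0) / \<epsilon>)"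
    by (rule nn_integral_FTC_atLeast[OF _ _ _ lim])
       (use assms in \<open>auto intro!: derivative_eq_intros\<close>)
  moreover have "ennreal (decay \<epsilon> t) = ennreal (exp (- \<epsilon> * t)) * indicator {0..} t" for t
    by (simp split: split_indicator)
  ultimately show ?thesis by simp
qed

lemma integrable_exp_decay:
  assumes "\<epsilon> > 0"
  shows "integrable lborel (\<lambda>t::real. decay \<epsilon> t)"
    "(\<integral>t. decay \<epsilon> t \<partial>lborel) = 1 / \<epsilon>"
proof -
  have m: "(\<lambda>t::real. decay \<epsilon> t) \<in> borel_measurable lborel" by measurable
  show "integrable lborel (\<lambda>t::real. decay \<epsilon> t)"
    by (rule integrableI_nonneg[OF m]) (simp_all add: nn_integral_exp_decay[OF assms, simplified])
  show "(\<integral>t. decay \<epsilon> t \<partial>lborel) = 1 / \<epsilon>"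
    using assms by (subst integral_eq_nn_integral[OF m]) (simp_all add: nn_integral_exp_decay[OF assms, simplified])
qed

definition damped :: "real \<Rightarrow> real \<Rightarrow> real \<Rightarrow> (int \<Rightarrow> complex) \<Rightarrow> int \<Rightarrow> real \<Rightarrow> complex" where
  "damped V \<omega> \<epsilon> \<psi> n t = of_real (decay \<epsilon> t) * evolution V \<omega> t \<psi> n"

text \<open>With z = E + i \<epsilon> this is - i (H - z)^(-1) \<psi>, defined as a Laplace
  transform so that no inverse operator has to be constructed.\<close>

definition resolvent :: "real \<Rightarrow> real \<Rightarrow> real \<Rightarrow> (int \<Rightarrow> complex) \<Rightarrow> real \<Rightarrow> int \<Rightarrow> complex" where
  "resolvent V \<omega> \<epsilon> \<psi> E n = (\<integral>t. damped V \<omega> \<epsilon> \<psi> n t * iexp (E * t) \<partial>lborel)"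

lemma cmod_evolution_le:
  assumes "V > 0" "\<psi> \<in> ell2" "t \<ge> 0"
  shows "cmod (evolution V \<omega> t \<psi> n) \<le> ell2_norm \<psi>"
  using cmod_le_ell2_norm[OF evolution_ell2_limit(1)[OF assms(1,2)]] ell2_norm_evolution[OF assms] by metis

lemma evolution_measurable [measurable]:
  assumes "V > 0" "\<psi> \<in> ell2"
  shows "(\<lambda>t. evolution V \<omega> t \<psi> n) \<in> borel_measurable borel"
  by (intro borel_measurable_continuous_onI evolution_continuous assms)

context
  fixes V \<omega> \<epsilon> :: real and \<psi> :: "int \<Rightarrow> complex"
  assumes V: "V > 0" and \<psi>: "\<psi> \<in> ell2" and \<epsilon>: "\<epsilon> > 0"
begin

lemma damped_bound: "cmod (damped V \<omega> \<epsilon> \<psi> n t) \<le> (decay \<epsilon> t) * ell2_norm \<psi>"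
  unfolding damped_def norm_mult using cmod_evolution_le[OF V \<psi>]
  by (auto split: split_indicator)

lemma damped_measurable [measurable]: "damped V \<omega> \<epsilon> \<psi> n \<in> borel_measurable borel"
proof -
  have [measurable]: "(\<lambda>t. evolution V \<omega> t \<psi> n) \<in> borel_measurable borel"
    using V \<psi> by (rule evolution_measurable)
  show ?thesis unfolding damped_def[abs_def] by measurable
qed

lemma damped_integrable: "integrable lborel (damped V \<omega> \<epsilon> \<psi> n)"
proof (rule Bochner_Integration.integrable_bound)
  show "integrable lborel (\<lambda>t. (decay \<epsilon> t) * ell2_norm \<psi>)"
    using integrable_exp_decay(1)[OF \<epsilon>] by simp
  show "AE t in lborel. norm (damped V \<omega> \<epsilon> \<psi> n t) \<le> norm ((decay \<epsilon> t) * ell2_norm \<psi>)"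
    using damped_bound by (intro AE_I2) (simp add: abs_mult)
qed measurable

lemma damped_iexp_integrable: "integrable lborel (\<lambda>t. damped V \<omega> \<epsilon> \<psi> n t * iexp (E * t))"
  by (rule Bochner_Integration.integrable_bound[OF damped_integrable[of n]]) (auto simp: norm_mult)

text \<open>The derivative of exp (i z t) times the evolution is integrated over all positive times.
  The end at infinity vanishes by damping, and the end at 0 contributes the source term.\<close>

lemma resolvent_equation:
  "fib_H V \<omega> (resolvent V \<omega> \<epsilon> \<psi> E) n = (of_real E + \<i> * of_real \<epsilon>) * resolvent V \<omega> \<epsilon> \<psi> E n - \<i> * \<psi> n"
proof -
  define z where "z = of_real E + \<i> * of_real \<epsilon>"
  let ?a = "\<lambda>t n. evolution V \<omega> t \<psi> n"
  define h' where "h' t = exp (\<i> * z * of_real t) * (\<i> * z * ?a t n - \<i> * fib_H V \<omega> (?a t) n)" for t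
  have exp_eq: "exp (\<i> * z * of_real t) = of_real (exp (- \<epsilon> * t)) * iexp (E * t)" for t
    by (simp add: z_def exp_add[symmetric] exp_of_real[symmetric] algebra_simps del: exp_of_real)
  have damped_eq: "damped V \<omega> \<epsilon> \<psi> n t * iexp (E * t) = indicator {0..} t *\<^sub>R (exp (\<i> * z * of_real t) * ?a t n)" for n t
    unfolding damped_def exp_eq by (simp add: scaleR_conv_of_real mult_ac)
  have deriv: "((\<lambda>t. exp (\<i> * z * of_real t) * ?a t n) has_vector_derivative h' t) (at t)" for t
  proof -
    have "((\<lambda>w. exp (\<i> * z * w)) has_field_derivative \<i> * z * exp (\<i> * z * of_real t)) (at (of_real t))"
      by (auto intro!: derivative_eq_intros)
    from has_vector_derivative_real_field[OF this] evolution_deriv[OF V \<psi>, of \<omega> n t]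
    have "((\<lambda>t. exp (\<i> * z * of_real t) * ?a t n) has_vector_derivative
        exp (\<i> * z * of_real t) * (- \<i> * fib_H V \<omega> (?a t) n) + \<i> * z * exp (\<i> * z * of_real t) * ?a t n) (at t)"
      by (rule has_vector_derivative_mult)
    then show ?thesis by (simp add: h'_def algebra_simps)
  qed
  have cont: "continuous_on S h'" for S
    unfolding h'_def fib_H_def by (intro continuous_intros evolution_continuous V \<psi>)
  define D where "D n t = damped V \<omega> \<epsilon> \<psi> n t * iexp (E * t)" for n t
  have D_int: "integrable lborel (D n)" for n
    unfolding D_def by (rule damped_iexp_integrable)
  have D_val: "(\<integral>t. D n t \<partial>lborel) = resolvent V \<omega> \<epsilon> \<psi> E n" for n
    by (simp only: D_def resolvent_def)
  let ?q = "of_real (fib_potential V \<omega> n) :: complex"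
  have h'_eq: "indicator {0..} t *\<^sub>R h' t = (\<i> * z - \<i> * ?q) * D n t - \<i> * D (n + 1) t - \<i> * D (n - 1) t" for t
    unfolding D_def damped_eq h'_def fib_H_def by (simp add: scaleR_conv_of_real algebra_simps)
  have int: "integrable lborel (\<lambda>t. indicator {0..} t *\<^sub>R h' t)"
    unfolding h'_eq by (intro Bochner_Integration.integrable_diff integrable_mult_right D_int)
  have "(\<integral>t. indicator {0..} t *\<^sub>R h' t \<partial>lborel)
      = (\<i> * z - \<i> * ?q) * resolvent V \<omega> \<epsilon> \<psi> E n - \<i> * resolvent V \<omega> \<epsilon> \<psi> E (n + 1) - \<i> * resolvent V \<omega> \<epsilon> \<psi> E (n - 1)"
    unfolding h'_eq using D_int
    by (simp only: Bochner_Integration.integral_diff Bochner_Integration.integrable_diff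
        integrable_mult_right integral_mult_right_zero D_val)
  then have val: "(\<integral>t. indicator {0..} t *\<^sub>R h' t \<partial>lborel)
      = \<i> * z * resolvent V \<omega> \<epsilon> \<psi> E n - \<i> * fib_H V \<omega> (resolvent V \<omega> \<epsilon> \<psi> E) n"
    by (simp add: fib_H_def algebra_simps)
  have "((\<lambda>y. \<integral>t. indicator {..y} t *\<^sub>R (indicator {0..} t *\<^sub>R h' t) \<partial>lborel)
      \<longlongrightarrow> (\<integral>t. indicator {0..} t *\<^sub>R h' t \<partial>lborel)) at_top"
    by (rule tendsto_integral_at_top[OF _ int]) simp
  moreover have "\<forall>\<^sub>F y in at_top. (\<integral>t. indicator {..y} t *\<^sub>R (indicator {0..} t *\<^sub>R h' t) \<partial>lborel)
      = exp (\<i> * z * of_real y) * ?a y n - \<psi> n"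
    using eventually_ge_at_top[of "0::real"]
  proof eventually_elim
    case (elim y)
    have "(\<integral>t. indicator {..y} t *\<^sub>R (indicator {0..} t *\<^sub>R h' t) \<partial>lborel) = (\<integral>t. indicator {0..y} t *\<^sub>R h' t \<partial>lborel)"
      by (intro Bochner_Integration.integral_cong) (auto split: split_indicator)
    also have "\<dots> = exp (\<i> * z * of_real y) * ?a y n - exp (\<i> * z * of_real 0) * ?a 0 n"
      by (rule integral_FTC_Icc[OF elim]) (auto intro!: has_vector_derivative_at_within deriv cont)
    finally show ?case by (simp add: evolution_0)
  qed
  ultimately have lim1: "((\<lambda>y. exp (\<i> * z * of_real y) * ?a y n - \<psi> n)
      \<longlongrightarrow> (\<integral>t. indicator {0..} t *\<^sub>R h' t \<partial>lborel)) at_top"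
    by (rule Lim_transform_eventually)
  have "((\<lambda>y. exp (\<i> * z * of_real y) * ?a y n) \<longlongrightarrow> 0) at_top"
  proof (rule tendsto_norm_zero_cancel, rule tendsto_sandwich[OF _ _ tendsto_const])
    show "\<forall>\<^sub>F y in at_top. norm (exp (\<i> * z * of_real y) * ?a y n) \<le> exp (- \<epsilon> * y) * ell2_norm \<psi>"
      using eventually_ge_at_top[of "0::real"]
    proof eventually_elim
      case (elim y)
      then show ?case unfolding exp_eq norm_mult
        using cmod_evolution_le[OF V \<psi> elim, of \<omega> n] by (simp add: mult_left_mono)
    qed
    have "((\<lambda>y. exp (- \<epsilon> * y)) \<longlongrightarrow> 0) at_top"
      using \<epsilon> by (intro filterlim_compose[OF exp_at_bot]
          filterlim_tendsto_neg_mult_at_bot[OF tendsto_const] filterlim_ident) auto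
    then show "((\<lambda>y. exp (- \<epsilon> * y) * ell2_norm \<psi>) \<longlongrightarrow> 0) at_top"
      by (rule tendsto_mult_left_zero)
  qed simp
  then have "((\<lambda>y. exp (\<i> * z * of_real y) * ?a y n - \<psi> n) \<longlongrightarrow> 0 - \<psi> n) at_top"
    by (intro tendsto_diff tendsto_const)
  from tendsto_unique[OF _ lim1 this] have "\<i> * z * resolvent V \<omega> \<epsilon> \<psi> E n - \<i> * fib_H V \<omega> (resolvent V \<omega> \<epsilon> \<psi> E) n = - \<psi> n"
    by (simp add: val)
  then have "\<i> * (\<i> * z * resolvent V \<omega> \<epsilon> \<psi> E n - \<i> * fib_H V \<omega> (resolvent V \<omega> \<epsilon> \<psi> E) n) = \<i> * (- \<psi> n)"
    by simp
  then show ?thesis by (simp add: z_def algebra_simps)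
qed

lemma damped_square: "(cmod (damped V \<omega> \<epsilon> \<psi> n t))\<^sup>2
    = decay (2 * \<epsilon>) t * (cmod (evolution V \<omega> t \<psi> n))\<^sup>2"
  by (simp add: damped_def norm_mult power_mult_distrib exp_double[symmetric] split: split_indicator)

lemma resolvent_plancherel:
  "(\<integral>\<^sup>+E. ennreal ((cmod (resolvent V \<omega> \<epsilon> \<psi> E n))\<^sup>2) \<partial>lborel)
    = ennreal (2 * pi) * (\<integral>\<^sup>+t. ennreal (decay (2 * \<epsilon>) t * (cmod (evolution V \<omega> t \<psi> n))\<^sup>2) \<partial>lborel)"
  unfolding resolvent_def damped_square[symmetric]
proof (rule plancherel_integrable[OF damped_integrable])
  show "cmod (damped V \<omega> \<epsilon> \<psi> n t) \<le> ell2_norm \<psi>" for t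
  proof (rule order_trans[OF damped_bound])
    have "decay \<epsilon> t \<le> 1"
      using \<epsilon> by (auto split: split_indicator)
    then show "decay \<epsilon> t * ell2_norm \<psi> \<le> ell2_norm \<psi>"
      by (intro mult_left_le_one_le) auto
  qed
  \<comment> \<open>The jump of the damped evolution at time 0 is its only discontinuity.\<close>
  fix t :: real assume "t \<noteq> 0"
  have a: "isCont (\<lambda>t. evolution V \<omega> t \<psi> n) t"
    by (rule has_vector_derivative_continuous[OF evolution_deriv[OF V \<psi>]])
  show "isCont (damped V \<omega> \<epsilon> \<psi> n) t"
  proof (cases "t > 0")
    case True
    have "\<forall>\<^sub>F s in nhds t. of_real (exp (- \<epsilon> * s)) * evolution V \<omega> s \<psi> n = damped V \<omega> \<epsilon> \<psi> n s"
      using eventually_nhds_in_open[of "{0<..}" t] True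
      by (auto elim!: eventually_mono simp: damped_def)
    moreover have "isCont (\<lambda>s. of_real (exp (- \<epsilon> * s)) * evolution V \<omega> s \<psi> n) t"
      by (intro continuous_intros a)
    ultimately show ?thesis using isCont_cong by fastforce
  next
    case False
    then have "\<forall>\<^sub>F s in nhds t. 0 = damped V \<omega> \<epsilon> \<psi> n s"
      using eventually_nhds_in_open[of "{..<0}" t] \<open>t \<noteq> 0\<close>
      by (auto elim!: eventually_mono simp: damped_def)
    moreover have "isCont (\<lambda>s. 0 :: complex) t" by simp
    ultimately show ?thesis using isCont_cong by fastforce
  qed
qed

lemma sum_damped_le:
  assumes "finite F"
  shows "mass (evolution V \<omega> t \<psi>) F * indicator {0..} t \<le> (ell2_norm \<psi>)\<^sup>2 * indicator {0..} t"
  using sum_le_ell2_norm[OF evolution_ell2_limit(1)[OF V \<psi>] assms, of \<omega> t] ell2_norm_evolution[OF V \<psi>, of t \<omega>]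
  by (auto split: split_indicator)

lemma sum_resolvent_plancherel_le:
  assumes F: "finite F"
  shows "(\<integral>\<^sup>+E. ennreal (mass (resolvent V \<omega> \<epsilon> \<psi> E) F) \<partial>lborel)
    \<le> ennreal (pi / \<epsilon> * (ell2_norm \<psi>)\<^sup>2)"
proof -
  have [measurable]: "(\<lambda>t. evolution V \<omega> t \<psi> n) \<in> borel_measurable borel" for n
    using V \<psi> by (rule evolution_measurable)
  have [measurable]: "(\<lambda>E. resolvent V \<omega> \<epsilon> \<psi> E n) \<in> borel_measurable borel" for n
    unfolding resolvent_def by measurable
  have "(\<integral>\<^sup>+E. ennreal (mass (resolvent V \<omega> \<epsilon> \<psi> E) F) \<partial>lborel)
      = (\<Sum>n\<in>F. \<integral>\<^sup>+E. ennreal ((cmod (resolvent V \<omega> \<epsilon> \<psi> E n))\<^sup>2) \<partial>lborel)"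
    by (subst nn_integral_sum[symmetric]) auto
  also have "\<dots> = ennreal (2 * pi) * (\<Sum>n\<in>F. \<integral>\<^sup>+t. ennreal (decay (2 * \<epsilon>) t * (cmod (evolution V \<omega> t \<psi> n))\<^sup>2) \<partial>lborel)"
    unfolding resolvent_plancherel sum_distrib_left ..
  finally have eq: "(\<integral>\<^sup>+E. ennreal (mass (resolvent V \<omega> \<epsilon> \<psi> E) F) \<partial>lborel)
      = ennreal (2 * pi) * (\<Sum>n\<in>F. \<integral>\<^sup>+t. ennreal (decay (2 * \<epsilon>) t * (cmod (evolution V \<omega> t \<psi> n))\<^sup>2) \<partial>lborel)" .
  have "(\<Sum>n\<in>F. \<integral>\<^sup>+t. ennreal (decay (2 * \<epsilon>) t * (cmod (evolution V \<omega> t \<psi> n))\<^sup>2) \<partial>lborel)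
      = (\<integral>\<^sup>+t. ennreal (\<Sum>n\<in>F. decay (2 * \<epsilon>) t * (cmod (evolution V \<omega> t \<psi> n))\<^sup>2) \<partial>lborel)"
    by (subst nn_integral_sum[symmetric]) auto
  also have "\<dots> \<le> (\<integral>\<^sup>+t. ennreal ((ell2_norm \<psi>)\<^sup>2) * ennreal (decay (2 * \<epsilon>) t) \<partial>lborel)"
  proof (intro nn_integral_mono)
    fix t :: real
    have "(\<Sum>n\<in>F. decay (2 * \<epsilon>) t * (cmod (evolution V \<omega> t \<psi> n))\<^sup>2)
        = exp (- (2 * \<epsilon>) * t) * (mass (evolution V \<omega> t \<psi>) F * indicator {0..} t)"
      by (simp add: sum_distrib_left sum_distrib_right mult_ac)
    also have "\<dots> \<le> exp (- (2 * \<epsilon>) * t) * ((ell2_norm \<psi>)\<^sup>2 * indicator {0..} t)"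
      by (intro mult_left_mono sum_damped_le F) simp
    finally show "ennreal (\<Sum>n\<in>F. decay (2 * \<epsilon>) t * (cmod (evolution V \<omega> t \<psi> n))\<^sup>2)
        \<le> ennreal ((ell2_norm \<psi>)\<^sup>2) * ennreal (decay (2 * \<epsilon>) t)"
      by (subst ennreal_mult[symmetric]) (auto intro!: ennreal_leI simp: mult_ac)
  qed
  also have "\<dots> = ennreal ((ell2_norm \<psi>)\<^sup>2) * (\<integral>\<^sup>+t. ennreal (decay (2 * \<epsilon>) t) \<partial>lborel)"
    by (rule nn_integral_cmult) measurable
  also have "\<dots> = ennreal ((ell2_norm \<psi>)\<^sup>2) * ennreal (1 / (2 * \<epsilon>))"
    using \<epsilon> by (subst nn_integral_exp_decay) auto
  finally have "ennreal (2 * pi) * (\<Sum>n\<in>F. \<integral>\<^sup>+t. ennreal (decay (2 * \<epsilon>) t * (cmod (evolution V \<omega> t \<psi> n))\<^sup>2) \<partial>lborel)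
      \<le> ennreal (2 * pi) * (ennreal ((ell2_norm \<psi>)\<^sup>2) * ennreal (1 / (2 * \<epsilon>)))"
    by (rule mult_left_mono) simp
  also have "\<dots> = ennreal (pi / \<epsilon> * (ell2_norm \<psi>)\<^sup>2)"
    using \<epsilon> by (simp add: ennreal_mult[symmetric] field_simps)
  finally show ?thesis unfolding eq .
qed

text \<open>Jensen's inequality for the exponential weight of total mass 1 / \<epsilon>, applied at
  each site, allows the squared moduli to be summed under the time integral, where the norm is
  conserved.\<close>

lemma resolvent_ell2:
  shows "resolvent V \<omega> \<epsilon> \<psi> E \<in> ell2" "ell2_norm (resolvent V \<omega> \<epsilon> \<psi> E) \<le> ell2_norm \<psi> / \<epsilon>"
proof -
  let ?w = "\<lambda>t::real. decay \<epsilon> t" and ?a = "\<lambda>n t. cmod (evolution V \<omega> t \<psi> n)"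
  have [measurable]: "(\<lambda>t. evolution V \<omega> t \<psi> n) \<in> borel_measurable borel" for n
    using V \<psi> by (rule evolution_measurable)
  have w: "?w t \<ge> 0" for t by simp
  have int1: "integrable lborel (\<lambda>t. ?w t * ?a n t)" for n
    using integrable_norm[OF damped_integrable[of n]] by (simp add: damped_def norm_mult)
  have int2: "integrable lborel (\<lambda>t. ?w t * (?a n t)\<^sup>2)" for n
  proof (rule Bochner_Integration.integrable_bound[of _ "\<lambda>t. ?w t * (ell2_norm \<psi>)\<^sup>2"])
    show "AE t in lborel. norm (?w t * (?a n t)\<^sup>2) \<le> norm (?w t * (ell2_norm \<psi>)\<^sup>2)"
      using cmod_evolution_le[OF V \<psi>] by (intro AE_I2) (auto split: split_indicator intro!: mult_left_mono power_mono)
  qed (use integrable_exp_decay(1)[OF \<epsilon>] in auto)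
  have pt: "(cmod (resolvent V \<omega> \<epsilon> \<psi> E n))\<^sup>2 \<le> (\<integral>t. ?w t * (?a n t)\<^sup>2 \<partial>lborel) / \<epsilon>" for n
  proof -
    define I where "I = (\<integral>t. ?w t * ?a n t \<partial>lborel)"
    \<comment> \<open>\<open>\<epsilon> * I\<close> is the weighted mean, so this is the
      variance.\<close>
    have "0 \<le> (\<integral>t. ?w t * (?a n t - \<epsilon> * I)\<^sup>2 \<partial>lborel)" by (intro Bochner_Integration.integral_nonneg) simp
    also have "\<dots> = (\<integral>t. ?w t * (?a n t)\<^sup>2 - (2 * \<epsilon> * I) * (?w t * ?a n t) + (\<epsilon> * I)\<^sup>2 * ?w t \<partial>lborel)"
      by (intro Bochner_Integration.integral_cong) (simp_all add: power2_eq_square algebra_simps)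
    also have "\<dots> = (\<integral>t. ?w t * (?a n t)\<^sup>2 \<partial>lborel) - (2 * \<epsilon> * I) * I + (\<epsilon> * I)\<^sup>2 * (1 / \<epsilon>)"
      unfolding I_def integrable_exp_decay(2)[OF \<epsilon>, symmetric]
      using int1[of n] int2[of n] integrable_exp_decay(1)[OF \<epsilon>]
      by (simp only: Bochner_Integration.integral_add Bochner_Integration.integral_diff integrable_mult_right
          Bochner_Integration.integrable_diff integral_mult_right_zero)
    finally have "\<epsilon> * I\<^sup>2 \<le> (\<integral>t. ?w t * (?a n t)\<^sup>2 \<partial>lborel)"
      using \<epsilon> by (simp add: power2_eq_square mult_ac)
    then have "I\<^sup>2 \<le> (\<integral>t. ?w t * (?a n t)\<^sup>2 \<partial>lborel) / \<epsilon>"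
      using \<epsilon> by (simp add: field_simps)
    moreover have "cmod (resolvent V \<omega> \<epsilon> \<psi> E n) \<le> I"
      unfolding resolvent_def I_def
      by (rule order_trans[OF integral_norm_bound]) (simp add: damped_def norm_mult)
    then have "(cmod (resolvent V \<omega> \<epsilon> \<psi> E n))\<^sup>2 \<le> I\<^sup>2" by (intro power_mono) auto
    ultimately show ?thesis by linarith
  qed
  have "mass (resolvent V \<omega> \<epsilon> \<psi> E) F \<le> (ell2_norm \<psi> / \<epsilon>)\<^sup>2" if F: "finite F" for F
  proof -
    have "mass (resolvent V \<omega> \<epsilon> \<psi> E) F \<le> (\<Sum>n\<in>F. (\<integral>t. ?w t * (?a n t)\<^sup>2 \<partial>lborel) / \<epsilon>)"
      by (intro sum_mono pt)
    also have "\<dots> = (\<integral>t. (\<Sum>n\<in>F. ?w t * (?a n t)\<^sup>2) \<partial>lborel) / \<epsilon>"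
      using int2 by (simp add: sum_divide_distrib)
    also have "\<dots> \<le> (\<integral>t. (ell2_norm \<psi>)\<^sup>2 * ?w t \<partial>lborel) / \<epsilon>"
    proof (intro divide_right_mono integral_mono)
      fix t :: real
      have "(\<Sum>n\<in>F. ?w t * (?a n t)\<^sup>2) = exp (- \<epsilon> * t) * ((\<Sum>n\<in>F. (?a n t)\<^sup>2) * indicator {0..} t)"
        by (simp add: sum_distrib_left sum_distrib_right mult_ac)
      also have "\<dots> \<le> exp (- \<epsilon> * t) * ((ell2_norm \<psi>)\<^sup>2 * indicator {0..} t)"
        by (intro mult_left_mono sum_damped_le F) simp
      finally show "(\<Sum>n\<in>F. ?w t * (?a n t)\<^sup>2) \<le> (ell2_norm \<psi>)\<^sup>2 * ?w t" by (simp add: mult_ac)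
    qed (use int2 integrable_exp_decay(1)[OF \<epsilon>] \<epsilon> in auto)
    also have "\<dots> = (ell2_norm \<psi> / \<epsilon>)\<^sup>2"
      by (simp only: integral_mult_right_zero integrable_exp_decay(2)[OF \<epsilon>]) (simp add: power2_eq_square)
    finally show ?thesis .
  qed
  from ell2_boundI[OF this] \<epsilon> show "resolvent V \<omega> \<epsilon> \<psi> E \<in> ell2" "ell2_norm (resolvent V \<omega> \<epsilon> \<psi> E) \<le> ell2_norm \<psi> / \<epsilon>"
    by simp_all
qed

end

section \<open>Transport\<close>

definition site :: "int \<Rightarrow> int \<Rightarrow> complex" where
  "site m n = (if n = m then 1 else 0)"

lemma site_ell2: "site m \<in> ell2" and ell2_norm_site: "ell2_norm (site m) \<le> 1"
proof -
  have "mass (site m) F \<le> 1\<^sup>2" if "finite F" for F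
  proof -
    have "mass (site m) F = (\<Sum>n\<in>F. if n = m then 1 else 0)"
      by (intro sum.cong) (auto simp: site_def)
    also have "\<dots> \<le> 1" using that by simp
    finally show ?thesis by simp
  qed
  from ell2_boundI[OF this] show "site m \<in> ell2" "ell2_norm (site m) \<le> 1" by simp_all
qed

text \<open>A dichotomy in the norm x of the transform. If x is small, its square goes into the last
  term, which is integrable over the energies. If x is large, the residual of the transform at
  \<open>E\<close> is below 2 \<delta> x, and a ring eigenvalue lies within 2 \<delta> of
  \<open>E\<close>, hence within 3 \<delta> of z. The hypothesis \<open>scale\<close> then bounds
  the traces at z up to index \<open>12 * i\<close>.\<close>

lemma resolvent_site_window:
  fixes V \<omega> \<epsilon> \<delta> E :: real and m :: int and i :: nat
  assumes V: "V > 0" and \<epsilon>: "0 < \<epsilon>" "\<epsilon> \<le> \<delta>" and \<delta>: "\<delta> \<le> 1"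
    and scale: "3 * \<delta> * (8 + V) ^ (12 * i) \<le> 1" and i: "i \<ge> 1"
  defines "\<phi> \<equiv> resolvent V \<omega> \<epsilon> (site m) E" and "c \<equiv> 1 + 1 / (2 * (7 + V)\<^sup>2 + 2)"
  shows "mass \<phi> {n. \<bar>n - m\<bar> < int (fib (6 * i))}
    \<le> 2 / c ^ i * mass \<phi> {n. \<bar>n - m\<bar> < int (fib (12 * i))}
      + (1 + (2 * (3 + V))\<^sup>2) / \<delta>\<^sup>2 * inverse (1 + E\<^sup>2)"
proof -
  define x where "x = ell2_norm \<phi>"
  define R where "R = 2 * (3 + V)"
  have R: "R > 6" using V by (simp add: R_def)
  have \<delta>0: "\<delta> > 0" using \<epsilon> by simp
  have c: "c > 0" by (simp add: c_def add_pos_nonneg)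
  have \<phi>: "\<phi> \<in> ell2" unfolding \<phi>_def by (rule resolvent_ell2(1)[OF V site_ell2 \<epsilon>(1)])
  have fin: "finite {n. \<bar>n - m\<bar> < L}" for L
    by (rule finite_subset[of _ "{m - L..m + L}"]) auto
  have nn: "0 \<le> 2 / c ^ i * mass \<phi> {n. \<bar>n - m\<bar> < int (fib (12 * i))}"
    using c by (simp add: sum_nonneg)
  have nn': "0 \<le> (1 + R\<^sup>2) / \<delta>\<^sup>2 * inverse (1 + E\<^sup>2)"
    by (simp add: add_nonneg_nonneg)
  have eq: "fib_H V \<omega> \<phi> n = (of_real E + \<i> * of_real \<epsilon>) * \<phi> n - \<i> * site m n" for n
    unfolding \<phi>_def by (rule resolvent_equation[OF V site_ell2 \<epsilon>(1)])
  have x0: "x \<ge> 0" by (simp add: x_def)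
  define r where "r n = fib_H V \<omega> \<phi> n - of_real E * \<phi> n" for n
  have r: "r \<in> ell2" "ell2_norm r \<le> \<epsilon> * x + 1"
  proof -
    have "r = (\<lambda>n. (\<i> * of_real \<epsilon>) * \<phi> n + (- \<i>) * site m n)"
      by (simp add: r_def fun_eq_iff eq algebra_simps)
    then have "r \<in> ell2" "ell2_norm r \<le> ell2_norm (\<lambda>n. (\<i> * of_real \<epsilon>) * \<phi> n) + ell2_norm (\<lambda>n. (- \<i>) * site m n)"
      using ell2_add[OF ell2_scale(1)[OF \<phi>] ell2_scale(1)[OF site_ell2]] by blast+
    moreover have "ell2_norm (\<lambda>n. (\<i> * of_real \<epsilon>) * \<phi> n) \<le> \<epsilon> * x"
      using ell2_scale(2)[OF \<phi>, of "\<i> * of_real \<epsilon>"] \<epsilon> by (simp add: norm_mult x_def)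
    moreover have "ell2_norm (\<lambda>n. (- \<i>) * site m n) \<le> 1"
      using ell2_scale(2)[OF site_ell2, of "- \<i>" m] ell2_norm_site[of m] by simp
    ultimately show "r \<in> ell2" "ell2_norm r \<le> \<epsilon> * x + 1" by linarith+
  qed
  show ?thesis
  proof (cases "x\<^sup>2 \<le> (1 + R\<^sup>2) / \<delta>\<^sup>2 * inverse (1 + E\<^sup>2)")
    case True
    have "mass \<phi> {n. \<bar>n - m\<bar> < int (fib (6 * i))} \<le> x\<^sup>2"
      unfolding x_def by (rule sum_le_ell2_norm[OF \<phi> fin])
    then show ?thesis using True nn by (simp add: R_def)
  next
    case False
    have E1: "1 + E\<^sup>2 > 0" by (simp add: add_pos_nonneg)
    have \<delta>2: "0 < \<delta>\<^sup>2" "\<delta>\<^sup>2 \<le> 1" using \<delta>0 \<delta> by (simp_all add: power_le_one)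
    from False have "(1 + R\<^sup>2) / \<delta>\<^sup>2 * inverse (1 + E\<^sup>2) * (1 + E\<^sup>2) < x\<^sup>2 * (1 + E\<^sup>2)"
      using E1 by (intro mult_strict_right_mono) auto
    then have "(1 + R\<^sup>2) / \<delta>\<^sup>2 < x\<^sup>2 * (1 + E\<^sup>2)"
      using E1 by (simp only: mult.assoc left_inverse[OF less_imp_neq[OF E1, symmetric]] mult_1_right)
    then have big: "1 + R\<^sup>2 < x\<^sup>2 * (1 + E\<^sup>2) * \<delta>\<^sup>2"
      using \<delta>2 by (simp add: field_simps)
    \<comment> \<open>For |E| at least R, twice the bound 3 + V obtained from the norm of H and the
      damping, the equation alone forces |E| x \<le> 2. That is incompatible with x being large, so
      1 + E^2 is at most 1 + R^2 and x \<delta> > 1 follows.\<close>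
    have "\<bar>E\<bar> < R"
    proof (rule ccontr)
      assume "\<not> \<bar>E\<bar> < R"
      then have E: "R \<le> \<bar>E\<bar>" by simp
      have "(\<lambda>n. of_real E * \<phi> n) = (\<lambda>n. fib_H V \<omega> \<phi> n + (- 1) * r n)"
        by (simp add: r_def fun_eq_iff)
      then have "ell2_norm (\<lambda>n. of_real E * \<phi> n) \<le> ell2_norm (fib_H V \<omega> \<phi>) + ell2_norm (\<lambda>n. (- 1) * r n)"
        using ell2_add(2)[OF fib_H_ell2(1)[OF V \<phi>, of \<omega>] ell2_scale(1)[OF r(1), of "- 1"]] by simp
      also have "\<dots> \<le> (2 + V) * x + (\<epsilon> * x + 1)"
        using fib_H_ell2(2)[OF V \<phi>, of \<omega>] ell2_scale(2)[OF r(1), of "- 1"] r(2)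
        by (intro add_mono) (simp_all add: x_def)
      also have "\<dots> \<le> (3 + V) * x + 1"
        using mult_right_mono[of \<epsilon> 1 x] \<epsilon> \<delta> x0 by (simp add: algebra_simps)
      finally have 1: "ell2_norm (\<lambda>n. of_real E * \<phi> n) \<le> (3 + V) * x + 1" .
      have "\<bar>E\<bar> * x \<le> ell2_norm (\<lambda>n. of_real E * \<phi> n)"
      proof -
        have "ell2_norm (\<lambda>n. inverse (of_real E) * (of_real E * \<phi> n)) \<le> inverse \<bar>E\<bar> * ell2_norm (\<lambda>n. of_real E * \<phi> n)"
          using ell2_scale(2)[OF ell2_scale(1)[OF \<phi>], of "inverse (of_real E)" "of_real E"]
          by (simp add: norm_inverse)
        moreover have "(\<lambda>n. inverse (of_real E) * (of_real E * \<phi> n)) = \<phi>"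
          using E R by (auto simp: fun_eq_iff)
        ultimately show ?thesis using E R by (simp add: x_def field_simps)
      qed
      with 1 have "\<bar>E\<bar> * x \<le> (3 + V) * x + 1" by linarith
      moreover have "(3 + V) * x \<le> \<bar>E\<bar> / 2 * x"
        using E x0 by (intro mult_right_mono) (simp_all add: R_def)
      ultimately have Ex: "\<bar>E\<bar> * x \<le> 2" by simp
      have "6 * x \<le> \<bar>E\<bar> * x" using E R x0 by (intro mult_right_mono) auto
      then have "x \<le> 1" using Ex by simp
      then have "x\<^sup>2 \<le> 1" using x0 by (simp add: power_le_one)
      moreover have "(\<bar>E\<bar> * x)\<^sup>2 \<le> 2\<^sup>2" using Ex x0 by (intro power_mono) auto
      ultimately have "x\<^sup>2 * (1 + E\<^sup>2) \<le> 5" by (simp add: power_mult_distrib algebra_simps)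
      then have "x\<^sup>2 * (1 + E\<^sup>2) * \<delta>\<^sup>2 \<le> 5 * 1"
        using \<delta>2 E1 by (intro mult_mono) auto
      moreover have "R\<^sup>2 \<ge> 6\<^sup>2" using R by (intro power_mono) auto
      ultimately show False using big by simp
    qed
    then have "E\<^sup>2 \<le> R\<^sup>2" using power_mono[of "\<bar>E\<bar>" R 2] by simp
    then have "(x * \<delta>)\<^sup>2 * (1 + E\<^sup>2) \<le> (x * \<delta>)\<^sup>2 * (1 + R\<^sup>2)"
      by (intro mult_left_mono) auto
    moreover have "x\<^sup>2 * (1 + E\<^sup>2) * \<delta>\<^sup>2 = (x * \<delta>)\<^sup>2 * (1 + E\<^sup>2)"
      by (simp only: power_mult_distrib mult_ac)
    ultimately have "1 * (1 + R\<^sup>2) < (x * \<delta>)\<^sup>2 * (1 + R\<^sup>2)"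
      using big by (simp only: mult_1)
    then have "1 < (x * \<delta>)\<^sup>2"
      by (rule mult_right_less_imp_less) simp
    then have "1 < x * \<delta>"
      using power2_less_imp_less[of 1 "x * \<delta>"] x0 \<delta>0 by simp
    moreover have "\<epsilon> * x \<le> \<delta> * x" using \<epsilon> x0 by (intro mult_right_mono) auto
    moreover have "2 * \<delta> * x = \<delta> * x + x * \<delta>" by simp
    ultimately have "ell2_norm r < 2 * \<delta> * x" using r(2) by linarith
    then have "\<exists>ev::real. \<exists>j\<ge>12 * i. \<bar>ev - E\<bar> \<le> 2 * \<delta> \<and> fib_trace V (of_real ev) (Suc j) = 2"
      using \<delta>0 unfolding r_def x_def by (intro spectral_trace[OF V \<phi>]) auto
    then obtain ev :: real and j where j: "j \<ge> 12 * i" and ev: "\<bar>ev - E\<bar> \<le> 2 * \<delta>"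
      and tr: "fib_trace V (of_real ev) (Suc j) = 2"
      by blast
    define z where "z = of_real E + \<i> * of_real \<epsilon>"
    have "cmod (z - of_real ev) \<le> cmod (of_real (E - ev)) + cmod (\<i> * of_real \<epsilon>)"
      by (rule order_trans[OF _ norm_triangle_ineq]) (simp add: z_def algebra_simps)
    also have "\<dots> \<le> 3 * \<delta>" using ev \<epsilon> by (simp add: norm_mult del: of_real_diff)
    finally have "cmod (z - of_real ev) * (8 + V) ^ (12 * i) \<le> 3 * \<delta> * (8 + V) ^ (12 * i)"
      using V by (intro mult_right_mono) auto
    then have close: "cmod (z - of_real ev) * (8 + V) ^ (12 * i) \<le> 1" using scale by linarith
    \<comment> \<open>The trace 2 at an index beyond \<open>12 * i\<close> bounds all earlier traces
      at \<open>ev\<close>; closeness carries the bounds over to z.\<close>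
    have tr_z: "cmod (fib_trace V z n) \<le> 7 + V" if "n \<le> 12 * i" for n
    proof (rule fib_trace_perturb[OF V _ close that])
      fix n assume "n \<le> 12 * i"
      then show "cmod (fib_trace V (of_real ev) n) \<le> 6 + V"
        using j tr by (intro fib_trace_bounded[OF V, of _ "Suc j"]) auto
    qed
    have "c ^ i * mass \<phi> {n. \<bar>n - m\<bar> < int (fib (6 * i))}
        \<le> 2 * mass \<phi> {n. \<bar>n - m\<bar> < int (fib (6 * i + 6 * i))}"
      unfolding c_def
    proof (rule mass_growth[OF _ tr_z])
      fix n assume "n \<noteq> m"
      then show "\<phi> (n + 1) + \<phi> (n - 1) + of_real (fib_potential V \<omega> n) * \<phi> n = z * \<phi> n"
        using eq[of n] by (simp add: fib_H_def site_def z_def)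
    qed (use i in auto)
    then have "c ^ i * mass \<phi> {n. \<bar>n - m\<bar> < int (fib (6 * i))}
        \<le> 2 * mass \<phi> {n. \<bar>n - m\<bar> < int (fib (12 * i))}"
      by (simp add: mult_2[symmetric] del: mult_2)
    then have "mass \<phi> {n. \<bar>n - m\<bar> < int (fib (6 * i))}
        \<le> 2 / c ^ i * mass \<phi> {n. \<bar>n - m\<bar> < int (fib (12 * i))}"
      using c by (simp add: field_simps)
    then show ?thesis using nn' unfolding R_def by linarith
  qed
qed

lemma integrable_inverse_square: "integrable lborel (\<lambda>E::real. inverse (1 + E\<^sup>2))"
  using integrable_inverse_1_plus_square by (simp add: set_integrable_def)

abbreviation integrated_mass ::
    "real \<Rightarrow> real \<Rightarrow> (int \<Rightarrow> complex) \<Rightarrow> int set \<Rightarrow> real \<Rightarrow> ennreal" where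
  "integrated_mass V \<omega> \<psi> S T \<equiv>
    \<integral>\<^sup>+t. ennreal (mass (evolution V \<omega> t \<psi>) S) * indicator {0..T} t \<partial>lborel"

text \<open>The dichotomy is integrated over all energies. By Plancherel the mass in the large
  window contributes at most \<pi> T before it is multiplied by 2 / c^i, and the energies of small
  norm contribute a multiple of 1 / \<delta>^2. The constant \<open>K\<close> depends neither on the
  site nor on \<open>i\<close> or \<open>T\<close>.\<close>

lemma window_average:
  fixes V \<omega> :: real
  assumes V: "V > 0"
  obtains K where "K \<ge> 0" "\<And>m i T. 1 \<le> i \<Longrightarrow> (3 * (8 + V) ^ (12 * i)) ^ 4 \<le> T \<Longrightarrow>
    integrated_mass V \<omega> (site m) {n. \<bar>n - m\<bar> < int (fib (6 * i))} T
    \<le> ennreal (exp 2 * (1 / (1 + 1 / (2 * (7 + V)\<^sup>2 + 2)) ^ i + K / 2 ^ i) * T)"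
proof -
  define c where "c = 1 + 1 / (2 * (7 + V)\<^sup>2 + 2)"
  have c: "c > 0" by (simp add: c_def add_pos_nonneg)
  define D where "D = 1 + (2 * (3 + V))\<^sup>2"
  have D: "D \<ge> 0" by (simp add: D_def)
  define J where "J = (\<integral>E. inverse (1 + E\<^sup>2 :: real) \<partial>lborel)"
  have J: "J \<ge> 0" unfolding J_def by (intro Bochner_Integration.integral_nonneg) simp
  define K where "K = D * J / (2 * pi)"
  have K: "K \<ge> 0" using D J by (simp add: K_def)
  have main: "integrated_mass V \<omega> (site m) {n. \<bar>n - m\<bar> < int (fib (6 * i))} T
      \<le> ennreal (exp 2 * (1 / c ^ i + K / 2 ^ i) * T)"
    if i: "1 \<le> i" and T: "(3 * (8 + V) ^ (12 * i)) ^ 4 \<le> T" for m i T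
  proof -
    define X where "X = 3 * (8 + V) ^ (12 * i)"
    have X: "X \<ge> 2 ^ i"
    proof -
      have "(2::real) ^ i \<le> (8 + V) ^ i" using V by (intro power_mono) auto
      also have "\<dots> \<le> (8 + V) ^ (12 * i)" using V by (intro power_increasing) auto
      also have "\<dots> \<le> X" using V by (simp add: X_def)
      finally show ?thesis .
    qed
    have X1: "X \<ge> 1" using X one_le_power[of "2::real" i] by linarith
    have "X ^ 4 \<ge> 1" using X1 by (rule one_le_power)
    then have T1: "T \<ge> 1" using T by (simp add: X_def)
    \<comment> \<open>The fourth root makes 1 / \<delta>^2 = sqrt T, and the lower bound on
      \<open>T\<close> says that this \<delta> is admissible for the trace perturbation.\<close>
    define \<delta> where "\<delta> = 1 / sqrt (sqrt T)"
    define \<epsilon> where "\<epsilon> = 1 / T"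
    have XT: "X \<le> sqrt (sqrt T)"
      using T by (intro real_le_rsqrt) (simp add: X_def flip: power_mult)
    have sT: "sqrt (sqrt T) \<ge> 1" using T1 by simp
    have \<delta>: "\<delta> \<le> 1" "\<delta> > 0" "\<delta>\<^sup>2 = 1 / sqrt T"
      using sT T1 by (simp_all add: \<delta>_def power_divide)
    have \<epsilon>: "0 < \<epsilon>" using T1 by (simp add: \<epsilon>_def)
    have "sqrt (sqrt T) \<le> T"
    proof -
      have "sqrt T \<le> T" using T1 by (simp add: real_le_lsqrt self_le_power)
      moreover from this have "sqrt (sqrt T) \<le> sqrt T" by (rule real_sqrt_le_mono)
      ultimately show ?thesis by linarith
    qed
    then have \<epsilon>\<delta>: "\<epsilon> \<le> \<delta>" using sT T1 by (simp add: \<epsilon>_def \<delta>_def frac_le)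
    have scale: "3 * \<delta> * (8 + V) ^ (12 * i) \<le> 1"
      using XT sT by (simp add: \<delta>_def X_def)
    \<comment> \<open>The relative error of order 1 / sqrt T is traded for 1 / 2^i, so that the
      final bound depends on \<open>i\<close> alone, apart from the factor \<open>T\<close>.\<close>
    have sqrtT: "sqrt T \<le> T / 2 ^ i"
    proof -
      have "2 ^ i \<le> sqrt (sqrt T)" using X XT by linarith
      also have "\<dots> \<le> sqrt T"
        using T1 sT by (simp add: real_le_lsqrt self_le_power)
      finally have "sqrt T * 2 ^ i \<le> sqrt T * sqrt T" using T1 by (intro mult_left_mono) auto
      then show ?thesis using T1 by (simp add: field_simps)
    qed
    let ?a = "\<lambda>t n. (cmod (evolution V \<omega> t (site m) n))\<^sup>2"
    let ?\<phi> = "\<lambda>E n. (cmod (resolvent V \<omega> \<epsilon> (site m) E n))\<^sup>2"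
    let ?W = "{n. \<bar>n - m\<bar> < int (fib (6 * i))}" and ?U = "{n. \<bar>n - m\<bar> < int (fib (12 * i))}"
    have fin: "finite {n. \<bar>n - m\<bar> < L}" for L
      by (rule finite_subset[of _ "{m - L..m + L}"]) auto
    have [measurable]: "(\<lambda>t. evolution V \<omega> t (site m) n) \<in> borel_measurable borel" for n
      by (rule evolution_measurable[OF V site_ell2])
    have [measurable]: "damped V \<omega> \<epsilon> (site m) n \<in> borel_measurable borel" for n
      by (rule damped_measurable[OF V site_ell2 \<epsilon>])
    have [measurable]: "(\<lambda>E. resolvent V \<omega> \<epsilon> (site m) E n) \<in> borel_measurable borel" for n
      unfolding resolvent_def by measurable
    have pt: "ennreal (\<Sum>n\<in>?W. ?\<phi> E n)
        \<le> ennreal (2 / c ^ i) * ennreal (\<Sum>n\<in>?U. ?\<phi> E n) + ennreal (D / \<delta>\<^sup>2) * ennreal (inverse (1 + E\<^sup>2))" for E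
    proof -
      have "(\<Sum>n\<in>?W. ?\<phi> E n) \<le> 2 / c ^ i * (\<Sum>n\<in>?U. ?\<phi> E n) + D / \<delta>\<^sup>2 * inverse (1 + E\<^sup>2)"
        unfolding c_def D_def by (rule resolvent_site_window[OF V \<epsilon> \<epsilon>\<delta> \<delta>(1) scale i])
      then have "ennreal (\<Sum>n\<in>?W. ?\<phi> E n) \<le> ennreal (2 / c ^ i * (\<Sum>n\<in>?U. ?\<phi> E n) + D / \<delta>\<^sup>2 * inverse (1 + E\<^sup>2))"
        by (rule ennreal_leI)
      also have "\<dots> = ennreal (2 / c ^ i * (\<Sum>n\<in>?U. ?\<phi> E n)) + ennreal (D / \<delta>\<^sup>2 * inverse (1 + E\<^sup>2))"
        using c D by (intro ennreal_plus mult_nonneg_nonneg sum_nonneg) auto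
      also have "ennreal (2 / c ^ i * (\<Sum>n\<in>?U. ?\<phi> E n)) = ennreal (2 / c ^ i) * ennreal (\<Sum>n\<in>?U. ?\<phi> E n)"
        using c by (intro ennreal_mult sum_nonneg) auto
      also have "ennreal (D / \<delta>\<^sup>2 * inverse (1 + E\<^sup>2)) = ennreal (D / \<delta>\<^sup>2) * ennreal (inverse (1 + E\<^sup>2))"
        using D by (intro ennreal_mult) auto
      finally show ?thesis .
    qed
    have norm1: "(ell2_norm (site m))\<^sup>2 \<le> 1" using ell2_norm_site[of m] by (simp add: power_le_one)
    have "(\<integral>\<^sup>+E. ennreal (\<Sum>n\<in>?W. ?\<phi> E n) \<partial>lborel)
        \<le> (\<integral>\<^sup>+E. ennreal (2 / c ^ i) * ennreal (\<Sum>n\<in>?U. ?\<phi> E n) + ennreal (D / \<delta>\<^sup>2) * ennreal (inverse (1 + E\<^sup>2)) \<partial>lborel)"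
      by (intro nn_integral_mono pt)
    also have "\<dots> = ennreal (2 / c ^ i) * (\<integral>\<^sup>+E. ennreal (\<Sum>n\<in>?U. ?\<phi> E n) \<partial>lborel)
        + ennreal (D / \<delta>\<^sup>2) * (\<integral>\<^sup>+E. ennreal (inverse (1 + E\<^sup>2)) \<partial>lborel)"
    proof -
      have "(\<integral>\<^sup>+E. ennreal (D / \<delta>\<^sup>2) * ennreal (inverse (1 + E\<^sup>2)) \<partial>lborel)
          = ennreal (D / \<delta>\<^sup>2) * (\<integral>\<^sup>+E. ennreal (inverse (1 + E\<^sup>2)) \<partial>lborel)"
        by (rule nn_integral_cmult) measurable
      moreover have "(\<integral>\<^sup>+E. ennreal (2 / c ^ i) * ennreal (\<Sum>n\<in>?U. ?\<phi> E n) \<partial>lborel)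
          = ennreal (2 / c ^ i) * (\<integral>\<^sup>+E. ennreal (\<Sum>n\<in>?U. ?\<phi> E n) \<partial>lborel)"
        by (rule nn_integral_cmult) measurable
      ultimately show ?thesis by (subst nn_integral_add) measurable
    qed
    also have "(\<integral>\<^sup>+E. ennreal (inverse (1 + E\<^sup>2)) \<partial>lborel) = ennreal J"
      unfolding J_def by (intro nn_integral_eq_integral integrable_inverse_square AE_I2) simp
    also have "(\<integral>\<^sup>+E. ennreal (\<Sum>n\<in>?U. ?\<phi> E n) \<partial>lborel) \<le> ennreal (pi * T)"
    proof (rule order_trans[OF sum_resolvent_plancherel_le[OF V site_ell2 \<epsilon> fin]])
      have "pi / \<epsilon> * (ell2_norm (site m))\<^sup>2 \<le> pi / \<epsilon> * 1"
        using norm1 \<epsilon> by (intro mult_left_mono) auto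
      then show "ennreal (pi / \<epsilon> * (ell2_norm (site m))\<^sup>2) \<le> ennreal (pi * T)"
        by (intro ennreal_leI) (simp add: \<epsilon>_def)
    qed
    also have "ennreal (2 / c ^ i) * ennreal (pi * T) + ennreal (D / \<delta>\<^sup>2) * ennreal J
        = ennreal (2 * pi * (T / c ^ i + K * sqrt T))"
    proof -
      have "D / \<delta>\<^sup>2 * J = 2 * pi * (K * sqrt T)" by (simp add: \<delta> K_def)
      then have eq: "2 * pi * (T / c ^ i + K * sqrt T) = 2 / c ^ i * (pi * T) + D / \<delta>\<^sup>2 * J"
        by (simp add: distrib_left)
      have "ennreal (2 / c ^ i) * ennreal (pi * T) = ennreal (2 / c ^ i * (pi * T))"
        using c T1 by (intro ennreal_mult[symmetric]) auto
      moreover have "ennreal (D / \<delta>\<^sup>2) * ennreal J = ennreal (D / \<delta>\<^sup>2 * J)"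
        using D J by (intro ennreal_mult[symmetric]) auto
      moreover have "ennreal (2 / c ^ i * (pi * T) + D / \<delta>\<^sup>2 * J) = ennreal (2 / c ^ i * (pi * T)) + ennreal (D / \<delta>\<^sup>2 * J)"
        using c T1 D J by (intro ennreal_plus) auto
      ultimately show ?thesis unfolding eq by simp
    qed
    finally have energy: "(\<integral>\<^sup>+E. ennreal (\<Sum>n\<in>?W. ?\<phi> E n) \<partial>lborel) \<le> ennreal (2 * pi * (T / c ^ i + K * sqrt T))"
      by (simp add: add_mono mult_left_mono)
    have "(\<integral>\<^sup>+E. ennreal (\<Sum>n\<in>?W. ?\<phi> E n) \<partial>lborel) = (\<Sum>n\<in>?W. \<integral>\<^sup>+E. ennreal (?\<phi> E n) \<partial>lborel)"
      by (subst nn_integral_sum[symmetric]) auto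
    also have "\<dots> = ennreal (2 * pi) * (\<Sum>n\<in>?W. \<integral>\<^sup>+t. ennreal (decay (2 * \<epsilon>) t * ?a t n) \<partial>lborel)"
      unfolding resolvent_plancherel[OF V site_ell2 \<epsilon>] sum_distrib_left ..
    also have "(\<Sum>n\<in>?W. \<integral>\<^sup>+t. ennreal (decay (2 * \<epsilon>) t * ?a t n) \<partial>lborel)
        = (\<integral>\<^sup>+t. ennreal (decay (2 * \<epsilon>) t * (\<Sum>n\<in>?W. ?a t n)) \<partial>lborel)"
      by (subst nn_integral_sum[symmetric]) (auto simp: sum_distrib_left)
    finally have time_energy: "(\<integral>\<^sup>+E. ennreal (\<Sum>n\<in>?W. ?\<phi> E n) \<partial>lborel)
        = ennreal (2 * pi) * (\<integral>\<^sup>+t. ennreal (decay (2 * \<epsilon>) t * (\<Sum>n\<in>?W. ?a t n)) \<partial>lborel)" .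
    have "ennreal (2 * pi * (T / c ^ i + K * sqrt T)) = ennreal (2 * pi) * ennreal (T / c ^ i + K * sqrt T)"
      using c T1 K by (intro ennreal_mult) auto
    with energy have "ennreal (2 * pi) * (\<integral>\<^sup>+t. ennreal (decay (2 * \<epsilon>) t * (\<Sum>n\<in>?W. ?a t n)) \<partial>lborel)
        \<le> ennreal (2 * pi) * ennreal (T / c ^ i + K * sqrt T)"
      by (simp only: time_energy)
    then have time: "(\<integral>\<^sup>+t. ennreal (decay (2 * \<epsilon>) t * (\<Sum>n\<in>?W. ?a t n)) \<partial>lborel)
        \<le> ennreal (T / c ^ i + K * sqrt T)"
      by (simp add: ennreal_mult_le_mult_iff)
    \<comment> \<open>Up to time T the damping exp (- 2 t / T) is at least exp (- 2), so a sharp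
      time average is dominated by the exponential one.\<close>
    have "(\<integral>\<^sup>+t. ennreal (\<Sum>n\<in>?W. ?a t n) * indicator {0..T} t \<partial>lborel)
        \<le> (\<integral>\<^sup>+t. ennreal (exp 2) * ennreal (decay (2 * \<epsilon>) t * (\<Sum>n\<in>?W. ?a t n)) \<partial>lborel)"
    proof (intro nn_integral_mono)
      fix t :: real
      show "ennreal (\<Sum>n\<in>?W. ?a t n) * indicator {0..T} t
          \<le> ennreal (exp 2) * ennreal (decay (2 * \<epsilon>) t * (\<Sum>n\<in>?W. ?a t n))"
      proof (cases "t \<in> {0..T}")
        case True
        then have "2 * \<epsilon> * t \<le> 2" using T1 by (simp add: \<epsilon>_def field_simps)
        then have "1 \<le> exp 2 * exp (- (2 * \<epsilon>) * t)" by (simp add: exp_add[symmetric])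
        then have "1 * (\<Sum>n\<in>?W. ?a t n) \<le> exp 2 * exp (- (2 * \<epsilon>) * t) * (\<Sum>n\<in>?W. ?a t n)"
          by (intro mult_right_mono) (auto simp: sum_nonneg)
        then show ?thesis
          using True by (simp add: ennreal_mult[symmetric] sum_nonneg mult_ac ennreal_leI)
      qed simp
    qed
    also have "\<dots> = ennreal (exp 2) * (\<integral>\<^sup>+t. ennreal (decay (2 * \<epsilon>) t * (\<Sum>n\<in>?W. ?a t n)) \<partial>lborel)"
      by (rule nn_integral_cmult) measurable
    also have "\<dots> \<le> ennreal (exp 2) * ennreal (T / c ^ i + K * sqrt T)"
      by (rule mult_left_mono[OF time]) simp
    also have "\<dots> = ennreal (exp 2 * (T / c ^ i + K * sqrt T))"
      using c T1 K by (simp add: ennreal_mult)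
    also have "\<dots> \<le> ennreal (exp 2 * (1 / c ^ i + K / 2 ^ i) * T)"
    proof (rule ennreal_leI)
      have "T / c ^ i + K * sqrt T \<le> (1 / c ^ i + K / 2 ^ i) * T"
        using mult_left_mono[OF sqrtT K] by (simp add: algebra_simps)
      then show "exp 2 * (T / c ^ i + K * sqrt T) \<le> exp 2 * (1 / c ^ i + K / 2 ^ i) * T"
        unfolding mult.assoc by (intro mult_left_mono) auto
    qed
    finally show ?thesis .
  qed
  show thesis by (rule that[OF K main[unfolded c_def]])
qed


section \<open>From point masses to arbitrary states\<close>

lemma evolution_linear:
  assumes V: "V > 0" and f: "f \<in> ell2" and g: "g \<in> ell2"
  shows "evolution V \<omega> t (\<lambda>n. c * f n + g n) n = c * evolution V \<omega> t f n + evolution V \<omega> t g n"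
proof -
  have H: "(fib_H V \<omega> ^^ k) (\<lambda>n. c * f n + g n) = (\<lambda>n. c * (fib_H V \<omega> ^^ k) f n + (fib_H V \<omega> ^^ k) g n)" for k
    by (induction k) (simp_all add: fib_H_def fun_eq_iff algebra_simps)
  have sm: "summable (\<lambda>k. (- \<i> * of_real t) ^ k / fact k * (fib_H V \<omega> ^^ k) h n)" if "h \<in> ell2" for h
  proof -
    have "(\<lambda>k. (- \<i> * of_real t) ^ k / fact k * (fib_H V \<omega> ^^ k) h n)
        = (\<lambda>k. (- \<i>) ^ k / fact k * (fib_H V \<omega> ^^ k) h n * of_real t ^ k)"
      unfolding power_mult_distrib by (simp add: fun_eq_iff)
    then show ?thesis
      using evolution_power_series(1)[OF V that, where \<omega> = \<omega> and n = n and z = "of_real t"] by simp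
  qed
  have "(\<lambda>k. c * ((- \<i> * of_real t) ^ k / fact k * (fib_H V \<omega> ^^ k) f n) + (- \<i> * of_real t) ^ k / fact k * (fib_H V \<omega> ^^ k) g n)
      sums (c * evolution V \<omega> t f n + evolution V \<omega> t g n)"
    unfolding evolution_def by (intro sums_add sums_mult summable_sums sm f g)
  then show ?thesis
    unfolding evolution_def H by (simp add: sums_iff algebra_simps)
qed

lemma evolution_sites:
  assumes V: "V > 0" and \<rho>: "\<rho> \<in> ell2" and "finite M"
  shows "(\<lambda>n. (\<Sum>m\<in>M. c m * site m n) + \<rho> n) \<in> ell2 \<and>
    evolution V \<omega> t (\<lambda>n. (\<Sum>m\<in>M. c m * site m n) + \<rho> n) n
      = (\<Sum>m\<in>M. c m * evolution V \<omega> t (site m) n) + evolution V \<omega> t \<rho> n"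
  using \<open>finite M\<close>
proof (induction M rule: finite_induct)
  case empty
  show ?case using \<rho> by simp
next
  case (insert m M)
  have eq: "(\<lambda>n. (\<Sum>m\<in>insert m M. c m * site m n) + \<rho> n)
      = (\<lambda>n. c m * site m n + ((\<Sum>m\<in>M. c m * site m n) + \<rho> n))"
    using insert by (simp add: add.assoc)
  show ?case
    unfolding eq using insert ell2_add(1)[OF ell2_scale(1)[OF site_ell2]] evolution_linear[OF V site_ell2]
    by (simp add: add.assoc)
qed

text \<open>Each further six indices multiply the Fibonacci number by at least 13, and
  \<open>fib 6\<close> = 8 starts the induction. This bound is the origin of the \<open>ln 8\<close>
  in the exponent.\<close>

lemma fib_6_ge: "i \<ge> 1 \<Longrightarrow> 8 ^ i \<le> fib (6 * i)"
proof (induction i rule: nat_induct_at_least)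
  case base
  show ?case by (simp add: eval_nat_numeral)
next
  case (Suc i)
  have "fib (6 * Suc i) = 5 * fib (6 * i) + 8 * fib (Suc (6 * i))"
    by (simp add: eval_nat_numeral)
  moreover have "fib (6 * i) \<le> fib (Suc (6 * i))" by (rule fib_Suc_mono)
  ultimately show ?case using Suc by simp
qed

lemma finite_double_abs_less: "finite {n::int. 2 * \<bar>n\<bar> < L}"
  by (rule finite_subset[of _ "{- L..L}"]) auto

text \<open>Cauchy-Schwarz over the finitely many sites of the main part, while the remainder keeps
  its norm. The condition 2 |n| < 8^i leaves room for the displacement of the sites: |m| \<le> N <
  8^i / 2, so the common window lies inside the window around every \<open>m\<close>.\<close>

lemma central_mass_split:
  assumes V: "V > 0" and \<rho>: "\<rho> \<in> ell2" and t: "t \<ge> 0" and i: "i \<ge> 1" and N: "2 * N < 8 ^ i"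
    and \<psi>: "\<psi> = (\<lambda>n. (\<Sum>m\<in>{- int N..int N}. c m * site m n) + \<rho> n)"
  shows "mass (evolution V \<omega> t \<psi>) {n. 2 * \<bar>n\<bar> < 8 ^ i}
    \<le> 2 * (\<Sum>m\<in>{- int N..int N}. (cmod (c m))\<^sup>2) *
        (\<Sum>m\<in>{- int N..int N}. \<Sum>n | \<bar>n - m\<bar> < int (fib (6 * i)). (cmod (evolution V \<omega> t (site m) n))\<^sup>2)
      + 2 * (ell2_norm \<rho>)\<^sup>2"
proof -
  let ?M = "{- int N..int N}" and ?G = "{n::int. 2 * \<bar>n\<bar> < 8 ^ i}"
  let ?a = "\<lambda>m n. cmod (evolution V \<omega> t (site m) n)"
  define S where "S = (\<Sum>m\<in>?M. (cmod (c m))\<^sup>2)"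
  have pt: "(cmod (evolution V \<omega> t \<psi> n))\<^sup>2 \<le> 2 * S * (\<Sum>m\<in>?M. (?a m n)\<^sup>2) + 2 * (cmod (evolution V \<omega> t \<rho> n))\<^sup>2" for n
  proof -
    have "cmod (evolution V \<omega> t \<psi> n) \<le> cmod (\<Sum>m\<in>?M. c m * evolution V \<omega> t (site m) n) + cmod (evolution V \<omega> t \<rho> n)"
      unfolding \<psi> using evolution_sites[OF V \<rho>, of ?M c \<omega> t n] norm_triangle_ineq by simp
    also have "\<dots> \<le> (\<Sum>m\<in>?M. cmod (c m) * ?a m n) + cmod (evolution V \<omega> t \<rho> n)"
      by (intro add_right_mono order_trans[OF norm_sum]) (simp add: norm_mult)
    finally have "(cmod (evolution V \<omega> t \<psi> n))\<^sup>2 \<le> ((\<Sum>m\<in>?M. cmod (c m) * ?a m n) + cmod (evolution V \<omega> t \<rho> n))\<^sup>2"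
      by (intro power_mono) auto
    also have "\<dots> \<le> 2 * (\<Sum>m\<in>?M. cmod (c m) * ?a m n)\<^sup>2 + 2 * (cmod (evolution V \<omega> t \<rho> n))\<^sup>2"
      using sum_squares_bound[of "\<Sum>m\<in>?M. cmod (c m) * ?a m n" "cmod (evolution V \<omega> t \<rho> n)"]
      by (simp add: power2_sum)
    also have "(\<Sum>m\<in>?M. cmod (c m) * ?a m n)\<^sup>2 \<le> S * (\<Sum>m\<in>?M. (?a m n)\<^sup>2)"
      unfolding S_def by (rule Cauchy_Schwarz_ineq_sum)
    finally show ?thesis by simp
  qed
  have "mass (evolution V \<omega> t \<psi>) ?G
      \<le> (\<Sum>n\<in>?G. 2 * S * (\<Sum>m\<in>?M. (?a m n)\<^sup>2) + 2 * (cmod (evolution V \<omega> t \<rho> n))\<^sup>2)"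
    by (intro sum_mono pt)
  also have "\<dots> = 2 * S * (\<Sum>m\<in>?M. \<Sum>n\<in>?G. (?a m n)\<^sup>2) + 2 * mass (evolution V \<omega> t \<rho>) ?G"
    unfolding sum.distrib sum_distrib_left[symmetric] by (subst sum.swap) simp
  also have "\<dots> \<le> 2 * S * (\<Sum>m\<in>?M. \<Sum>n | \<bar>n - m\<bar> < int (fib (6 * i)). (?a m n)\<^sup>2) + 2 * (ell2_norm \<rho>)\<^sup>2"
  proof (intro add_mono mult_left_mono sum_mono)
    have "mass (evolution V \<omega> t \<rho>) ?G \<le> (ell2_norm (evolution V \<omega> t \<rho>))\<^sup>2"
      by (rule sum_le_ell2_norm[OF evolution_ell2_limit(1)[OF V \<rho>] finite_double_abs_less])
    then show "mass (evolution V \<omega> t \<rho>) ?G \<le> (ell2_norm \<rho>)\<^sup>2"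
      by (simp add: ell2_norm_evolution[OF V \<rho> t])
    fix m assume m: "m \<in> ?M"
    have "int (2 * N) < int (8 ^ i)" using N by (simp only: of_nat_less_iff)
    then have "2 * int N < 8 ^ i" by simp
    moreover have "int (8 ^ i) \<le> int (fib (6 * i))" using fib_6_ge[OF i] by (simp only: of_nat_le_iff)
    then have "8 ^ i \<le> int (fib (6 * i))" by (simp only: of_nat_power of_nat_numeral)
    ultimately have "?G \<subseteq> {n. \<bar>n - m\<bar> < int (fib (6 * i))}"
    proof -
      define L where "L = int (fib (6 * i))"
      assume "2 * int N < 8 ^ i" "8 ^ i \<le> int (fib (6 * i))"
      then have "2 * int N < 8 ^ i" "8 ^ i \<le> L" by (simp_all only: L_def)
      then show ?thesis using m unfolding L_def[symmetric] by auto
    qed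
    moreover have "finite {n. \<bar>n - m\<bar> < int (fib (6 * i))}"
      by (rule finite_subset[of _ "{m - int (fib (6 * i))..m + int (fib (6 * i))}"]) auto
    ultimately show "(\<Sum>n\<in>?G. (?a m n)\<^sup>2) \<le> (\<Sum>n | \<bar>n - m\<bar> < int (fib (6 * i)). (?a m n)\<^sup>2)"
      by (intro sum_mono2) auto
  qed (simp_all add: S_def sum_nonneg)
  finally show ?thesis by (simp only: S_def)
qed

text \<open>The number of sites needed to approximate the state is fixed, while the bound for a
  single site tends to 0 with \<open>i\<close>, uniformly in the admissible \<open>T\<close>. No
  rate is required.\<close>

lemma central_mass_average:
  assumes V: "V > 0" and \<psi>: "\<psi> \<in> ell2" and pos: "ell2_norm \<psi> > 0"
  shows "\<exists>i0. \<forall>i\<ge>i0. \<forall>T\<ge>(3 * (8 + V) ^ (12 * i)) ^ 4.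
    integrated_mass V \<omega> \<psi> {n. 2 * \<bar>n\<bar> < 8 ^ i} T
    \<le> ennreal ((ell2_norm \<psi>)\<^sup>2 / 4 * T)"
proof -
  define x where "x = ell2_norm \<psi>"
  have x: "x > 0" using pos by (simp add: x_def)
  \<comment> \<open>A remainder of norm x / 4 contributes at most 2 (x / 4)^2 = x^2 / 8, and the
    point masses are given the other x^2 / 8.\<close>
  obtain N :: nat where tail: "(\<lambda>n. if \<bar>n\<bar> \<le> int N then 0 else \<psi> n) \<in> ell2"
    "ell2_norm (\<lambda>n. if \<bar>n\<bar> \<le> int N then 0 else \<psi> n) \<le> x / 4"
    using ell2_tail[OF \<psi>, of "x / 4"] x by auto
  define \<rho> where "\<rho> = (\<lambda>n. if \<bar>n\<bar> \<le> int N then 0 else \<psi> n)"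
  let ?M = "{- int N..int N}"
  have \<rho>: "\<rho> \<in> ell2" "(ell2_norm \<rho>)\<^sup>2 \<le> x\<^sup>2 / 16"
    using tail power_mono[OF tail(2), of 2] by (simp_all add: \<rho>_def power_divide)
  have \<psi>_eq: "\<psi> = (\<lambda>n. (\<Sum>m\<in>?M. \<psi> m * site m n) + \<rho> n)"
  proof
    fix n
    have "(\<Sum>m\<in>?M. \<psi> m * site m n) = (\<Sum>m\<in>?M. if m = n then \<psi> m else 0)"
      by (intro sum.cong) (auto simp: site_def)
    then show "\<psi> n = (\<Sum>m\<in>?M. \<psi> m * site m n) + \<rho> n"
      by (auto simp: \<rho>_def abs_le_iff)
  qed
  obtain K where K: "K \<ge> 0" and avg: "\<And>m i T. 1 \<le> i \<Longrightarrow> (3 * (8 + V) ^ (12 * i)) ^ 4 \<le> T \<Longrightarrow>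
    integrated_mass V \<omega> (site m) {n. \<bar>n - m\<bar> < int (fib (6 * i))} T
    \<le> ennreal (exp 2 * (1 / (1 + 1 / (2 * (7 + V)\<^sup>2 + 2)) ^ i + K / 2 ^ i) * T)"
    using window_average[OF V, of \<omega>] by blast
  define c where "c = 1 + 1 / (2 * (7 + V)\<^sup>2 + 2)"
  have c: "c > 1" by (simp add: c_def add_nonneg_pos)
  define b where "b i = exp 2 * ((1 / c) ^ i + K * (1 / 2) ^ i)" for i
  have b_eq: "exp 2 * (1 / c ^ i + K / 2 ^ i) = b i" for i
    by (simp add: b_def power_divide)
  have b0: "b i \<ge> 0" for i using c K by (simp add: b_def)
  have "b \<longlonglongrightarrow> exp 2 * (0 + K * 0)"
    unfolding b_def using c by (intro tendsto_intros LIMSEQ_realpow_zero) auto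
  then have "b \<longlonglongrightarrow> 0" by simp
  then have "(\<lambda>i. 2 * x\<^sup>2 * (real (card ?M) * b i)) \<longlonglongrightarrow> 2 * x\<^sup>2 * (real (card ?M) * 0)"
    by (intro tendsto_intros)
  then have "\<forall>\<^sub>F i in sequentially. 2 * x\<^sup>2 * (real (card ?M) * b i) < x\<^sup>2 / 8"
    by (rule order_tendstoD(2)) (use x in simp)
  moreover have "\<forall>\<^sub>F i in sequentially. 2 * N < 8 ^ i"
  proof (rule eventually_sequentiallyI[of "2 * N"])
    fix i :: nat assume "2 * N \<le> i"
    also have "i < 2 ^ i" by (rule less_exp)
    also have "(2::nat) ^ i \<le> 8 ^ i" by (intro power_mono) auto
    finally show "2 * N < 8 ^ i" .
  qed
  ultimately have "\<forall>\<^sub>F i in sequentially. 2 * x\<^sup>2 * (real (card ?M) * b i) < x\<^sup>2 / 8 \<and> 2 * N < 8 ^ i \<and> 1 \<le> i"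
    using eventually_ge_at_top[of "1::nat"] by eventually_elim auto
  then obtain i0 where i0: "\<And>i. i \<ge> i0 \<Longrightarrow> 2 * x\<^sup>2 * (real (card ?M) * b i) < x\<^sup>2 / 8 \<and> 2 * N < 8 ^ i \<and> 1 \<le> i"
    unfolding eventually_sequentially by blast
  show ?thesis
  proof (intro exI[of _ i0] allI impI)
    fix i :: nat and T :: real
    assume "i0 \<le> i" and T: "(3 * (8 + V) ^ (12 * i)) ^ 4 \<le> T"
    then have small: "2 * x\<^sup>2 * (real (card ?M) * b i) < x\<^sup>2 / 8" and N: "2 * N < 8 ^ i" and i: "1 \<le> i"
      using i0 by blast+
    have T0: "T \<ge> 0" using T V by (meson add_nonneg_nonneg less_imp_le mult_nonneg_nonneg order_trans zero_le_numeral zero_le_power)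
    let ?w = "\<lambda>m t. \<Sum>n | \<bar>n - m\<bar> < int (fib (6 * i)). (cmod (evolution V \<omega> t (site m) n))\<^sup>2"
    let ?S = "\<lambda>t. \<Sum>n | 2 * \<bar>n\<bar> < 8 ^ i. (cmod (evolution V \<omega> t \<psi> n))\<^sup>2"
    have [measurable]: "(\<lambda>t. evolution V \<omega> t (site m) n) \<in> borel_measurable borel" for m n
      by (rule evolution_measurable[OF V site_ell2])
    have cx: "(\<Sum>m\<in>?M. (cmod (\<psi> m))\<^sup>2) \<le> x\<^sup>2"
      unfolding x_def by (rule sum_le_ell2_norm[OF \<psi>]) simp
    have pt: "ennreal (?S t) * indicator {0..T} t
        \<le> ennreal (2 * x\<^sup>2) * (\<Sum>m\<in>?M. ennreal (?w m t) * indicator {0..T} t) + ennreal (x\<^sup>2 / 8) * indicator {0..T} t" for t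
    proof (cases "t \<in> {0..T}")
      case True
      then have "?S t \<le> 2 * (\<Sum>m\<in>?M. (cmod (\<psi> m))\<^sup>2) * (\<Sum>m\<in>?M. ?w m t) + 2 * (ell2_norm \<rho>)\<^sup>2"
        by (intro central_mass_split[OF V \<rho>(1) _ i N \<psi>_eq]) simp
      also have "\<dots> \<le> 2 * x\<^sup>2 * (\<Sum>m\<in>?M. ?w m t) + x\<^sup>2 / 8"
        using cx \<rho>(2) by (intro add_mono mult_right_mono) (auto simp: sum_nonneg)
      finally have "ennreal (?S t) \<le> ennreal (2 * x\<^sup>2 * (\<Sum>m\<in>?M. ?w m t) + x\<^sup>2 / 8)"
        by (rule ennreal_leI)
      also have "\<dots> = ennreal (2 * x\<^sup>2) * (\<Sum>m\<in>?M. ennreal (?w m t)) + ennreal (x\<^sup>2 / 8)"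
        by (simp add: ennreal_mult sum_nonneg sum_ennreal)
      finally show ?thesis using True by simp
    qed simp
    have "(\<integral>\<^sup>+t. ennreal (?S t) * indicator {0..T} t \<partial>lborel)
        \<le> (\<integral>\<^sup>+t. ennreal (2 * x\<^sup>2) * (\<Sum>m\<in>?M. ennreal (?w m t) * indicator {0..T} t) + ennreal (x\<^sup>2 / 8) * indicator {0..T} t \<partial>lborel)"
      by (intro nn_integral_mono pt)
    also have "\<dots> = (\<integral>\<^sup>+t. ennreal (2 * x\<^sup>2) * (\<Sum>m\<in>?M. ennreal (?w m t) * indicator {0..T} t) \<partial>lborel)
        + (\<integral>\<^sup>+t. ennreal (x\<^sup>2 / 8) * indicator {0..T} t \<partial>lborel)"
      by (rule nn_integral_add) measurable
    also have "(\<integral>\<^sup>+t. ennreal (2 * x\<^sup>2) * (\<Sum>m\<in>?M. ennreal (?w m t) * indicator {0..T} t) \<partial>lborel)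
        = ennreal (2 * x\<^sup>2) * (\<integral>\<^sup>+t. (\<Sum>m\<in>?M. ennreal (?w m t) * indicator {0..T} t) \<partial>lborel)"
      by (rule nn_integral_cmult) measurable
    also have "(\<integral>\<^sup>+t. (\<Sum>m\<in>?M. ennreal (?w m t) * indicator {0..T} t) \<partial>lborel)
        = (\<Sum>m\<in>?M. \<integral>\<^sup>+t. ennreal (?w m t) * indicator {0..T} t \<partial>lborel)"
      by (rule nn_integral_sum) measurable
    also have "(\<integral>\<^sup>+t. ennreal (x\<^sup>2 / 8) * indicator {0..T} t \<partial>lborel) = ennreal (x\<^sup>2 / 8 * T)"
      using T0 by (subst nn_integral_cmult_indicator) (simp_all only: emeasure_lborel_Icc diff_0_right
          ennreal_mult[OF divide_nonneg_nonneg[OF zero_le_power2 zero_le_numeral]] sets_lborel atLeastAtMost_borel)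
    also have "ennreal (2 * x\<^sup>2) * (\<Sum>m\<in>?M. \<integral>\<^sup>+t. ennreal (?w m t) * indicator {0..T} t \<partial>lborel) + ennreal (x\<^sup>2 / 8 * T)
        \<le> ennreal (2 * x\<^sup>2) * (\<Sum>m\<in>?M. ennreal (b i * T)) + ennreal (x\<^sup>2 / 8 * T)"
      unfolding b_eq[symmetric] c_def by (intro add_right_mono mult_left_mono sum_mono avg i T) simp
    also have "\<dots> = ennreal (2 * x\<^sup>2 * (real (card ?M) * b i) * T + x\<^sup>2 / 8 * T)"
    proof -
      have "(\<Sum>m\<in>?M. ennreal (b i * T)) = ennreal (\<Sum>m\<in>?M. b i * T)"
        using b0 T0 by (intro sum_ennreal) simp
      also have "(\<Sum>m\<in>?M. b i * T) = real (card ?M) * b i * T" by (simp only: sum_constant mult.assoc)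
      finally have "ennreal (2 * x\<^sup>2) * (\<Sum>m\<in>?M. ennreal (b i * T))
          = ennreal (2 * x\<^sup>2) * ennreal (real (card ?M) * b i * T)"
        by (simp only:)
      also have "\<dots> = ennreal (2 * x\<^sup>2 * (real (card ?M) * b i * T))"
        using b0 T0 by (intro ennreal_mult[symmetric] mult_nonneg_nonneg) auto
      finally have eq: "ennreal (2 * x\<^sup>2) * (\<Sum>m\<in>?M. ennreal (b i * T))
          = ennreal (2 * x\<^sup>2 * (real (card ?M) * b i) * T)"
        by (simp only: mult.assoc)
      show ?thesis
        unfolding eq using b0 T0 by (intro ennreal_plus[symmetric] mult_nonneg_nonneg) auto
    qed
    also have "\<dots> \<le> ennreal (x\<^sup>2 / 4 * T)"
    proof (rule ennreal_leI)
      have "2 * x\<^sup>2 * (real (card ?M) * b i) * T \<le> x\<^sup>2 / 8 * T"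
        using small T0 by (intro mult_right_mono) auto
      moreover have "x\<^sup>2 / 8 * T + x\<^sup>2 / 8 * T = x\<^sup>2 / 4 * T" by simp
      ultimately show "2 * x\<^sup>2 * (real (card ?M) * b i) * T + x\<^sup>2 / 8 * T \<le> x\<^sup>2 / 4 * T" by linarith
    qed
    finally show "(\<integral>\<^sup>+t. ennreal (?S t) * indicator {0..T} t \<partial>lborel) \<le> ennreal ((ell2_norm \<psi>)\<^sup>2 / 4 * T)"
      by (simp only: x_def)
  qed
qed

text \<open>By conservation of the norm, what is missing in the centre lies at sites with |n| at
  least 8^i / 2. The estimate is made for finite sets of sites and passed to the limit, as the
  moment may be infinite.\<close>

lemma moment_ge:
  assumes V: "V > 0" and \<psi>: "\<psi> \<in> ell2" and t: "t \<ge> 0" and p: "p > 0"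
  shows "ennreal ((8 ^ i / 2) powr p * ((ell2_norm \<psi>)\<^sup>2 - mass (evolution V \<omega> t \<psi>) {n. 2 * \<bar>n\<bar> < 8 ^ i}))
    \<le> moment V \<omega> \<psi> p t"
proof -
  let ?a = "\<lambda>n. (cmod (evolution V \<omega> t \<psi> n))\<^sup>2" and ?G = "{n::int. 2 * \<bar>n\<bar> < 8 ^ i}"
  let ?L = "(8 ^ i / 2 :: real) powr p"
  have a: "evolution V \<omega> t \<psi> \<in> ell2" by (rule evolution_ell2_limit(1)[OF V \<psi>])
  have "(?a has_sum (ell2_norm \<psi>)\<^sup>2) UNIV"
    using a ell2_norm_evolution[OF V \<psi> t, of \<omega>] ell2_norm_square[of "evolution V \<omega> t \<psi>"]
    by (simp add: ell2_def)
  then have "(sum ?a \<longlongrightarrow> (ell2_norm \<psi>)\<^sup>2) (finite_subsets_at_top UNIV)"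
    by (simp add: has_sum_def)
  then have lim: "((\<lambda>F. ennreal (?L * (sum ?a F - sum ?a ?G))) \<longlongrightarrow> ennreal (?L * ((ell2_norm \<psi>)\<^sup>2 - sum ?a ?G))) (finite_subsets_at_top UNIV)"
    by (intro tendsto_intros)
  have "\<forall>\<^sub>F F in finite_subsets_at_top UNIV. ennreal (?L * (sum ?a F - sum ?a ?G)) \<le> moment V \<omega> \<psi> p t"
  proof (rule eventually_finite_subsets_at_top_weakI)
    fix F :: "int set" assume F: "finite F"
    have "sum ?a F - sum ?a ?G \<le> sum ?a (F - ?G)"
    proof -
      have "sum ?a F = sum ?a (F - ?G) + sum ?a (F \<inter> ?G)"
        using sum.Int_Diff[OF F, of ?a ?G] by (simp only: add.commute)
      moreover have "sum ?a (F \<inter> ?G) \<le> sum ?a ?G"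
        by (intro sum_mono2 finite_double_abs_less) auto
      ultimately show ?thesis by simp
    qed
    then have "?L * (sum ?a F - sum ?a ?G) \<le> ?L * sum ?a (F - ?G)"
      by (intro mult_left_mono) auto
    also have "\<dots> \<le> (\<Sum>n\<in>F - ?G. \<bar>of_int n\<bar> powr p * ?a n)"
      unfolding sum_distrib_left
    proof (intro sum_mono mult_right_mono)
      fix n assume "n \<in> F - ?G"
      then have "8 ^ i \<le> 2 * \<bar>n\<bar>" by auto
      then have "real_of_int (8 ^ i) \<le> real_of_int (2 * \<bar>n\<bar>)" by (simp only: of_int_le_iff)
      then have "8 ^ i / 2 \<le> \<bar>real_of_int n\<bar>" by simp
      then show "?L \<le> \<bar>real_of_int n\<bar> powr p" using p by (intro powr_mono2) auto
    qed simp
    finally have "ennreal (?L * (sum ?a F - sum ?a ?G)) \<le> ennreal (\<Sum>n\<in>F - ?G. \<bar>of_int n\<bar> powr p * ?a n)"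
      by (rule ennreal_leI)
    also have "\<dots> = (\<Sum>n\<in>F - ?G. ennreal (\<bar>of_int n\<bar> powr p * ?a n))"
      by (subst sum_ennreal) auto
    also have "\<dots> \<le> moment V \<omega> \<psi> p t"
      unfolding moment_def using F by (subst nonneg_infsum_complete) (auto intro!: SUP_upper)
    finally show "ennreal (?L * (sum ?a F - sum ?a ?G)) \<le> moment V \<omega> \<psi> p t" .
  qed
  from tendsto_upperbound[OF lim this] show ?thesis by simp
qed

text \<open>On average at least three quarters of the squared norm lie outside the centre. Only the
  lower bound for the moment is split by additivity of the integral; the moment itself enters by
  monotonicity.\<close>

lemma time_average_moment_ge:
  assumes V: "V > 0" and \<psi>: "\<psi> \<in> ell2" and p: "p > 0" and T: "T > 0"
    and avg: "integrated_mass V \<omega> \<psi> {n. 2 * \<bar>n\<bar> < 8 ^ i} T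
      \<le> ennreal ((ell2_norm \<psi>)\<^sup>2 / 4 * T)"
  shows "ennreal ((8 ^ i / 2) powr p * (3 / 4 * (ell2_norm \<psi>)\<^sup>2)) \<le> time_average (moment V \<omega> \<psi> p) T"
proof -
  define x where "x = (ell2_norm \<psi>)\<^sup>2"
  have x: "x \<ge> 0" by (simp add: x_def)
  let ?L = "(8 ^ i / 2 :: real) powr p"
  define S where "S t = mass (evolution V \<omega> t \<psi>) {n. 2 * \<bar>n\<bar> < 8 ^ i}" for t
  have [measurable]: "(\<lambda>t. evolution V \<omega> t \<psi> n) \<in> borel_measurable borel" for n
    by (rule evolution_measurable[OF V \<psi>])
  have [measurable]: "S \<in> borel_measurable borel" unfolding S_def by measurable
  have S0: "S t \<ge> 0" for t by (simp add: S_def sum_nonneg)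
  have Sx: "S t \<le> x" if "t \<ge> 0" for t
    using sum_le_ell2_norm[OF evolution_ell2_limit(1)[OF V \<psi>] finite_double_abs_less, of \<omega> t "8 ^ i"]
    by (simp add: S_def x_def ell2_norm_evolution[OF V \<psi> that])
  define A where "A = (\<integral>\<^sup>+t. ennreal (x - S t) * indicator {0..T} t \<partial>lborel)"
  define B where "B = (\<integral>\<^sup>+t. ennreal (S t) * indicator {0..T} t \<partial>lborel)"
  have "A + B = (\<integral>\<^sup>+t. ennreal (x - S t) * indicator {0..T} t + ennreal (S t) * indicator {0..T} t \<partial>lborel)"
    unfolding A_def B_def by (rule nn_integral_add[symmetric]) measurable
  also have "\<dots> = (\<integral>\<^sup>+t. ennreal x * indicator {0..T} t \<partial>lborel)"
    using S0 Sx by (intro nn_integral_cong) (auto simp: ennreal_plus[symmetric] split: split_indicator simp del: ennreal_plus)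
  also have "\<dots> = ennreal (x * T)"
    using x T by (subst nn_integral_cmult_indicator) (auto simp: ennreal_mult)
  finally have AB: "A + B = ennreal (x * T)" .
  have "ennreal (x / 4 * T) + ennreal (3 / 4 * x * T) = ennreal (x * T)"
    using x T by (subst ennreal_plus[symmetric]) (auto simp: field_simps)
  also have "\<dots> \<le> ennreal (x / 4 * T) + A"
    unfolding AB[symmetric] using avg by (simp add: B_def S_def x_def add.commute add_left_mono)
  finally have A: "ennreal (3 / 4 * x * T) \<le> A"
    by (simp add: ennreal_add_left_cancel_le)
  have "ennreal (?L * (3 / 4 * x)) * ennreal T = ennreal ?L * ennreal (3 / 4 * x * T)"
    using x T by (simp add: ennreal_mult[symmetric] mult_ac)
  also have "\<dots> \<le> ennreal ?L * A" by (intro mult_left_mono A) simp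
  also have "\<dots> = (\<integral>\<^sup>+t. ennreal ?L * (ennreal (x - S t) * indicator {0..T} t) \<partial>lborel)"
    unfolding A_def by (rule nn_integral_cmult[symmetric]) measurable
  also have "\<dots> \<le> (\<integral>\<^sup>+t. moment V \<omega> \<psi> p t * indicator {0..T} t \<partial>lborel)"
  proof (intro nn_integral_mono)
    fix t :: real
    show "ennreal ?L * (ennreal (x - S t) * indicator {0..T} t) \<le> moment V \<omega> \<psi> p t * indicator {0..T} t"
      using moment_ge[OF V \<psi> _ p, of t i \<omega>] Sx[of t]
      by (auto simp: S_def x_def ennreal_mult split: split_indicator)
  qed
  finally have "ennreal (?L * (3 / 4 * x)) * ennreal T / ennreal T \<le> time_average (moment V \<omega> \<psi> p) T"
    unfolding time_average_def by (rule divide_right_mono_ennreal)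
  moreover have "ennreal (?L * (3 / 4 * x)) * ennreal T / ennreal T = ennreal (?L * (3 / 4 * x))"
    using x T by (simp add: ennreal_mult[symmetric] divide_ennreal)
  ultimately show ?thesis by (simp only: x_def)
qed

section \<open>Passage to logarithms and comparison of the exponents\<close>

lemma ennreal_ln_mono:
  assumes "ennreal q \<le> y" "q > 0"
  shows "ereal (ln q) \<le> ennreal_ln y"
proof (cases y)
  case (real r)
  then have "q \<le> r" using assms by (simp add: ennreal_le_iff)
  then show ?thesis using assms real by (simp add: ennreal_ln_def)
qed (simp add: ennreal_ln_def top_ennreal_def[symmetric] infinity_ennreal_def)

text \<open>The numerator is at most 1 / 2, since ln (1 + s) \<le> s and s \<le> 1 / 4. The golden
  ratio is at least 3 / 2 and the other argument at least 2 (3 + V), so their product is at least 8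
  + V. The claimed exponent is thus at most 1 / (32 ln (8 + V)), and ln 8 = 3 ln 2 exceeds 48 /
  32.\<close>

lemma exponent_less:
  assumes V: "V > 0"
  shows "2 * ln (1 + 1 / (2 + 2 * V)\<^sup>2) /
        (ln (1 + 1 / (2 + 2 * V)\<^sup>2) + 16 * ln ((sqrt 5 + 1) / 2)
          + 16 * ln (sqrt (5 + 2 * V) * (3 + V) * largest_root V)) < ln 8 / (48 * ln (8 + V))"
proof -
  define y where "y = ln (1 + 1 / (2 + 2 * V)\<^sup>2)"
  define r where "r = largest_root V"
  have y0: "y > 0" using V by (simp add: y_def ln_gt_zero)
  have "y \<le> 1 / (2 + 2 * V)\<^sup>2"
    unfolding y_def using ln_add_one_self_le_self[of "1 / (2 + 2 * V)\<^sup>2"] V by simp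
  also have "\<dots> \<le> 1 / 2\<^sup>2"
    using V by (intro divide_left_mono power_mono) auto
  finally have y1: "y \<le> 1 / 4" by simp
  have "r > 0" and root: "r ^ 3 - (2 + V) * r - 1 = 0"
    using largest_root[OF V] by (simp_all add: r_def)
  have r1: "r \<ge> 1"
  proof (rule ccontr)
    assume "\<not> r \<ge> 1"
    then have "r ^ 3 \<le> r ^ 1" using \<open>r > 0\<close> by (intro power_decreasing) auto
    moreover have "V * r > 0" using V \<open>r > 0\<close> by simp
    ultimately show False using root \<open>r > 0\<close> by (simp add: algebra_simps)
  qed
  have s5: "sqrt 5 \<ge> 2" by (rule real_le_rsqrt) simp
  have s: "sqrt (5 + 2 * V) \<ge> 2" using V by (intro real_le_rsqrt) simp
  define w where "w = sqrt (5 + 2 * V) * (3 + V) * r"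
  have w: "w \<ge> 2 * (3 + V)"
    unfolding w_def using mult_mono[OF mult_right_mono[OF s, of "3 + V"] r1] V by simp
  have "8 + V \<le> 3 / 2 * (2 * (3 + V))" using V by simp
  also have "\<dots> \<le> (sqrt 5 + 1) / 2 * w"
    using s5 w V by (intro mult_mono) auto
  finally have "ln (8 + V) \<le> ln ((sqrt 5 + 1) / 2 * w)"
    using V by (intro ln_mono) auto
  also have "\<dots> = ln ((sqrt 5 + 1) / 2) + ln w"
    using w V s5 by (intro ln_mult_pos) auto
  finally have den: "16 * ln (8 + V) \<le> 16 * ln ((sqrt 5 + 1) / 2) + 16 * ln w" by simp
  have C: "ln (8 + V) > 0" using V by simp
  have "2 * y / (y + 16 * ln ((sqrt 5 + 1) / 2) + 16 * ln w) \<le> (1 / 2) / (16 * ln (8 + V))"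
    using y0 y1 C den by (intro frac_le) auto
  also have "\<dots> < ln 8 / (48 * ln (8 + V))"
  proof -
    have "ln 8 = ln ((2::real) ^ 3)" by simp
    also have "\<dots> = 3 * ln 2" by (subst ln_realpow) auto
    finally have "ln (8::real) > 3 / 2" using ln2_ge_two_thirds by simp
    then show ?thesis using C by (simp add: field_simps)
  qed
  finally show ?thesis by (simp add: y_def w_def r_def)
qed

text \<open>For given T the largest admissible scale is used: (3 (8 + V)^(12 i))^4 = 81 (8 + V)^(48
  i) \<le> T, so i is about ln T / C with C = 48 ln (8 + V). A moment of order 8^(i p) then yields
  the quotient ln 8 / C in the limit, and rounding and constants disappear after division by ln
  T.\<close>

lemma transport_quotient_ge:
  assumes V: "V > 0" and \<psi>: "\<psi> \<in> ell2" and nz: "ell2_norm \<psi> > 0" and p: "p > 0"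
    and \<beta>: "\<beta> < ln 8 / (48 * ln (8 + V))"
  shows "\<forall>\<^sub>F T in at_top. ereal \<beta> \<le> transport_quotient V \<omega> \<psi> p T"
proof -
  define x where "x = 3 / 4 * (ell2_norm \<psi>)\<^sup>2"
  have x: "x > 0" using nz by (simp add: x_def)
  define C where "C = 48 * ln (8 + V)"
  have C: "C > 0" using V by (simp add: C_def)
  define I where "I T = nat \<lfloor>(ln T - ln 81) / C\<rfloor>" for T :: real
  obtain i0 where i0: "\<And>i T. i \<ge> i0 \<Longrightarrow> T \<ge> (3 * (8 + V) ^ (12 * i)) ^ 4 \<Longrightarrow>
    integrated_mass V \<omega> \<psi> {n. 2 * \<bar>n\<bar> < 8 ^ i} T
    \<le> ennreal ((ell2_norm \<psi>)\<^sup>2 / 4 * T)"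
    using central_mass_average[OF V \<psi> nz, of \<omega>] by blast
  \<comment> \<open>The lower bound for the quotient with the rounded scale replaced by (ln T - ln
    81) / C - 1.\<close>
  define h where "h T = (p * (((ln T - ln 81) / C - 1) * ln 8 - ln 2) + ln x) / (p * ln T)" for T
  have "(h \<longlongrightarrow> ln 8 / C) at_top"
  proof -
    define k where "k = (p * ((- ln 81 / C - 1) * ln 8 - ln 2) + ln x) / p"
    have "((\<lambda>T. ln 8 / C + k / ln T) \<longlongrightarrow> ln 8 / C + 0) at_top"
      by (intro tendsto_intros tendsto_divide_0[OF tendsto_const] filterlim_at_top_imp_at_infinity ln_at_top)
    moreover have "\<forall>\<^sub>F T in at_top. ln 8 / C + k / ln T = h T"
      using eventually_gt_at_top[of "1::real"]
    proof eventually_elim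
      case (elim T)
      then have "ln T > 0" by simp
      then show ?case using p C by (simp add: h_def k_def field_simps)
    qed
    ultimately show ?thesis by (simp add: Lim_transform_eventually)
  qed
  then have ev1: "\<forall>\<^sub>F T in at_top. \<beta> < h T"
    using \<beta> by (intro order_tendstoD(1)) (simp_all add: C_def)
  have ev2: "\<forall>\<^sub>F T in at_top. real i0 \<le> (ln T - ln 81) / C"
  proof -
    have "\<forall>\<^sub>F T in at_top. real i0 * C + ln 81 \<le> ln T"
      using ln_at_top unfolding filterlim_at_top by blast
    then show ?thesis by eventually_elim (use C in \<open>simp add: field_simps\<close>)
  qed
  from ev1 ev2 eventually_gt_at_top[of "1::real"] show ?thesis
  proof eventually_elim
    case (elim T)
    define i where "i = I T"
    have lnT: "ln T > 0" using elim by simp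
    have floor0: "0 \<le> (ln T - ln 81) / C" using elim(2) by linarith
    have i: "real i \<le> (ln T - ln 81) / C" "(ln T - ln 81) / C - 1 \<le> real i"
      unfolding i_def I_def using floor0 by linarith+
    have "i \<ge> i0"
      unfolding i_def I_def using elim(2) by linarith
    have "ln ((3 * (8 + V) ^ (12 * i)) ^ 4) = ln 81 + real i * C"
    proof -
      have "(3 * (8 + V) ^ (12 * i)) ^ 4 = 81 * (8 + V) ^ (48 * i)"
        by (simp add: power_mult_distrib flip: power_mult)
      then show ?thesis using V by (simp add: ln_mult_pos ln_realpow C_def)
    qed
    also have "\<dots> \<le> ln T" using i(1) C by (simp add: field_simps)
    finally have "(3 * (8 + V) ^ (12 * i)) ^ 4 \<le> T"
      using V elim(3) by (subst (asm) ln_le_cancel_iff) auto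
    from i0[OF \<open>i \<ge> i0\<close> this]
    have "ennreal ((8 ^ i / 2) powr p * x) \<le> time_average (moment V \<omega> \<psi> p) T"
      unfolding x_def using elim(3) by (intro time_average_moment_ge[OF V \<psi> p]) auto
    then have ln_le: "ereal (ln ((8 ^ i / 2) powr p * x)) \<le> ennreal_ln (time_average (moment V \<omega> \<psi> p) T)"
      using x by (intro ennreal_ln_mono) auto
    have "ln ((8 ^ i / 2) powr p * x) = p * (real i * ln 8 - ln 2) + ln x"
      using x by (simp add: ln_mult_pos ln_powr ln_div ln_realpow)
    also have "\<dots> \<ge> p * (((ln T - ln 81) / C - 1) * ln 8 - ln 2) + ln x"
      using i(2) p by (intro add_right_mono mult_left_mono diff_right_mono mult_right_mono) auto
    finally have "h T \<le> ln ((8 ^ i / 2) powr p * x) / (p * ln T)"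
      unfolding h_def using p lnT by (intro divide_right_mono) auto
    then have "ereal \<beta> \<le> ereal (ln ((8 ^ i / 2) powr p * x)) / ereal (p * ln T)"
      using elim(1) p lnT by simp
    also have "\<dots> \<le> transport_quotient V \<omega> \<psi> p T"
      unfolding transport_quotient_def using ln_le p lnT by (intro ereal_divide_right_mono) auto
    finally show ?case .
  qed
qed

theorem corollary2:
  fixes V \<omega> p :: real and \<psi> :: "int \<Rightarrow> complex"
  assumes "V > 0" and "\<psi> \<in> ell2" and "\<psi> \<noteq> (\<lambda>n. 0)" and "p > 0"
  shows "let bound =
      2 * ln (1 + 1 / (2 + 2 * V)\<^sup>2) /
        (ln (1 + 1 / (2 + 2 * V)\<^sup>2) + 16 * ln ((sqrt 5 + 1) / 2)
          + 16 * ln (sqrt (5 + 2 * V) * (3 + V) * largest_root V))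
    in beta_plus V \<omega> \<psi> p \<ge> ereal bound \<and> beta_minus V \<omega> \<psi> p \<ge> ereal bound"
proof -
  obtain n where "\<psi> n \<noteq> 0" using assms(3) by (auto simp: fun_eq_iff)
  then have "ell2_norm \<psi> > 0"
    using cmod_le_ell2_norm[OF assms(2), of n] by (metis norm_le_zero_iff not_le order_trans)
  \<comment> \<open>As the inequality between the exponents is strict, the claimed bound itself is
    an eventual lower bound of the quotient, so the lower limit needs no further
    approximation.\<close>
  from transport_quotient_ge[OF assms(1,2) this assms(4) exponent_less[OF assms(1)], of \<omega>]
  have minus: "ereal (2 * ln (1 + 1 / (2 + 2 * V)\<^sup>2) /
        (ln (1 + 1 / (2 + 2 * V)\<^sup>2) + 16 * ln ((sqrt 5 + 1) / 2)
          + 16 * ln (sqrt (5 + 2 * V) * (3 + V) * largest_root V))) \<le> beta_minus V \<omega> \<psi> p"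
    unfolding beta_minus_def by (rule Liminf_bounded)
  moreover have "beta_minus V \<omega> \<psi> p \<le> beta_plus V \<omega> \<psi> p"
    unfolding beta_minus_def beta_plus_def by (rule Liminf_le_Limsup) simp
  ultimately show ?thesis unfolding Let_def using order_trans by blast
qed

end
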